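(* Let $G$ be a group and let $X$ be a non-trivial strongly irreducible $G$-subshift. For every finite alphabet $A$: (1) If $G$ admits a torsion-free element (an element of infinite order), then $\operatorname{Aut}(A^{\mathbb{Z}})$ embeds into $\operatorname{Aut}(X)$. (2) If the free group $F_2$ of rank $2$ embeds into $G$, then $\operatorname{Aut}(A^{F_k})$ embeds into $\operatorname{Aut}(X)$ for every $k\geq 1$.
   Context: Let $B$ be a finite set (alphabet) and $G$ a (discrete) group. $B^G=\{x\colon G\to B\}$ carries the prodiscrete topology and the left shift action $(gx)(h)=x(g^{-1}h)$. A $G$-subshift is a closed, shift-invariant subset $X\subset B^G$ for some finite alphabet $B$; it is non-trivial if it is neither empty nor a single point. For finite $F\subset G$, $L_F(X)=\{x|_F : x\in X\}$. $X$ is strongly irreducible if there is a finite $K\subset G$ such that whenever $S,T\subset G$ are finite with $SK\cap T=\varnothing$, for every $p\in L_S(X)$ and $q\in L_T(X)$ there is $x\in X$ with $x|_S=p$ and $x|_T=q$. $\operatorname{Aut}(X)$ is the group of all $G$-equivariant homeomorphisms $X\to X$ under composition. $F_k$ is the free group of rank $k$, and $\operatorname{Aut}(A^{F_k})$, $\operatorname{Aut}(A^{\mathbb{Z}})$ are the automorphism groups of the full shifts over $F_k$, $\mathbb{Z}$ (equivariant with respect to the corresponding group). "Embeds" means that there is an injective group homomorphism. *)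

theory Defs
  imports "HOL-Analysis.Analysis" "HOL-Algebra.Bij" "HOL-Algebra.Coset" "HOL-Algebra.Elementary_Groups"
begin

text \<open>
  The letter \<open>(i, True)\<close> stands for the generator \<open>i\<close> and \<open>(i, False)\<close> for its inverse.
  The elements of the free group of rank \<open>k\<close> are the reduced words over the generators
  \<open>0, \<dots>, k - 1\<close>.
\<close>

type_synonym letter = "nat \<times> bool"

definition inv_letter :: "letter \<Rightarrow> letter"
  where "inv_letter a = (fst a, \<not> snd a)"

definition reduced_word :: "letter list \<Rightarrow> bool"
  where "reduced_word = successively (\<lambda>a b. b \<noteq> inv_letter a)"

fun push :: "letter \<Rightarrow> letter list \<Rightarrow> letter list"
  where
    "push a [] = [a]"
  | "push a (b # w) = (if b = inv_letter a then w else a # b # w)"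

text \<open>
  If \<open>v\<close> is reduced, then \<open>foldr push u v\<close> is the reduced form of the concatenation of
  \<open>u\<close> and \<open>v\<close>.
\<close>

definition free_group :: "nat \<Rightarrow> letter list monoid"
  where "free_group k =
    \<lparr>carrier = {w. reduced_word w \<and> set w \<subseteq> {..<k} \<times> UNIV},
     mult = foldr push,
     one = []\<rparr>"

lemma inv_letter_inv_letter [simp]: "inv_letter (inv_letter a) = a"
  by (simp add: inv_letter_def)

lemma inv_letter_neq [simp]: "inv_letter a \<noteq> a" "a \<noteq> inv_letter a"
  by (cases a; simp add: inv_letter_def)+

lemma reduced_Nil [simp]: "reduced_word []"
  by (simp add: reduced_word_def)

lemma reduced_ConsD: "reduced_word (a # w) \<Longrightarrow> reduced_word w"
  by (auto simp: reduced_word_def successively_Cons)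

lemma reduced_push: "reduced_word w \<Longrightarrow> reduced_word (push a w)"
  by (cases w) (auto simp: reduced_word_def successively_Cons)

lemma push_reduced_Cons: "reduced_word (a # w) \<Longrightarrow> push a w = a # w"
  by (cases w) (auto simp: reduced_word_def)

lemma push_inv_push: "reduced_word w \<Longrightarrow> push (inv_letter a) (push a w) = w"
  by (cases w) (auto dest: push_reduced_Cons)

lemma push_push_inv: "reduced_word w \<Longrightarrow> push a (push (inv_letter a) w) = w"
  using push_inv_push [of w "inv_letter a"] by simp

lemma set_push: "set (push a w) \<subseteq> insert a (set w)"
  by (cases w) auto

lemma reduced_foldr_push: "reduced_word w \<Longrightarrow> reduced_word (foldr push u w)"
  by (induction u) (auto intro: reduced_push)

lemma set_foldr_push: "set (foldr push u w) \<subseteq> set u \<union> set w"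
  by (induction u) (use set_push in fastforce)+

lemma foldr_push_push:
  assumes "reduced_word w"
  shows "foldr push (push a v) w = push a (foldr push v w)"
proof (cases v)
  case (Cons b v')
  then show ?thesis
    using push_push_inv [of "foldr push v' w" a] reduced_foldr_push [OF assms] by auto
qed simp

lemma foldr_push_assoc:
  "reduced_word w \<Longrightarrow> foldr push (foldr push u v) w = foldr push u (foldr push v w)"
  by (induction u) (auto simp: foldr_push_push)

lemma foldr_push_Nil: "reduced_word u \<Longrightarrow> foldr push u [] = u"
proof (induction u)
  case (Cons a u)
  then show ?case using push_reduced_Cons [of a u] reduced_ConsD [of a u] by simp
qed simp

lemma foldr_push_inverse: "reduced_word u \<Longrightarrow> foldr push (map inv_letter (rev u)) u = []"
proof (induction u)
  case (Cons a u)
  have "push (inv_letter a) (a # u) = u" by simp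
  with Cons show ?case by (auto dest: reduced_ConsD)
qed simp

lemma group_free_group: "group (free_group k)"
proof (rule groupI)
  show "\<exists>y\<in>carrier (free_group k). y \<otimes>\<^bsub>free_group k\<^esub> x = \<one>\<^bsub>free_group k\<^esub>"
    if x: "x \<in> carrier (free_group k)" for x
  proof
    let ?y = "foldr push (map inv_letter (rev x)) []"
    have "reduced_word ?y" by (simp add: reduced_foldr_push)
    moreover have "set ?y \<subseteq> {..<k} \<times> UNIV"
      using x set_foldr_push [of "map inv_letter (rev x)" "[]"]
      by (fastforce simp: free_group_def inv_letter_def)
    ultimately show "?y \<in> carrier (free_group k)"
      by (simp add: free_group_def)
    show "?y \<otimes>\<^bsub>free_group k\<^esub> x = \<one>\<^bsub>free_group k\<^esub>"
      using x by (simp add: free_group_def foldr_push_assoc foldr_push_inverse)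
  qed
next
  fix x y
  assume "x \<in> carrier (free_group k)" "y \<in> carrier (free_group k)"
  then show "x \<otimes>\<^bsub>free_group k\<^esub> y \<in> carrier (free_group k)"
    using set_foldr_push [of x y] by (auto simp: free_group_def reduced_foldr_push)
qed (auto simp: free_group_def foldr_push_assoc)

lemma free_group_universal:
  assumes "group H" and f: "f \<in> {..<k} \<rightarrow> carrier H"
  shows "\<exists>h \<in> hom (free_group k) H. \<forall>i<k. h [(i, True)] = f i"
proof -
  interpret H: group H by fact
  define val where "val a = (if snd a then f (fst a) else inv\<^bsub>H\<^esub> f (fst a))" for a :: letter
  define h where "h w = foldr (\<lambda>a x. val a \<otimes>\<^bsub>H\<^esub> x) w \<one>\<^bsub>H\<^esub>" for w
  define W where "W = {w. set w \<subseteq> {..<k} \<times> (UNIV :: bool set)}"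
  have val: "val a \<in> carrier H" if "fst a < k" for a
    using f that by (auto simp: val_def)
  have val_inv: "val (inv_letter a) = inv\<^bsub>H\<^esub> val a" if "fst a < k" for a
    using f that by (auto simp: val_def inv_letter_def Pi_iff)
  have h_in: "h w \<in> carrier H" if "w \<in> W" for w
    using that by (induction w) (auto simp: h_def W_def intro!: H.m_closed val)
  have h_push: "h (push a w) = val a \<otimes>\<^bsub>H\<^esub> h w" if "fst a < k" "w \<in> W" for a w
  proof (cases w)
    case (Cons b w')
    have "w' \<in> W" using that Cons by (simp add: W_def)
    then have "val a \<otimes>\<^bsub>H\<^esub> (inv\<^bsub>H\<^esub> val a \<otimes>\<^bsub>H\<^esub> h w') = h w'"
      using val [OF that(1)] h_in by (simp add: H.m_assoc [symmetric])
    then show ?thesis using Cons val_inv [OF that(1)] by (auto simp: h_def)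
  qed (simp add: h_def)
  have h_mult: "h (foldr push u v) = h u \<otimes>\<^bsub>H\<^esub> h v" if "u \<in> W" "v \<in> W" for u v
    using that(1)
  proof (induction u)
    case Nil
    then show ?case using h_in [OF that(2)] by (simp add: h_def [of "[]"])
  next
    case (Cons a u)
    then have *: "fst a < k" "u \<in> W" by (auto simp: W_def)
    then have "foldr push u v \<in> W"
      using that set_foldr_push [of u v] by (auto simp: W_def)
    then have "h (foldr push (a # u) v) = val a \<otimes>\<^bsub>H\<^esub> (h u \<otimes>\<^bsub>H\<^esub> h v)"
      using Cons * by (simp add: h_push)
    also have "\<dots> = h (a # u) \<otimes>\<^bsub>H\<^esub> h v"
      using val [OF *(1)] h_in [OF *(2)] h_in [OF that(2)]
      by (simp add: h_def [of "a # u"] h_def [of u, symmetric] H.m_assoc)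
    finally show ?case .
  qed
  have "h \<in> hom (free_group k) H"
    by (rule homI) (auto simp: free_group_def W_def intro!: h_in h_mult)
  moreover have "h [(i, True)] = f i" if "i < k" for i
    using H.r_one [of "f i"] funcset_mem [OF f] that by (simp add: h_def val_def)
  ultimately show ?thesis by blast
qed

lemma free_group_hom_unique:
  assumes "group H" and h: "h \<in> hom (free_group k) H" and h': "h' \<in> hom (free_group k) H"
    and eq: "\<And>i. i < k \<Longrightarrow> h [(i, True)] = h' [(i, True)]"
    and "w \<in> carrier (free_group k)"
  shows "h w = h' w"
  using \<open>w \<in> carrier (free_group k)\<close>
proof (induction w)
  interpret F: group "free_group k" by (rule group_free_group)
  interpret H: group H by fact
  interpret h: group_hom "free_group k" H h using h by unfold_locales
  interpret h': group_hom "free_group k" H h' using h' by unfold_locales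
  {
    case Nil
    then show ?case using h.hom_one h'.hom_one by (simp add: free_group_def)
  next
    case (Cons a w)
    obtain i b where a: "a = (i, b)" by (cases a)
    have i: "i < k" and w: "w \<in> carrier (free_group k)"
      using Cons.prems a by (auto simp: free_group_def dest: reduced_ConsD)
    have letters: "[(i, c)] \<in> carrier (free_group k)" for c
      using i by (simp add: free_group_def reduced_word_def)
    have "inv\<^bsub>free_group k\<^esub> [(i, True)] = [(i, False)]"
      by (rule F.inv_equality) (auto simp: letters, simp add: free_group_def inv_letter_def)
    then have "h [a] = h' [a]"
      using eq [OF i] a h.hom_inv [OF letters [of True]] h'.hom_inv [OF letters [of True]]
      by (cases b) auto
    moreover have "a # w = [a] \<otimes>\<^bsub>free_group k\<^esub> w"
      using Cons.prems by (simp add: free_group_def push_reduced_Cons)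
    ultimately show ?case
      using Cons.IH w a letters h.hom_mult h'.hom_mult by simp
  }
qed

definition full_shift :: "('g, 'm) monoid_scheme \<Rightarrow> 'b set \<Rightarrow> ('g \<Rightarrow> 'b) set"
  where "full_shift G B = carrier G \<rightarrow>\<^sub>E B"

definition prodiscrete :: "('g, 'm) monoid_scheme \<Rightarrow> 'b set \<Rightarrow> ('g \<Rightarrow> 'b) topology"
  where "prodiscrete G B = product_topology (\<lambda>_. discrete_topology B) (carrier G)"

definition shift :: "('g, 'm) monoid_scheme \<Rightarrow> 'g \<Rightarrow> ('g \<Rightarrow> 'b) \<Rightarrow> 'g \<Rightarrow> 'b"
  where "shift G g x = (\<lambda>h \<in> carrier G. x (inv\<^bsub>G\<^esub> g \<otimes>\<^bsub>G\<^esub> h))"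

lemma topspace_prodiscrete [simp]: "topspace (prodiscrete G B) = full_shift G B"
  by (simp add: prodiscrete_def full_shift_def)

definition subshift :: "('g, 'm) monoid_scheme \<Rightarrow> 'b set \<Rightarrow> ('g \<Rightarrow> 'b) set \<Rightarrow> bool"
  where "subshift G B X \<longleftrightarrow>
    finite B \<and> closedin (prodiscrete G B) X \<and> (\<forall>g \<in> carrier G. \<forall>x \<in> X. shift G g x \<in> X)"

definition nontrivial :: "('g \<Rightarrow> 'b) set \<Rightarrow> bool"
  where "nontrivial X \<longleftrightarrow> X \<noteq> {} \<and> (\<nexists>x. X = {x})"

definition patterns :: "'g set \<Rightarrow> ('g \<Rightarrow> 'b) set \<Rightarrow> ('g \<Rightarrow> 'b) set"
  where "patterns F X = (\<lambda>x. restrict x F) ` X"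

definition strongly_irreducible :: "('g, 'm) monoid_scheme \<Rightarrow> ('g \<Rightarrow> 'b) set \<Rightarrow> bool"
  where "strongly_irreducible G X \<longleftrightarrow>
    (\<exists>K. finite K \<and> K \<subseteq> carrier G \<and>
      (\<forall>S T. finite S \<and> S \<subseteq> carrier G \<and> finite T \<and> T \<subseteq> carrier G \<and>
             (S <#>\<^bsub>G\<^esub> K) \<inter> T = {} \<longrightarrow>
        (\<forall>p \<in> patterns S X. \<forall>q \<in> patterns T X.
          \<exists>x \<in> X. restrict x S = p \<and> restrict x T = q)))"

text \<open>Automorphisms are taken to be extensional, so that they are determined by their values on \<open>X\<close>.\<close>

definition shift_automorphisms ::
    "('g, 'm) monoid_scheme \<Rightarrow> 'b set \<Rightarrow> ('g \<Rightarrow> 'b) set \<Rightarrow> (('g \<Rightarrow> 'b) \<Rightarrow> ('g \<Rightarrow> 'b)) set"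
  where "shift_automorphisms G B X =
    {f \<in> extensional X.
       homeomorphic_map (subtopology (prodiscrete G B) X) (subtopology (prodiscrete G B) X) f \<and>
       (\<forall>g \<in> carrier G. \<forall>x \<in> X. f (shift G g x) = shift G g (f x))}"

definition Aut_shift ::
    "('g, 'm) monoid_scheme \<Rightarrow> 'b set \<Rightarrow> ('g \<Rightarrow> 'b) set \<Rightarrow> (('g \<Rightarrow> 'b) \<Rightarrow> ('g \<Rightarrow> 'b)) monoid"
  where "Aut_shift G B X = BijGroup X \<lparr>carrier := shift_automorphisms G B X\<rparr>"

definition embeds :: "('a, 'm) monoid_scheme \<Rightarrow> ('b, 'n) monoid_scheme \<Rightarrow> bool"
  where "embeds G H \<longleftrightarrow> (\<exists>\<phi>. \<phi> \<in> mon G H)"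

lemma subshift_subset: "subshift G B X \<Longrightarrow> X \<subseteq> full_shift G B"
  using closedin_subset [of "prodiscrete G B" X] by (simp add: subshift_def)

lemma shift_in_full_shift:
  assumes "group G" "g \<in> carrier G" "x \<in> full_shift G B"
  shows "shift G g x \<in> full_shift G B"
proof -
  interpret group G by fact
  show ?thesis using assms by (auto simp: full_shift_def shift_def)
qed

lemma subshift_full_shift: "group G \<Longrightarrow> finite B \<Longrightarrow> subshift G B (full_shift G B)"
  using closedin_topspace [of "prodiscrete G B"]
  by (simp add: subshift_def shift_in_full_shift)

lemma group_Aut_shift:
  assumes "subshift G B X"
  shows "group (Aut_shift G B X)"
proof -
  define T where "T = subtopology (prodiscrete G B) X"
  have X: "topspace T = X"
    using subshift_subset [OF assms] by (auto simp: T_def)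
  have inv: "shift G g x \<in> X" if "g \<in> carrier G" "x \<in> X" for g x
    using assms that by (simp add: subshift_def)
  have carr: "shift_automorphisms G B X =
      {f \<in> extensional X. homeomorphic_map T T f \<and>
        (\<forall>g \<in> carrier G. \<forall>x \<in> X. f (shift G g x) = shift G g (f x))}" (is "_ = ?C")
    by (simp add: shift_automorphisms_def T_def)
  have bij: "bij_betw f X X" if "homeomorphic_map T T f" for f
    using that X
    by (metis bij_betw_def homeomorphic_eq_everything_map)
  have sub: "?C \<subseteq> Bij X"
    using bij by (auto simp: Bij_def)
  have "subgroup ?C (BijGroup X)"
  proof (rule group.subgroupI [OF group_BijGroup])
    show "?C \<subseteq> carrier (BijGroup X)" using sub by (simp add: BijGroup_def)
    have "homeomorphic_map T T (\<lambda>x\<in>X. x)"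
      by (rule homeomorphic_map_eq [of T T id]) (auto simp: X)
    then have "(\<lambda>x\<in>X. x) \<in> ?C" using inv by auto
    then show "?C \<noteq> {}" by blast
  next
    fix f assume f: "f \<in> ?C"
    then have fB: "f \<in> Bij X" using sub by blast
    have b: "bij_betw f X X" using f bij by blast
    have i: "inv\<^bsub>BijGroup X\<^esub> f = (\<lambda>x\<in>X. inv_into X f x)"
      using fB by (rule inv_BijGroup)
    obtain g where g: "homeomorphic_maps T T f g"
      using f homeomorphic_map_maps by blast
    have geq: "g x = inv_into X f x" if "x \<in> X" for x
    proof -
      have "g x \<in> X" "f (g x) = x"
        using g that X unfolding homeomorphic_maps_def
        by (auto dest: continuous_map_image_subset_topspace)
      then show ?thesis
        using b by (metis bij_betw_def inv_into_f_f)
    qed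
    have "homeomorphic_map T T g"
      using g homeomorphic_maps_map homeomorphic_maps_sym by blast
    then have "homeomorphic_map T T (\<lambda>x\<in>X. inv_into X f x)"
      by (rule homeomorphic_map_eq) (simp add: X geq)
    moreover have "inv_into X f (shift G a x) = shift G a (inv_into X f x)"
      if "a \<in> carrier G" "x \<in> X" for a x
    proof -
      define y where "y = inv_into X f x"
      have y: "y \<in> X" "f y = x"
        using b that by (auto simp: y_def bij_betw_def f_inv_into_f inv_into_into)
      then have "f (shift G a y) = shift G a x" using f that by auto
      then show ?thesis
        using b inv [OF that(1) y(1)] by (metis bij_betw_def inv_into_f_f y_def)
    qed
    ultimately show "inv\<^bsub>BijGroup X\<^esub> f \<in> ?C"
      using inv by (auto simp: i)
  next
    fix f h assume f: "f \<in> ?C" and h: "h \<in> ?C"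
    have m: "f \<otimes>\<^bsub>BijGroup X\<^esub> h = compose X f h"
      using f h sub by (simp add: BijGroup_def subset_eq)
    have "homeomorphic_map T T (f \<circ> h)"
      using f h homeomorphic_map_compose by blast
    then have "homeomorphic_map T T (compose X f h)"
      by (rule homeomorphic_map_eq) (simp add: X compose_def)
    moreover have "h x \<in> X" if "x \<in> X" for x
      using h bij that by (auto simp: bij_betw_def)
    ultimately show "f \<otimes>\<^bsub>BijGroup X\<^esub> h \<in> ?C"
      using f h inv by (auto simp: m compose_def)
  qed
  then show ?thesis
    using group.subgroup_imp_group [OF group_BijGroup] by (simp add: Aut_shift_def carr)
qed

end

theory Submission
  imports Defs "HOL-Real_Asymp.Real_Asymp"
begin

text \<open>
  Choose a pattern outside a finite set \<open>F\<close> admitting the least number of fillings of \<open>F\<close>. By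
  minimality its fillings can be exchanged in every context, and by strong irreducibility there are
  as many of them as desired once \<open>F\<close> is large; so an occurrence of this pattern can store a symbol.
  A counting argument extends it to a pattern \<open>p\<close> on \<open>S\<close> with an occurrence near which no other
  occurrence can appear, however \<open>F\<close> is filled, apart from those forced by the finite group \<open>act_kernel\<close>
  of elements acting trivially: the extra pattern sits on \<open>n\<close> generic positions, giving \<open>2^n\<close>
  candidates, while only polynomially many translates have to be avoided. Isolated occurrences
  are the markers; their position does not change when the stored symbols do.

  Along a homomorphism \<open>\<phi>\<close> from a free group to \<open>G\<close>, neighbouring markers are linked into
  conveyor belts: each marker stores a symbol on each of two tracks, traversed in opposite
  directions and joined at the ends of a chain. Every generator thus permutes the
  cells, the free group acts on them, and an automorphism of the full shift over a group \<open>H\<close> embedded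
  in the free group acts on the stored symbols, by reading at each cell the configuration along its
  orbit. If \<open>\<phi>\<close> avoids a suitable finite set, arbitrary finite configurations over \<open>H\<close> can be stored, so
  the action is faithful.
\<close>

section \<open>Strongly irreducible subshifts\<close>

text \<open>The obstacle is self-overlap. An element \<open>h\<close> may carry a position
  \<open>t\<close> into \<open>t K\<close>, for instance for every \<open>t\<close> when
  \<open>h\<close> lies in \<open>K\<close> and is central, and no generic choice of positions
  prevents this. At most \<open>card K\<close> elements behave so badly along a suitable infinite
  set of positions (\<open>stable_conjugators\<close>); they are dealt with by a pattern that breaks
  the corresponding symmetries, unless they act trivially on \<open>X\<close>. For every other
  \<open>h\<close> the number of coincidences is bounded independently of \<open>n\<close>, and this
  is what lets \<open>2 ^ n\<close> win. Isolation is required for products of two quotients of the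
  window \<open>S \<union> F\<close>: two markers whose labels touch the same potential occurrence
  of \<open>p\<close> are that far apart, and they must be the same marker up to the kernel. In a
  given point of \<open>X\<close> the markers may form long chains, short chains or none at all.
  Reversing at the ends makes every letter act bijectively in all these cases, so that an
  automorphism can be applied without any assumption on the point.\<close>

definition translate :: "('g, 'm) monoid_scheme \<Rightarrow> 'g \<Rightarrow> ('g \<Rightarrow> 'b) \<Rightarrow> 'g \<Rightarrow> 'b"
  where "translate G h x = (\<lambda>s \<in> carrier G. x (h \<otimes>\<^bsub>G\<^esub> s))"

section \<open>Counting and greedy choice\<close>

text \<open>Union bound: a subset that fails for \<open>h\<close> is prescribed on
  \<open>I h\<close>, hence determined by its trace on the at most \<open>m\<close> remaining
  positions.\<close>

lemma exists_avoiding_subset: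
  fixes u :: "'h \<Rightarrow> nat \<Rightarrow> bool"
  assumes "finite E" "\<And>h. h \<in> E \<Longrightarrow> card {i. i < n \<and> i \<notin> I h} \<le> m" "card E * 2 ^ m < 2 ^ n"
  shows "\<exists>V. \<forall>h\<in>E. \<exists>i\<in>I h. i < n \<and> (i \<in> V) \<noteq> u h i"
proof (rule ccontr)
  assume neg: "\<not> ?thesis"
  define Bad where "Bad h = {V \<in> Pow {..<n}. \<forall>i\<in>I h. i < n \<longrightarrow> (i \<in> V) = u h i}" for h
  have card_Bad: "card (Bad h) \<le> 2 ^ m" if "h \<in> E" for h
  proof -
    let ?D = "{i. i < n \<and> i \<notin> I h}"
    have "inj_on (\<lambda>V. V \<inter> ?D) (Bad h)"
      by (rule inj_onI) (auto simp: Bad_def set_eq_iff, blast+)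
    moreover have "(\<lambda>V. V \<inter> ?D) ` Bad h \<subseteq> Pow ?D" by blast
    ultimately have "card (Bad h) \<le> card (Pow ?D)"
      by (intro card_inj_on_le) auto
    also have "\<dots> = 2 ^ card ?D" by (simp add: card_Pow)
    also have "\<dots> \<le> 2 ^ m" using assms(2) [OF that] by (intro power_increasing) auto
    finally show ?thesis .
  qed
  have "Pow {..<n} \<subseteq> (\<Union>h\<in>E. Bad h)"
    using neg by (auto simp: Bad_def)
  then have "card (Pow {..<n}) \<le> card (\<Union>h\<in>E. Bad h)"
    using \<open>finite E\<close> by (intro card_mono) (auto simp: Bad_def)
  also have "\<dots> \<le> (\<Sum>h\<in>E. card (Bad h))"
    using \<open>finite E\<close> by (rule card_UN_le)
  also have "\<dots> \<le> card E * 2 ^ m"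
    using sum_bounded_above [of E "\<lambda>h. card (Bad h)" "2 ^ m"] card_Bad by simp
  finally show False using assms(3) by (simp add: card_Pow)
qed

lemma infinite_avoid:
  assumes "infinite I" "finite Z" shows "\<exists>t\<in>I. t \<notin> Z"
  using assms by (meson finite_subset subsetI)

text \<open>Greedy choice. The recursion carries the set of all earlier terms along, because the
  forbidden set depends on all of them.\<close>

lemma generic_sequence:
  assumes "infinite I" and "\<And>J. finite J \<Longrightarrow> J \<subseteq> I \<Longrightarrow> finite (Bad J)"
  obtains s :: "nat \<Rightarrow> 'a" where "\<And>n. s n \<in> I" "\<And>n. s n \<notin> Bad (s ` {..<n})"
proof -
  define pick where "pick J = (SOME t. t \<in> I \<and> t \<notin> Bad J)" for J
  have pick: "pick J \<in> I \<and> pick J \<notin> Bad J" if "finite J" "J \<subseteq> I" for J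
  proof -
    have "\<exists>t. t \<in> I \<and> t \<notin> Bad J"
      using infinite_avoid [OF assms(1) assms(2) [OF that]] by blast
    then show ?thesis unfolding pick_def by (rule someI_ex)
  qed
  define L where "L = rec_nat {} (\<lambda>n J. insert (pick J) J)"
  have L0: "L 0 = {}" and LS: "L (Suc n) = insert (pick (L n)) (L n)" for n
    by (simp_all add: L_def)
  have L: "finite (L n) \<and> L n \<subseteq> I" for n
    by (induction n) (auto simp: L0 LS pick)
  have "L n = (\<lambda>n. pick (L n)) ` {..<n}" for n
    by (induction n) (auto simp: L0 LS lessThan_Suc)
  then show ?thesis using that [of "\<lambda>n. pick (L n)"] pick L by metis
qed

text \<open>The exponent 4 comes from \<open>quotients R <#> quotients R\<close>, which is
  parametrised by four elements of \<open>R\<close>; \<open>c\<close> will be the factor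
  \<open>2 ^ M\<close> paid for lost positions.\<close>

lemma power_exceeds_poly: "\<exists>n::nat. c * (a + n) ^ 4 < 2 ^ n"
proof -
  have "\<forall>\<^sub>F n in sequentially. real c * (real a + real n) ^ 4 < 2 ^ n"
    by real_asymp
  then obtain n where "real c * (real a + real n) ^ 4 < 2 ^ n"
    by (auto simp: eventually_sequentially)
  then have "real (c * (a + n) ^ 4) < real (2 ^ n)" by simp
  then show ?thesis using of_nat_less_iff by blast
qed

text \<open>Closedness appears as approximation on finite windows. \<open>K\<close> may be enlarged,
  since this weakens \<open>glue\<close>; its symmetry makes separation a symmetric relation, and
  \<open>\<one> \<in> K\<close> makes separated sets disjoint.\<close>

locale si_subshift = group G for G (structure) +
  fixes B :: "'b set" and X :: "('g \<Rightarrow> 'b) set" and K :: "'g set" and \<alpha> \<beta> :: 'b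
  assumes infinite_carrier: "infinite (carrier G)"
    and finite_B: "finite B"
    and X_PiE: "X \<subseteq> carrier G \<rightarrow>\<^sub>E B"
    and X_closed: "\<lbrakk>x \<in> extensional (carrier G);
          \<And>W. finite W \<Longrightarrow> W \<subseteq> carrier G \<Longrightarrow> \<exists>y\<in>X. \<forall>w\<in>W. y w = x w\<rbrakk> \<Longrightarrow> x \<in> X"
    and X_translate: "h \<in> carrier G \<Longrightarrow> x \<in> X \<Longrightarrow> translate G h x \<in> X"
    and finite_K: "finite K" and K_carrier: "K \<subseteq> carrier G" and K_one: "\<one> \<in> K"
    and K_inv: "k \<in> K \<Longrightarrow> inv k \<in> K"
    and glue: "\<lbrakk>finite S; S \<subseteq> carrier G; finite T; T \<subseteq> carrier G; (S <#> K) \<inter> T = {}; x \<in> X; y \<in> X\<rbrakk>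
          \<Longrightarrow> \<exists>z\<in>X. (\<forall>s\<in>S. z s = x s) \<and> (\<forall>t\<in>T. z t = y t)"
    and \<alpha>_neq_\<beta>: "\<alpha> \<noteq> \<beta>"
    and \<alpha>_occurs: "\<exists>x\<in>X. x \<one> = \<alpha>" and \<beta>_occurs: "\<exists>x\<in>X. x \<one> = \<beta>"
begin

section \<open>Gluing and interchangeable fillings\<close>

abbreviation tr where "tr \<equiv> translate G"

lemma X_extensional: "x \<in> X \<Longrightarrow> x \<in> extensional (carrier G)"
  using X_PiE by (auto simp: PiE_def)

lemma tr_apply: "s \<in> carrier G \<Longrightarrow> tr h x s = x (h \<otimes> s)"
  by (simp add: translate_def)

text \<open>\<open>tr h\<close> is the shift by \<open>inv h\<close>, hence a right action. It moves
  what a point shows at \<open>h\<close> to the identity, so that occurrences at \<open>h\<close>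
  become conditions on a fixed window.\<close>

lemma tr_mult:
  "h \<in> carrier G \<Longrightarrow> k \<in> carrier G \<Longrightarrow> tr (h \<otimes> k) x = tr k (tr h x)"
  by (rule ext) (simp add: translate_def m_assoc)

lemma K_in_carrier [simp]: "k \<in> K \<Longrightarrow> k \<in> carrier G"
  using K_carrier by auto

lemma finite_set_mult [simp]: "finite S \<Longrightarrow> finite T \<Longrightarrow> finite (S <#> T)"
  by (simp add: set_mult_def)

lemma set_mult_K_disjoint_sym:
  assumes "S \<subseteq> carrier G" "T \<subseteq> carrier G" "(S <#> K) \<inter> T = {}"
  shows "(T <#> K) \<inter> S = {}"
proof (rule ccontr)
  assume "(T <#> K) \<inter> S \<noteq> {}"
  then obtain t k where tk: "t \<in> T" "k \<in> K" "t \<otimes> k \<in> S" by (auto simp: set_mult_def)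
  then have "(t \<otimes> k) \<otimes> inv k = t" using assms by (auto simp: m_assoc)
  then have "t \<in> S <#> K" using tk K_inv by (force simp: set_mult_def)
  then show False using tk assms by auto
qed

lemma glue_family:
  assumes "finite J"
    and "\<And>j. j \<in> J \<Longrightarrow> finite (T j)" "\<And>j. j \<in> J \<Longrightarrow> T j \<subseteq> carrier G" "\<And>j. j \<in> J \<Longrightarrow> y j \<in> X"
    and "\<And>i j. i \<in> J \<Longrightarrow> j \<in> J \<Longrightarrow> i \<noteq> j \<Longrightarrow> (T i <#> K) \<inter> T j = {}"
  shows "\<exists>z\<in>X. \<forall>j\<in>J. \<forall>t\<in>T j. z t = y j t"
  using assms
proof (induction J)
  case empty
  then show ?case using \<alpha>_occurs by auto
next
  case (insert j J)
  have "\<exists>z\<in>X. \<forall>j\<in>J. \<forall>t\<in>T j. z t = y j t"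
    by (rule insert.IH) (use insert.prems in auto)
  then obtain z where z: "z \<in> X" "\<forall>j\<in>J. \<forall>t\<in>T j. z t = y j t" by blast
  have "((\<Union>i\<in>J. T i) <#> K) \<inter> T j = {}"
    using insert.prems(4) [of _ j] insert.hyps(2) by (fastforce simp: set_mult_def)
  moreover have "finite (\<Union>i\<in>J. T i)" "(\<Union>i\<in>J. T i) \<subseteq> carrier G"
    using insert.hyps(1) insert.prems(1,2) by auto
  moreover have "finite (T j)" "T j \<subseteq> carrier G" "y j \<in> X" using insert.prems by auto
  ultimately obtain w where w: "w \<in> X" "\<forall>s\<in>(\<Union>i\<in>J. T i). w s = z s" "\<forall>t\<in>T j. w t = y j t"
    using glue [of "\<Union>i\<in>J. T i" "T j" z "y j"] z(1) by blast
  have "\<forall>i\<in>insert j J. \<forall>t\<in>T i. w t = y i t" using z(2) w(2,3) by simp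
  then show ?case using w(1) by blast
qed

lemma symbol_occurs:
  assumes "h \<in> carrier G" shows "\<exists>x\<in>X. x h = (if b then \<alpha> else \<beta>)"
proof -
  obtain x where "x \<in> X" "x \<one> = (if b then \<alpha> else \<beta>)"
    using \<alpha>_occurs \<beta>_occurs by (cases b) auto
  then show ?thesis
    using X_translate [of "inv h" x] tr_apply [of h "inv h" x] assms
    by (intro bexI [of _ "tr (inv h) x"]) auto
qed

lemma finite_patterns:
  assumes "finite F" "F \<subseteq> carrier G"
  shows "finite ((\<lambda>y. restrict y F) ` X)"
proof (rule finite_subset)
  show "(\<lambda>y. restrict y F) ` X \<subseteq> F \<rightarrow>\<^sub>E B" using X_PiE assms by fastforce
qed (use assms finite_B in \<open>auto intro: finite_PiE\<close>)

text \<open>A pattern outside \<open>F\<close> leaving the least number of fillings of \<open>F\<close> leaves exactly the same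
  fillings however it is extended, so these may be exchanged for one another in any context.\<close>

lemma interchangeable_core:
  assumes F: "finite F" "F \<subseteq> carrier G" and S: "finite S" "S \<subseteq> carrier G" "S \<inter> F = {}"
    and x: "x \<in> X"
  obtains C c where "finite C" "C \<subseteq> carrier G" "S \<subseteq> C" "C \<inter> F = {}" "c \<in> X" "\<forall>s\<in>S. c s = x s"
    "\<And>y z. y \<in> X \<Longrightarrow> z \<in> X \<Longrightarrow> \<forall>s\<in>C. y s = c s \<Longrightarrow> \<forall>s\<in>C. z s = c s \<Longrightarrow> override_on y z F \<in> X"
proof -
  define fill where "fill C c = (\<lambda>y. restrict y F) ` {y \<in> X. \<forall>s\<in>C. y s = c s}" for C and c :: "'g \<Rightarrow> 'b"
  define P where "P = (\<lambda>(C, c). finite C \<and> C \<subseteq> carrier G \<and> S \<subseteq> C \<and> C \<inter> F = {} \<and> c \<in> X \<and>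
    (\<forall>s\<in>S. c s = x s))"
  have "P (S, x)" using S x by (simp add: P_def)
  then obtain Cc where Cc: "P Cc" and least: "\<And>Dd. P Dd \<Longrightarrow> card (case_prod fill Cc) \<le> card (case_prod fill Dd)"
    using ex_has_least_nat [of P "(S, x)" "\<lambda>Cc. card (case_prod fill Cc)"] by blast
  obtain C c where [simp]: "Cc = (C, c)" by (cases Cc)
  have C: "finite C" "C \<subseteq> carrier G" "S \<subseteq> C" "C \<inter> F = {}" "c \<in> X" "\<forall>s\<in>S. c s = x s"
    using Cc by (auto simp: P_def)
  have fin: "finite (fill D d)" for D d
    by (rule finite_subset [OF _ finite_patterns [OF F]]) (auto simp: fill_def)
  have "override_on y z F \<in> X"
    if y: "y \<in> X" "\<forall>s\<in>C. y s = c s" and z: "z \<in> X" "\<forall>s\<in>C. z s = c s" for y z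
  proof (rule X_closed)
    show "override_on y z F \<in> extensional (carrier G)"
      using X_extensional [OF y(1)] F by (auto simp: override_on_def extensional_def)
    fix W assume W: "finite W" "W \<subseteq> carrier G"
    \<comment> \<open>Enlarging the core by the rest of \<open>W\<close> cannot lose a filling, by
      minimality; so the filling seen in \<open>z\<close> also occurs next to the values of
      \<open>y\<close> on \<open>W - F\<close>.\<close>
    define D where "D = C \<union> (W - F)"
    have "\<forall>s\<in>S. y s = x s" using y(2) C(3,6) by (metis subsetD)
    then have "P (D, y)" using C(1-4) W y(1) unfolding P_def D_def by auto
    then have "card (fill C c) \<le> card (fill D y)" using least by fastforce
    moreover have "fill D y \<subseteq> fill C c" using y by (auto simp: fill_def D_def)
    ultimately have "fill D y = fill C c" using fin card_seteq by blast
    moreover have "restrict z F \<in> fill C c" using z by (auto simp: fill_def)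
    ultimately have "restrict z F \<in> fill D y" by simp
    then obtain w where w: "w \<in> X" "\<forall>s\<in>D. w s = y s" "restrict z F = restrict w F"
      unfolding fill_def by blast
    have "w s = z s" if "s \<in> F" for s using fun_cong [OF w(3), of s] that by simp
    then show "\<exists>w\<in>X. \<forall>s\<in>W. w s = override_on y z F s"
      using w by (intro bexI [of _ w]) (auto simp: override_on_def D_def)
  qed
  with C show ?thesis by (rule that)
qed

section \<open>The kernel of the shift action\<close>

definition act_kernel :: "'g set"
  where "act_kernel = {n \<in> carrier G. \<forall>x\<in>X. \<forall>w\<in>carrier G. x (n \<otimes> w) = x w}"

lemma act_kernel_carrier: "n \<in> act_kernel \<Longrightarrow> n \<in> carrier G"
  by (simp add: act_kernel_def)

lemma act_kernel_apply: "n \<in> act_kernel \<Longrightarrow> x \<in> X \<Longrightarrow> w \<in> carrier G \<Longrightarrow> x (n \<otimes> w) = x w"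
  by (simp add: act_kernel_def)

text \<open>For \<open>n\<close> outside \<open>K\<close> the symbols at the identity and at
  \<open>n\<close> can be prescribed independently, so \<open>n\<close> cannot act
  trivially.\<close>

lemma act_kernel_subset_K: "act_kernel \<subseteq> K"
proof
  fix n assume n: "n \<in> act_kernel"
  then have nG: "n \<in> carrier G" by (rule act_kernel_carrier)
  show "n \<in> K"
  proof (rule ccontr)
    assume "n \<notin> K"
    then have "({\<one>} <#> K) \<inter> {n} = {}" by (auto simp: set_mult_def)
    moreover obtain x y where "x \<in> X" "x \<one> = \<alpha>" "y \<in> X" "y n = \<beta>"
      using \<alpha>_occurs symbol_occurs [OF nG, of False] by auto
    ultimately obtain z where "z \<in> X" "z \<one> = \<alpha>" "z n = \<beta>"
      using glue [of "{\<one>}" "{n}" x y] nG by auto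
    then show False using act_kernel_apply [OF n, of z \<one>] nG \<alpha>_neq_\<beta> by simp
  qed
qed

lemma finite_act_kernel: "finite act_kernel"
  using act_kernel_subset_K finite_K finite_subset by blast

lemma act_kernel_mult: "m \<in> act_kernel \<Longrightarrow> n \<in> act_kernel \<Longrightarrow> m \<otimes> n \<in> act_kernel"
  by (auto simp: act_kernel_def m_assoc)

lemma act_kernel_one: "\<one> \<in> act_kernel"
  by (simp add: act_kernel_def)

lemma act_kernel_inv:
  assumes n: "n \<in> act_kernel" shows "inv n \<in> act_kernel"
proof -
  have nG: "n \<in> carrier G" using n by (rule act_kernel_carrier)
  have "x (inv n \<otimes> w) = x w" if "x \<in> X" "w \<in> carrier G" for x w
    using act_kernel_apply [OF n, of x "inv n \<otimes> w"] that nG by (simp add: m_assoc [symmetric])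
  then show ?thesis using nG by (simp add: act_kernel_def)
qed

lemma tr_act_kernel: "n \<in> act_kernel \<Longrightarrow> x \<in> X \<Longrightarrow> tr n x = x"
  by (rule ext) (auto simp: translate_def act_kernel_apply extensional_arb [OF X_extensional])

text \<open>Hence the occurrences of any pattern form a union of left cosets of
  \<open>act_kernel\<close>, and separation can only be achieved up to this subgroup.\<close>

lemma tr_mult_act_kernel: "h \<in> carrier G \<Longrightarrow> n \<in> act_kernel \<Longrightarrow> x \<in> X \<Longrightarrow> tr (h \<otimes> n) x = tr h x"
  by (simp add: tr_mult act_kernel_carrier tr_act_kernel X_translate)

section \<open>Breaking symmetries\<close>

lemma infinite_left_translate:
  assumes "infinite T" "T \<subseteq> carrier G" "a \<in> carrier G" "finite Z"
  shows "\<exists>t\<in>T. t \<otimes> a \<notin> Z"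
proof (rule ccontr)
  assume "\<not> ?thesis"
  then have "(\<lambda>t. t \<otimes> a) ` T \<subseteq> Z" by auto
  moreover have "inj_on (\<lambda>t. t \<otimes> a) T"
    using assms by (auto simp: inj_on_def subset_iff)
  ultimately show False using assms(1,4) by (meson finite_imageD finite_subset)
qed

text \<open>If almost all conjugates of \<open>h\<close> lie in \<open>K\<close> then infinitely many elements commute with \<open>h\<close>,
  and a point witnessing \<open>h \<notin> act_kernel\<close> can be moved by them far away from \<open>W\<close>.\<close>

lemma break_symmetry:
  assumes h: "h \<in> carrier G" "h \<notin> act_kernel" and x: "x \<in> X" and W: "finite W" "W \<subseteq> carrier G"
  shows "\<exists>y\<in>X. (\<forall>w\<in>W. y w = x w) \<and> (\<exists>w\<in>carrier G. y (h \<otimes> w) \<noteq> y w)"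
proof -
  define T where "T = {t \<in> carrier G. inv t \<otimes> h \<otimes> t \<in> K}"
  \<comment> \<open>\<open>Z\<close> collects the \<open>t\<close> for which \<open>t\<close> or
    \<open>h \<otimes> t\<close> is too close to \<open>W\<close> for gluing.\<close>
  define Z where "Z = (W <#> K) \<union> (\<lambda>v. inv h \<otimes> v) ` (W <#> K)"
  have Zfin: "finite Z" using W finite_K by (simp add: Z_def)
  have WK: "W <#> K \<subseteq> carrier G" using W K_carrier by (simp add: set_mult_closed)
  have Z: "t \<notin> W <#> K" "h \<otimes> t \<notin> W <#> K" if "t \<notin> Z" "t \<in> carrier G" for t
  proof -
    show "t \<notin> W <#> K" using that by (auto simp: Z_def)
    show "h \<otimes> t \<notin> W <#> K"
    proof
      assume "h \<otimes> t \<in> W <#> K"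
      then have "inv h \<otimes> (h \<otimes> t) \<in> Z" unfolding Z_def by blast
      then show False using that h by (simp add: m_assoc [symmetric])
    qed
  qed
  show ?thesis
  proof (cases "finite T")
    case True
    then have "infinite (carrier G - T)" using infinite_carrier by simp
    then obtain t where t: "t \<in> carrier G" "t \<notin> T" "t \<notin> Z"
      using infinite_avoid [OF _ Zfin] by blast
    note tZ = Z [OF t(3,1)]
    obtain a where a: "a \<in> X" "a t = \<alpha>" using symbol_occurs [OF t(1), of True] by auto
    obtain b where b: "b \<in> X" "b (h \<otimes> t) = \<beta>"
      using symbol_occurs [of "h \<otimes> t" False] h t by auto
    have "({t} <#> K) \<inter> {h \<otimes> t} = {}"
    proof (rule ccontr)
      assume "({t} <#> K) \<inter> {h \<otimes> t} \<noteq> {}"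
      then obtain k where k: "k \<in> K" "h \<otimes> t = t \<otimes> k" by (auto simp: set_mult_def)
      then have "inv t \<otimes> h \<otimes> t = k" using t h by (simp add: m_assoc) (simp add: m_assoc [symmetric])
      then show False using k t by (simp add: T_def)
    qed
    then obtain y where y: "y \<in> X" "y t = \<alpha>" "y (h \<otimes> t) = \<beta>"
      using glue [of "{t}" "{h \<otimes> t}" a b] a b h t by auto
    have "(W <#> K) \<inter> {t, h \<otimes> t} = {}" using tZ by auto
    then obtain z where "z \<in> X" "\<forall>w\<in>W. z w = x w" "z t = y t" "z (h \<otimes> t) = y (h \<otimes> t)"
      using glue [of W "{t, h \<otimes> t}" x y] W x y(1) h t by auto
    then show ?thesis using y t \<alpha>_neq_\<beta> by (intro bexI [of _ z] conjI bexI [of _ t]) auto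
  next
    case False
    obtain y w where y: "y \<in> X" "w \<in> carrier G" "y (h \<otimes> w) \<noteq> y w"
      using h by (auto simp: act_kernel_def)
    have "(\<lambda>t. inv t \<otimes> h \<otimes> t) ` T \<subseteq> K" by (auto simp: T_def)
    \<comment> \<open>Pigeonhole on the finite set \<open>K\<close>: infinitely many
      \<open>t\<close> give the same conjugate as \<open>t0\<close>, and then
      \<open>t \<otimes> inv t0\<close> commutes with \<open>h\<close>.\<close>
    then obtain t0 where t0: "t0 \<in> T" "infinite {t \<in> T. inv t \<otimes> h \<otimes> t = inv t0 \<otimes> h \<otimes> t0}"
      using pigeonhole_infinite [OF False, of "\<lambda>t. inv t \<otimes> h \<otimes> t"] finite_K finite_subset by blast
    have t0G: "t0 \<in> carrier G" using t0 by (simp add: T_def)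
    obtain t where t: "t \<in> carrier G" "inv t \<otimes> h \<otimes> t = inv t0 \<otimes> h \<otimes> t0" "t \<otimes> (inv t0 \<otimes> w) \<notin> Z"
      using infinite_left_translate [OF t0(2), of "inv t0 \<otimes> w" Z] Zfin t0G y(2)
      by (auto simp: T_def)
    define s where "s = t \<otimes> inv t0"
    have sG: "s \<in> carrier G" using t t0G by (simp add: s_def)
    have "t \<otimes> (inv t \<otimes> h \<otimes> t) \<otimes> inv t0 = t \<otimes> (inv t0 \<otimes> h \<otimes> t0) \<otimes> inv t0" using t by simp
    moreover have "t \<otimes> (inv t \<otimes> h \<otimes> t) = h \<otimes> t"
      using t(1) h by (simp add: m_assoc [symmetric])
    moreover have "t \<otimes> (inv t0 \<otimes> h \<otimes> t0) \<otimes> inv t0 = t \<otimes> inv t0 \<otimes> h"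
      using t h t0G by (simp add: m_assoc)
    ultimately have comm: "h \<otimes> s = s \<otimes> h" using t h t0G by (simp add: s_def m_assoc)
    have sw: "s \<otimes> w \<notin> Z" using t t0G y(2) by (simp add: s_def m_assoc)
    have swG: "s \<otimes> w \<in> carrier G" "h \<otimes> (s \<otimes> w) \<in> carrier G" using sG y h by auto
    define y' where "y' = tr (inv s) y"
    have y': "y' \<in> X" using X_translate y sG by (simp add: y'_def)
    have "y' (s \<otimes> w) = y w" using swG sG y by (simp add: y'_def tr_apply m_assoc [symmetric])
    moreover have "h \<otimes> (s \<otimes> w) = s \<otimes> (h \<otimes> w)" using comm h sG y by (simp add: m_assoc [symmetric])
    then have "y' (h \<otimes> (s \<otimes> w)) = y (h \<otimes> w)"
      using swG sG y h by (simp add: y'_def tr_apply m_assoc [symmetric])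
    moreover have "(W <#> K) \<inter> {s \<otimes> w, h \<otimes> (s \<otimes> w)} = {}" using Z [OF sw swG(1)] by auto
    then obtain z where "z \<in> X" "\<forall>w\<in>W. z w = x w" "z (s \<otimes> w) = y' (s \<otimes> w)"
        "z (h \<otimes> (s \<otimes> w)) = y' (h \<otimes> (s \<otimes> w))"
      using glue [of W "{s \<otimes> w, h \<otimes> (s \<otimes> w)}" x y'] W x y' swG by auto
    ultimately show ?thesis using y swG by (intro bexI [of _ z] conjI bexI [of _ "s \<otimes> w"]) auto
  qed
qed

lemma break_symmetries:
  assumes "finite H" "H \<subseteq> carrier G" "H \<inter> act_kernel = {}"
  shows "\<exists>x\<in>X. \<exists>S. finite S \<and> S \<subseteq> carrier G \<and> (\<forall>h\<in>H. \<exists>w\<in>S. h \<otimes> w \<in> S \<and> x (h \<otimes> w) \<noteq> x w)"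
  using assms
proof (induction H)
  case empty
  then show ?case using \<alpha>_occurs by auto
next
  case (insert h H)
  then obtain x S where x: "x \<in> X" and S: "finite S" "S \<subseteq> carrier G"
    and wit: "\<And>h. h \<in> H \<Longrightarrow> \<exists>w\<in>S. h \<otimes> w \<in> S \<and> x (h \<otimes> w) \<noteq> x w" by auto
  obtain y w where y: "y \<in> X" "\<forall>s\<in>S. y s = x s" "w \<in> carrier G" "y (h \<otimes> w) \<noteq> y w"
    using break_symmetry [OF _ _ x S, of h] insert.prems by auto
  have "\<exists>v\<in>insert w (insert (h \<otimes> w) S). g \<otimes> v \<in> insert w (insert (h \<otimes> w) S) \<and> y (g \<otimes> v) \<noteq> y v"
    if g: "g \<in> insert h H" for g
  proof (cases "g = h")
    case False
    then obtain v where "v \<in> S" "g \<otimes> v \<in> S" "x (g \<otimes> v) \<noteq> x v" using wit g by blast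
    then show ?thesis using y(2) by (intro bexI [of _ v]) auto
  qed (use y in auto)
  then show ?case
    using y S insert.prems
    by (intro bexI [of _ y] exI [of _ "insert w (insert (h \<otimes> w) S)"]) auto
qed

text \<open>Conjugation is injective, so a set that infinitely many \<open>t\<close> simultaneously
  conjugate into \<open>K\<close> has at most \<open>card K\<close> elements. For a largest such
  \<open>H\<close>, an element outside \<open>H\<close> is conjugated into \<open>K\<close> by only
  finitely many of these \<open>t\<close>. The relation
  \<open>inv t \<otimes> h \<otimes> t \<in> K\<close> matters because it says that \<open>h\<close>
  moves \<open>t\<close> into \<open>t K\<close>.\<close>

lemma stable_conjugators:
  obtains I H where "I \<subseteq> carrier G" "infinite I" "finite H" "H \<subseteq> carrier G"
    "\<And>h. h \<in> carrier G \<Longrightarrow> h \<notin> H \<Longrightarrow> finite {t \<in> I. inv t \<otimes> h \<otimes> t \<in> K}"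
proof -
  define conj where "conj H = {t \<in> carrier G. \<forall>h\<in>H. inv t \<otimes> h \<otimes> t \<in> K}" for H
  define P where "P H \<longleftrightarrow> finite H \<and> H \<subseteq> carrier G \<and> infinite (conj H)" for H
  have "P {}" using infinite_carrier by (simp add: P_def conj_def)
  moreover have "\<forall>H. P H \<longrightarrow> card H < Suc (card K)"
  proof (intro allI impI)
    fix H assume H: "P H"
    then obtain t where t: "t \<in> conj H" by (metis P_def finite.emptyI ex_in_conv)
    have "inj_on (\<lambda>h. inv t \<otimes> h \<otimes> t) H"
      using t H by (intro inj_onI) (simp add: P_def conj_def subset_iff)
    moreover have "(\<lambda>h. inv t \<otimes> h \<otimes> t) ` H \<subseteq> K"
      using t by (auto simp: conj_def)
    ultimately have "card H \<le> card K" using finite_K by (rule card_inj_on_le)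
    then show "card H < Suc (card K)" by simp
  qed
  ultimately obtain H where H: "P H" and max: "\<And>H'. P H' \<Longrightarrow> card H' \<le> card H"
    using ex_has_greatest_nat [of P "{}" card "Suc (card K)"] by blast
  have fin: "finite {t \<in> conj H. inv t \<otimes> h \<otimes> t \<in> K}" if "h \<in> carrier G" "h \<notin> H" for h
  proof (rule ccontr)
    assume "\<not> ?thesis"
    moreover have "{t \<in> conj H. inv t \<otimes> h \<otimes> t \<in> K} = conj (insert h H)" by (auto simp: conj_def)
    ultimately have "P (insert h H)" using H that by (auto simp: P_def)
    then show False using max [of "insert h H"] H that by (auto simp: P_def)
  qed
  have "conj H \<subseteq> carrier G" by (auto simp: conj_def)
  moreover have "infinite (conj H)" "finite H" "H \<subseteq> carrier G" using H by (simp_all add: P_def)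
  ultimately show ?thesis using fin by (rule that)
qed

section \<open>Isolated markers\<close>

lemma set_multI: "a \<in> S \<Longrightarrow> b \<in> T \<Longrightarrow> a \<otimes> b \<in> S <#> T"
  by (auto simp: set_mult_def)

lemma set_multE:
  assumes "v \<in> S <#> T" obtains a b where "a \<in> S" "b \<in> T" "v = a \<otimes> b"
  using assms by (auto simp: set_mult_def)

lemma subset_set_mult_K:
  assumes "S \<subseteq> carrier G" shows "S \<subseteq> S <#> K"
proof
  fix v assume "v \<in> S"
  then have "v \<otimes> \<one> \<in> S <#> K" using K_one by (rule set_multI)
  then show "v \<in> S <#> K" using \<open>v \<in> S\<close> assms by auto
qed

text \<open>For each of \<open>m\<close> spaced positions there is a point that shows \<alpha> there
  and \<beta> at the others; these points differ on \<open>F\<close>.\<close>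

lemma many_patterns:
  assumes "finite Z"
  shows "\<exists>F. finite F \<and> F \<subseteq> carrier G \<and> F \<inter> Z = {} \<and> m \<le> card ((\<lambda>y. restrict y F) ` X)"
proof -
  obtain s :: "nat \<Rightarrow> 'g" where sG: "\<And>n. s n \<in> carrier G"
    and s: "\<And>n. s n \<notin> (s ` {..<n} <#> K) \<union> Z"
    using generic_sequence [OF infinite_carrier, of "\<lambda>J. (J <#> K) \<union> Z"] assms finite_K by auto
  have sJK: "s j \<notin> s ` {..<j} <#> K" for j using s [of j] by blast
  have lt: "({s i} <#> K) \<inter> {s j} = {}" if "i < j" for i j
    using sJK [of j] that unfolding set_mult_def by blast
  have sep: "({s i} <#> K) \<inter> {s j} = {}" if "i \<noteq> j" for i j
  proof (cases "i < j")
    case False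
    then have "({s j} <#> K) \<inter> {s i} = {}" using that by (intro lt) simp
    then show ?thesis by (rule set_mult_K_disjoint_sym [rotated 2]) (simp_all add: sG)
  qed (rule lt)
  define F where "F = s ` {..<m}"
  have F: "finite F" "F \<subseteq> carrier G" "F \<inter> Z = {}" using sG s by (auto simp: F_def)
  have "\<exists>z\<in>X. \<forall>j<m. z (s j) = (if j = i then \<alpha> else \<beta>)" for i
  proof -
    have "\<exists>v. \<forall>j. v j \<in> X \<and> v j (s j) = (if j = i then \<alpha> else \<beta>)"
      using symbol_occurs [OF sG] by (intro choice) (simp add: Bex_def)
    then obtain v where v: "\<And>j. v j \<in> X" "\<And>j. v j (s j) = (if j = i then \<alpha> else \<beta>)" by blast
    have "\<exists>z\<in>X. \<forall>j\<in>{..<m}. \<forall>t\<in>{s j}. z t = v j t"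
      by (rule glue_family) (simp_all add: v(1) sep sG)
    then obtain z where z: "z \<in> X" "\<And>j. j < m \<Longrightarrow> z (s j) = v j (s j)" by auto
    then have "\<forall>j<m. z (s j) = (if j = i then \<alpha> else \<beta>)" unfolding v(2) by blast
    then show ?thesis using z(1) by blast
  qed
  then obtain z where z: "\<And>i. z i \<in> X" "\<And>i j. j < m \<Longrightarrow> z i (s j) = (if j = i then \<alpha> else \<beta>)"
    by metis
  have "inj_on (\<lambda>i. restrict (z i) F) {..<m}"
  proof (rule inj_onI)
    fix i j assume ij: "i \<in> {..<m}" "j \<in> {..<m}" and eq: "restrict (z i) F = restrict (z j) F"
    have "s i \<in> F" using ij by (simp add: F_def)
    then have "z i (s i) = z j (s i)" using fun_cong [OF eq, of "s i"] by simp
    then show "i = j" using z(2) [of i i] z(2) [of i j] ij \<alpha>_neq_\<beta> by (simp split: if_splits)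
  qed
  moreover have "(\<lambda>i. restrict (z i) F) ` {..<m} \<subseteq> (\<lambda>y. restrict y F) ` X" using z by auto
  ultimately have "card {..<m} \<le> card ((\<lambda>y. restrict y F) ` X)"
    using finite_patterns F by (intro card_inj_on_le) auto
  then show ?thesis using F by auto
qed

text \<open>For \<open>R\<close> inside the group, \<open>e\<close> lies here exactly when
  \<open>R\<close> meets its translate by \<open>e\<close>. Products of two such elements link
  translates that meet a common third one.\<close>

definition quotients :: "'g set \<Rightarrow> 'g set"
  where "quotients R = (\<lambda>(a, b). a \<otimes> inv b) ` (R \<times> R)"

lemma quotientsI: "a \<in> R \<Longrightarrow> b \<in> R \<Longrightarrow> a \<otimes> inv b \<in> quotients R"
  by (auto simp: quotients_def)

lemma card_set_mult: "finite S \<Longrightarrow> finite T \<Longrightarrow> card (S <#> T) \<le> card S * card T"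
proof -
  assume "finite S" "finite T"
  moreover have "S <#> T = (\<lambda>(s, t). s \<otimes> t) ` (S \<times> T)" by (auto simp: set_mult_def)
  ultimately show ?thesis
    using card_image_le [of "S \<times> T" "\<lambda>(s, t). s \<otimes> t"] by (simp add: card_cartesian_product)
qed

lemma finite_quotients [simp]: "finite R \<Longrightarrow> finite (quotients R)"
  by (simp add: quotients_def)

lemma card_quotients: "finite R \<Longrightarrow> card (quotients R) \<le> card R * card R"
  using card_image_le [of "R \<times> R" "\<lambda>(a, b). a \<otimes> inv b"]
  by (simp add: quotients_def card_cartesian_product)

lemma quotients_carrier: "R \<subseteq> carrier G \<Longrightarrow> quotients R \<subseteq> carrier G"
  by (auto simp: quotients_def)

section \<open>Coincidences of generic positions\<close>

lemma card_translates_in: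
  assumes "inj s" "\<And>i. s i \<in> carrier G" "h \<in> carrier G" "finite W"
  shows "finite {i::nat. h \<otimes> s i \<in> W} \<and> card {i. h \<otimes> s i \<in> W} \<le> card W"
proof -
  have inj: "inj_on (\<lambda>i. h \<otimes> s i) {i. h \<otimes> s i \<in> W}"
    using assms(1-3) by (auto simp: inj_on_def)
  have sub: "(\<lambda>i. h \<otimes> s i) ` {i. h \<otimes> s i \<in> W} \<subseteq> W" by auto
  show ?thesis
    using card_inj_on_le [OF inj sub assms(4)] finite_subset [OF sub assms(4)] finite_imageD [OF _ inj]
    by auto
qed

text \<open>Each part excludes one accident for the next term \<open>t\<close>: lying in
  \<open>Z\<close>; being too close to an earlier term; being expressible through three earlier
  terms; and satisfying \<open>h \<otimes> t \<in> t K\<close> for an \<open>h\<close> with the same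
  kind of coincidence at an earlier term. In the last part \<open>H\<close> is exempt, because
  finiteness is guaranteed only outside \<open>H\<close>.\<close>

definition forbidden :: "'g set \<Rightarrow> 'g set \<Rightarrow> 'g set \<Rightarrow> 'g set \<Rightarrow> 'g set"
  where "forbidden I H Z J = Z \<union> (J <#> K) \<union> (((J <#> K) <#> m_inv G ` J) <#> (J <#> K)) \<union>
    (\<Union>h\<in>((J <#> K) <#> m_inv G ` J) - H. {t \<in> I. inv t \<otimes> h \<otimes> t \<in> K})"

lemma finite_forbidden:
  assumes "finite J" "J \<subseteq> carrier G" "finite Z"
    and "\<And>h. h \<in> carrier G \<Longrightarrow> h \<notin> H \<Longrightarrow> finite {t \<in> I. inv t \<otimes> h \<otimes> t \<in> K}"
  shows "finite (forbidden I H Z J)"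
proof -
  have "(J <#> K) <#> m_inv G ` J \<subseteq> carrier G"
    using assms(2) K_carrier by (intro set_mult_closed) auto
  then show ?thesis using assms finite_K by (auto simp: forbidden_def)
qed

text \<open>Two relations \<open>h \<otimes> s i = s j \<otimes> k\<close> and \<open>h \<otimes> s i' = s j' \<otimes> k'\<close> with four distinct indices would
  express the \<open>s\<close> of largest index through the other three, which \<open>forbidden\<close> rules out.\<close>

lemma generic_translates:
  fixes s :: "nat \<Rightarrow> 'g"
  assumes I: "I \<subseteq> carrier G" and sI: "\<And>n. s n \<in> I" and s: "\<And>n. s n \<notin> forbidden I H Z (s ` {..<n})"
    and h: "h \<in> carrier G" "h \<notin> H"
  shows "card {i. h \<otimes> s i \<in> range s <#> K} \<le> 3 + 2 * card K \<and> finite {i. h \<otimes> s i \<in> range s <#> K}"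
proof -
  have sG [simp]: "s n \<in> carrier G" for n using I sI by auto
  have sJK: "s j \<notin> s ` {..<j} <#> K" for j using s [of j] unfolding forbidden_def by blast
  have lt: "s j \<noteq> s i \<otimes> k" if "i < j" "k \<in> K" for i j k
    using sJK [of j] that unfolding set_mult_def by blast
  have inj: "inj s"
  proof (rule linorder_injI)
    fix i j :: nat assume "i < j"
    then show "s i \<noteq> s j" using lt [of i j \<one>] K_one by (metis sG r_one)
  qed
  have triple: "s d \<noteq> (s a \<otimes> k \<otimes> inv s b) \<otimes> (s c \<otimes> k')"
    if "a < d" "b < d" "c < d" "k \<in> K" "k' \<in> K" for a b c d k k'
  proof
    assume eq: "s d = (s a \<otimes> k \<otimes> inv s b) \<otimes> (s c \<otimes> k')"
    let ?J = "s ` {..<d}"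
    have "(s a \<otimes> k \<otimes> inv s b) \<otimes> (s c \<otimes> k') \<in> ((?J <#> K) <#> m_inv G ` ?J) <#> (?J <#> K)"
      using that by (intro set_multI imageI) auto
    then show False using s [of d] unfolding forbidden_def eq [symmetric] by blast
  qed
  \<comment> \<open>The largest index belongs to the first relation here, as \<open>i\<close> or as
    \<open>j\<close>. The second relation eliminates \<open>h\<close>, and the first is solved for
    the term of largest index.\<close>
  have no_pair: False
    if eq: "h \<otimes> s i = s j \<otimes> k" "h \<otimes> s i' = s j' \<otimes> k'" and k: "k \<in> K" "k' \<in> K"
      and d: "(j' < i \<and> i' < i \<and> j < i) \<or> (j' < j \<and> i' < j \<and> i < j)" for i j i' j' k k'
  proof -
    have h': "h = s j' \<otimes> k' \<otimes> inv s i'"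
      using eq(2) k h by (metis K_in_carrier inv_solve_right m_closed sG)
    have hinv: "inv h = s i' \<otimes> inv k' \<otimes> inv s j'"
      using k h by (simp add: h' inv_mult_group m_assoc)
    have "s i = inv h \<otimes> (s j \<otimes> k)"
      using eq(1) k h by (metis K_in_carrier inv_solve_left m_closed sG)
    then have "s i = (s i' \<otimes> inv k' \<otimes> inv s j') \<otimes> (s j \<otimes> k)" by (simp add: hinv)
    moreover have "s j = (h \<otimes> s i) \<otimes> inv k"
      using eq(1) k h by (metis K_in_carrier inv_solve_right m_closed sG)
    then have "s j = h \<otimes> (s i \<otimes> inv k)" using k h by (simp add: m_assoc)
    then have "s j = (s j' \<otimes> k' \<otimes> inv s i') \<otimes> (s i \<otimes> inv k)" by (simp add: h')
    ultimately show False
      using triple [of i' i j' j "inv k'" k] triple [of j' j i' i k' "inv k"] d k K_inv by blast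
  qed
  have hits: "j = i \<or> i = i' \<or> i' = j \<or> j' = i' \<or> j' = i \<or> j' = j"
    if eq: "h \<otimes> s i = s j \<otimes> k" "h \<otimes> s i' = s j' \<otimes> k'" and k: "k \<in> K" "k' \<in> K" for i j i' j' k k'
  proof (rule ccontr)
    assume neq: "\<not> ?thesis"
    define M where "M = Max {i, j, i', j'}"
    have "M \<in> {i, j, i', j'}" unfolding M_def by (rule Max_in) auto
    moreover have "i \<le> M" "j \<le> M" "i' \<le> M" "j' \<le> M" by (simp_all add: M_def)
    ultimately have "(j' < i \<and> i' < i \<and> j < i) \<or> (j' < j \<and> i' < j \<and> i < j) \<or>
        (j < i' \<and> i < i' \<and> j' < i') \<or> (j < j' \<and> i < j' \<and> i' < j')"
      using neq by (auto simp: order.strict_iff_order)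
    then show False using no_pair [OF eq k] no_pair [OF eq(2,1) k(2,1)] by blast
  qed
  have fin: "finite {i. h \<otimes> s i \<in> {s j} <#> K}" and crd: "card {i. h \<otimes> s i \<in> {s j} <#> K} \<le> card K" for j
    using card_translates_in [OF inj _ h(1), of "{s j} <#> K"] card_set_mult [of "{s j}" K] finite_K
    by auto
  \<comment> \<open>\<open>A2\<close> holds the coincidences of a term with itself, of which a
    second one is forbidden. By \<open>hits\<close>, every member of \<open>A3\<close> shares an
    index with a fixed coincidence \<open>(i, j)\<close>: it is \<open>i\<close> or
    \<open>j\<close>, or it is carried near \<open>s i\<close> or \<open>s j\<close>, which happens
    at most \<open>card K\<close> times each. This is the origin of
    \<open>3 + 2 * card K\<close>.\<close>
  define A2 where "A2 = {i. h \<otimes> s i \<in> {s i} <#> K}"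
  define A3 where "A3 = {i. \<exists>j. j \<noteq> i \<and> h \<otimes> s i \<in> {s j} <#> K}"
  have A2: "i = j" if "i \<in> A2" "j \<in> A2" for i j
    using that
  proof (induction i j rule: linorder_wlog)
    case (le i j)
    then obtain k k' where k: "k \<in> K" "h \<otimes> s i = s i \<otimes> k" and k': "k' \<in> K" "h \<otimes> s j = s j \<otimes> k'"
      by (auto simp: A2_def set_mult_def)
    show ?case
    proof (rule ccontr)
      assume "i \<noteq> j"
      with le have ij: "i < j" by simp
      have "h = s i \<otimes> k \<otimes> inv s i"
        using k h by (metis K_in_carrier inv_solve_right m_closed sG)
      moreover have "s i \<otimes> k \<otimes> inv s i \<in> (s ` {..<j} <#> K) <#> m_inv G ` s ` {..<j}"
        using ij k by (intro set_multI imageI) auto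
      ultimately have "h \<in> (s ` {..<j} <#> K) <#> m_inv G ` s ` {..<j}" by simp
      moreover have "inv s j \<otimes> h \<otimes> s j \<in> K"
        using k' h by (simp add: m_assoc) (simp add: m_assoc [symmetric])
      ultimately have "s j \<in> forbidden I H Z (s ` {..<j})"
        using h(2) sI unfolding forbidden_def by blast
      then show False using s by blast
    qed
  qed auto
  have A2': "finite A2 \<and> card A2 \<le> 1"
  proof (cases "A2 = {}")
    case False
    then obtain i where "i \<in> A2" by blast
    then have "A2 = {i}" using A2 by blast
    then show ?thesis by simp
  qed simp
  have A3: "finite A3 \<and> card A3 \<le> 2 + 2 * card K"
  proof (cases "A3 = {}")
    case False
    then obtain i j k where i: "j \<noteq> i" "h \<otimes> s i = s j \<otimes> k" "k \<in> K"
      by (auto simp: A3_def set_mult_def)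
    let ?U = "{i, j} \<union> {i'. h \<otimes> s i' \<in> {s i} <#> K} \<union> {i'. h \<otimes> s i' \<in> {s j} <#> K}"
    have "A3 \<subseteq> ?U"
    proof
      fix i' assume "i' \<in> A3"
      then obtain j' k' where i': "j' \<noteq> i'" "h \<otimes> s i' = s j' \<otimes> k'" "k' \<in> K"
        by (auto simp: A3_def set_mult_def)
      then have "i' = i \<or> i' = j \<or> j' = i \<or> j' = j" using hits [OF i(2) i'(2) i(3) i'(3)] i(1) by auto
      then show "i' \<in> ?U" using i' by (auto simp: set_mult_def)
    qed
    moreover have "finite ?U" using fin by simp
    moreover have "card ?U \<le> card {i, j} + card {i'. h \<otimes> s i' \<in> {s i} <#> K}
        + card {i'. h \<otimes> s i' \<in> {s j} <#> K}"
      by (meson add_le_mono1 card_Un_le order_trans)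
    then have "card ?U \<le> 2 + 2 * card K" using i(1) crd [of i] crd [of j] by simp
    ultimately show ?thesis by (meson card_mono finite_subset order_trans)
  qed simp
  have sub: "{i. h \<otimes> s i \<in> range s <#> K} \<subseteq> A2 \<union> A3"
  proof
    fix i assume "i \<in> {i. h \<otimes> s i \<in> range s <#> K}"
    then obtain j k where "k \<in> K" "h \<otimes> s i = s j \<otimes> k" by (auto elim: set_multE)
    then have "h \<otimes> s i \<in> {s j} <#> K" by (simp add: set_multI)
    then show "i \<in> A2 \<union> A3" unfolding A2_def A3_def by (cases "j = i") auto
  qed
  have "finite (A2 \<union> A3)" "card (A2 \<union> A3) \<le> 3 + 2 * card K"
    using A2' A3 card_Un_le [of A2 A3] by auto
  then show ?thesis using sub by (meson card_mono finite_subset order_trans)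
qed

text \<open>The last conclusion splits according to \<open>H\<close>: an \<open>e\<close> in
  \<open>H\<close> outside the kernel is caught by the symmetry-breaking pattern \<open>x1\<close>
  on \<open>S1\<close>, any other \<open>e\<close> by the generic positions, where the symbol
  required by \<open>p\<close> differs from the one present. In both cases the symbol compared with
  \<open>p\<close> sits outside \<open>F\<close>, so the filling \<open>z\<close> cannot repair the
  mismatch.\<close>

lemma isolated_marker:
  obtains S F p where "finite S" "S \<subseteq> carrier G" "finite F" "F \<subseteq> carrier G" "S \<inter> F = {}" "p \<in> X"
    "\<And>n f. n \<in> act_kernel \<Longrightarrow> f \<in> F \<Longrightarrow> n \<otimes> f \<in> F"
    "m \<le> card ((\<lambda>z. restrict z F) ` {z \<in> X. \<forall>s\<in>S. z s = p s})"
    "\<And>y z. y \<in> X \<Longrightarrow> z \<in> X \<Longrightarrow> \<forall>s\<in>S. y s = p s \<Longrightarrow> \<forall>s\<in>S. z s = p s \<Longrightarrow> override_on y z F \<in> X"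
    "\<And>e z. e \<in> quotients (S \<union> F) <#> quotients (S \<union> F) \<Longrightarrow> e \<notin> act_kernel \<Longrightarrow> \<exists>s\<in>S. override_on p z F (e \<otimes> s) \<noteq> p s"
proof -
  obtain I H where I: "I \<subseteq> carrier G" "infinite I" and H: "finite H" "H \<subseteq> carrier G"
    and IH: "\<And>h. h \<in> carrier G \<Longrightarrow> h \<notin> H \<Longrightarrow> finite {t \<in> I. inv t \<otimes> h \<otimes> t \<in> K}"
    by (fact stable_conjugators)
  obtain x1 S1 where x1: "x1 \<in> X" and S1: "finite S1" "S1 \<subseteq> carrier G"
    and brk: "\<And>h. h \<in> H - act_kernel \<Longrightarrow> \<exists>w\<in>S1. h \<otimes> w \<in> S1 \<and> x1 (h \<otimes> w) \<noteq> x1 w"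
  proof -
    have "finite (H - act_kernel)" "H - act_kernel \<subseteq> carrier G" "(H - act_kernel) \<inter> act_kernel = {}"
      using H by auto
    from break_symmetries [OF this] show thesis by (elim bexE exE conjE) (rule that, auto)
  qed
  \<comment> \<open>The avoided set is chosen so that \<open>F\<close>, which thickens
    \<open>F'\<close> by \<open>act_kernel\<close> on the left and by \<open>K\<close> on the right,
    still misses \<open>S1\<close>.\<close>
  obtain F' where F': "finite F'" "F' \<subseteq> carrier G" "F' \<inter> (K <#> (S1 <#> K)) = {}"
    and m: "m \<le> card ((\<lambda>y. restrict y F') ` X)"
    using many_patterns [of "K <#> (S1 <#> K)" m] finite_K S1(1)
    by (elim meta_impE exE conjE) simp_all
  \<comment> \<open>Containing \<open>F' <#> K\<close> allows any pattern on \<open>F'\<close> to be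
    glued to any pattern on a finite set off \<open>F\<close>, so \<open>F\<close> has at least as
    many fillings as \<open>F'\<close> has patterns. The factor \<open>act_kernel\<close> makes
    \<open>F\<close> invariant.\<close>
  define F where "F = act_kernel <#> (F' <#> K)"
  have NG: "act_kernel \<subseteq> carrier G" using act_kernel_carrier by auto
  have F'K: "F' <#> K \<subseteq> carrier G" using F' K_carrier by (intro set_mult_closed)
  have F: "finite F" "F \<subseteq> carrier G"
    using F' finite_K finite_act_kernel F'K NG by (simp_all add: F_def set_mult_closed)
  have satF: "n \<otimes> f \<in> F" if n: "n \<in> act_kernel" and f: "f \<in> F" for n f
  proof -
    obtain n' v where v: "n' \<in> act_kernel" "v \<in> F' <#> K" "f = n' \<otimes> v"
      using f by (auto simp: F_def set_mult_def)
    then have "n \<otimes> f = (n \<otimes> n') \<otimes> v" using n NG F'K by (simp add: m_assoc subset_iff)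
    then show ?thesis using v n act_kernel_mult unfolding F_def by (metis set_multI)
  qed
  have F'KF: "F' <#> K \<subseteq> F"
  proof
    fix v assume v: "v \<in> F' <#> K"
    then have "\<one> \<otimes> v \<in> F" unfolding F_def by (intro set_multI act_kernel_one)
    then show "v \<in> F" using v F'K by auto
  qed
  have F'F: "F' \<subseteq> F" using subset_set_mult_K [OF F'(2)] F'KF by simp
  have S1F: "S1 \<inter> F = {}"
  proof (rule ccontr)
    assume "S1 \<inter> F \<noteq> {}"
    then obtain n t k where ntk: "n \<in> act_kernel" "t \<in> F'" "k \<in> K" "n \<otimes> (t \<otimes> k) \<in> S1"
      by (auto simp: F_def set_mult_def)
    have G: "n \<in> carrier G" "t \<in> carrier G" "k \<in> carrier G"
      using ntk F' NG by auto
    have "inv n \<otimes> ((n \<otimes> (t \<otimes> k)) \<otimes> inv k) = (inv n \<otimes> n) \<otimes> (t \<otimes> (k \<otimes> inv k))"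
      using G by (simp only: m_assoc inv_closed m_closed)
    then have "t = inv n \<otimes> ((n \<otimes> (t \<otimes> k)) \<otimes> inv k)" using G by simp
    moreover have "inv n \<in> K" "inv k \<in> K" using ntk act_kernel_inv act_kernel_subset_K K_inv by auto
    ultimately have "t \<in> K <#> (S1 <#> K)" using ntk(4) by (metis set_multI)
    then show False using F' ntk by blast
  qed
  obtain C c where C: "finite C" "C \<subseteq> carrier G" "S1 \<subseteq> C" "C \<inter> F = {}" "c \<in> X" "\<forall>s\<in>S1. c s = x1 s"
    and swap: "\<And>y z. y \<in> X \<Longrightarrow> z \<in> X \<Longrightarrow> \<forall>s\<in>C. y s = c s \<Longrightarrow> \<forall>s\<in>C. z s = c s \<Longrightarrow> override_on y z F \<in> X"
    by (fact interchangeable_core [OF F S1 S1F x1])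
  define Z where "Z = (C \<union> F) <#> K"
  have Z: "finite Z" using C F finite_K by (simp add: Z_def)
  have CFZ: "C \<union> F \<subseteq> Z" using subset_set_mult_K [of "C \<union> F"] C(2) F(2) by (simp add: Z_def)
  have "finite (forbidden I H Z J)" if "finite J" "J \<subseteq> I" for J
    by (rule finite_forbidden [OF that(1) order_trans [OF that(2) I(1)] Z IH])
  then obtain s :: "nat \<Rightarrow> 'g" where sI: "\<And>n. s n \<in> I" and s: "\<And>n. s n \<notin> forbidden I H Z (s ` {..<n})"
    using generic_sequence [OF I(2), of "forbidden I H Z"] by metis
  have sG [simp]: "s n \<in> carrier G" for n using I sI by auto
  have sZ: "s n \<notin> Z" for n using s [of n] unfolding forbidden_def by blast
  have sJK: "s j \<notin> s ` {..<j} <#> K" for j using s [of j] unfolding forbidden_def by blast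
  have lt: "({s i} <#> K) \<inter> {s j} = {}" if "i < j" for i j
    using sJK [of j] that unfolding set_mult_def by blast
  have sep: "({s i} <#> K) \<inter> {s j} = {}" if "i \<noteq> j" for i j
  proof (cases "i < j")
    case False
    then have "({s j} <#> K) \<inter> {s i} = {}" using that by (intro lt) simp
    then show ?thesis by (rule set_mult_K_disjoint_sym [rotated 2]) simp_all
  qed (rule lt)
  have inj: "inj s"
  proof (rule injI, rule ccontr)
    fix i j assume "s i = s j" "i \<noteq> j"
    then show False using sep [of i j] subset_set_mult_K [of "{s i}"] by simp
  qed
  \<comment> \<open>A translate \<open>h\<close> outside \<open>H\<close> loses at most
    \<open>card Z\<close> positions to the neighbourhood of the core and of \<open>F\<close>, and
    \<open>3 + 2 * card K\<close> to the generic positions themselves. Neither number depends on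
    \<open>n\<close>.\<close>
  define M where "M = card Z + (3 + 2 * card K)"
  obtain n :: nat where n: "2 ^ M * (card (C \<union> F) + n) ^ 4 < 2 ^ n"
    using power_exceeds_poly by blast
  define S where "S = C \<union> s ` {..<n}"
  define R where "R = S \<union> F"
  define E where "E = quotients R <#> quotients R"
  define Y where "Y = (C \<union> F \<union> s ` {..<n}) <#> K"
  have S: "finite S" "S \<subseteq> carrier G" "S \<inter> F = {}"
    using C sZ CFZ by (auto simp: S_def)
  have R: "finite R" "R \<subseteq> carrier G" using S F by (auto simp: R_def)
  have E: "finite E" "E \<subseteq> carrier G"
    using R quotients_carrier by (simp_all add: E_def set_mult_closed)
  have "card R \<le> card (C \<union> F) + n"
  proof -
    have "R = (C \<union> F) \<union> s ` {..<n}" by (auto simp: R_def S_def)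
    then show ?thesis
      using card_Un_le [of "C \<union> F" "s ` {..<n}"] card_image_le [of "{..<n}" s] by simp
  qed
  then have "card R ^ 4 \<le> (card (C \<union> F) + n) ^ 4" by (rule power_mono) simp
  moreover have "card E \<le> card R ^ 4"
  proof -
    have "card E \<le> card (quotients R) * card (quotients R)"
      using R by (simp add: E_def card_set_mult)
    also have "\<dots> \<le> (card R * card R) * (card R * card R)"
      using card_quotients [OF R(1)] by (rule mult_le_mono) (rule card_quotients [OF R(1)])
    finally show ?thesis by (simp add: power4_eq_xxxx mult.assoc)
  qed
  ultimately have "card E \<le> (card (C \<union> F) + n) ^ 4" by linarith
  then have "card (E - H) \<le> (card (C \<union> F) + n) ^ 4"
    using card_mono [OF E(1), of "E - H"] by auto
  then have "card (E - H) * 2 ^ M \<le> (card (C \<union> F) + n) ^ 4 * 2 ^ M" by (rule mult_le_mono1)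
  then have big: "card (E - H) * 2 ^ M < 2 ^ n" using n by (metis mult.commute order.strict_trans1)
  have few: "card {i. i < n \<and> i \<notin> {i. h \<otimes> s i \<notin> Y}} \<le> M" if "h \<in> E - H" for h
  proof -
    have h: "h \<in> carrier G" "h \<notin> H" using that E by auto
    let ?A = "{i. h \<otimes> s i \<in> Z}" and ?B = "{i. h \<otimes> s i \<in> range s <#> K}"
    have A: "finite ?A" "card ?A \<le> card Z"
      using card_translates_in [OF inj sG h(1) Z] by blast+
    have B: "finite ?B" "card ?B \<le> 3 + 2 * card K"
      using generic_translates [OF I(1) sI s h] by blast+
    have "Y \<subseteq> Z \<union> (range s <#> K)" unfolding Y_def Z_def set_mult_def by blast
    then have "{i. i < n \<and> i \<notin> {i. h \<otimes> s i \<notin> Y}} \<subseteq> ?A \<union> ?B" by blast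
    then have "card {i. i < n \<and> i \<notin> {i. h \<otimes> s i \<notin> Y}} \<le> card (?A \<union> ?B)"
      using A B by (intro card_mono) auto
    then show ?thesis using A B card_Un_le [of ?A ?B] by (simp add: M_def)
  qed
  \<comment> \<open>Off \<open>Y\<close> nothing is prescribed yet, so \<open>p\<close> can later be
    glued to \<open>x1\<close> on the landing places \<open>D\<close>. \<open>V\<close> says where
    \<open>p\<close> shows \<alpha> among the \<open>s i\<close>; every \<open>h\<close> gets a
    position whose required symbol differs from the symbol of \<open>x1\<close> at its
    translate.\<close>
  have "\<exists>V. \<forall>h\<in>E - H. \<exists>i\<in>{i. h \<otimes> s i \<notin> Y}. i < n \<and> (i \<in> V) \<noteq> (x1 (h \<otimes> s i) = \<alpha>)"
    by (rule exists_avoiding_subset [OF finite_Diff [OF E(1)] _ big]) (rule few)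
  then obtain V where V: "\<And>h. h \<in> E - H \<Longrightarrow> \<exists>i. h \<otimes> s i \<notin> Y \<and> i < n \<and> (i \<in> V) \<noteq> (x1 (h \<otimes> s i) = \<alpha>)"
    by blast
  define D where "D = (\<lambda>(h, i). h \<otimes> s i) ` (E \<times> {..<n}) - Y"
  have D: "finite D" "D \<subseteq> carrier G" using E by (auto simp: D_def)
  have "\<exists>v. \<forall>i. v i \<in> X \<and> v i (s i) = (if i \<in> V then \<alpha> else \<beta>)"
    using symbol_occurs [OF sG] by (intro choice) (simp add: Bex_def)
  then obtain v where v: "\<And>i. v i \<in> X" "\<And>i. v i (s i) = (if i \<in> V then \<alpha> else \<beta>)" by blast
  have "\<exists>z\<in>X. \<forall>j\<in>{..<n}. \<forall>t\<in>{s j}. z t = v j t"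
    by (rule glue_family) (simp_all add: v(1) sep)
  then obtain z where z: "z \<in> X" "\<And>i. i < n \<Longrightarrow> z (s i) = v i (s i)" by auto
  have "(C <#> K) \<inter> s ` {..<n} = {}" using sZ unfolding Z_def set_mult_def by blast
  then obtain z' where z': "z' \<in> X" "\<forall>t\<in>C. z' t = c t" "\<forall>t\<in>s ` {..<n}. z' t = z t"
    using glue [OF C(1,2) _ _ _ C(5) z(1), of "s ` {..<n}"] by (metis (no_types, lifting) \<open>\<And>n. s n \<in> carrier G\<close> finite_imageI finite_lessThan image_subsetI)
  have "S \<subseteq> C \<union> F \<union> s ` {..<n}" by (auto simp: S_def)
  then have "(S <#> K) \<inter> D = {}" unfolding D_def Y_def set_mult_def by blast
  then obtain p where p: "p \<in> X" "\<forall>t\<in>S. p t = z' t" "\<forall>t\<in>D. p t = x1 t"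
    using glue [OF S(1,2) D _ z'(1) x1] by blast
  have pC: "\<forall>t\<in>C. p t = c t" using p z' by (auto simp: S_def)
  have ps: "p (s i) = (if i \<in> V then \<alpha> else \<beta>)" if "i < n" for i
    using p(2) z'(3) z(2) [OF that] that v(2) [of i] by (simp add: S_def)
  have m': "m \<le> card ((\<lambda>z. restrict z F) ` {z \<in> X. \<forall>s\<in>S. z s = p s})"
  proof -
    let ?N = "(\<lambda>z. restrict z F) ` {z \<in> X. \<forall>s\<in>S. z s = p s}"
    have "(\<lambda>y. restrict y F') ` X \<subseteq> (\<lambda>q. restrict q F') ` ?N"
    proof
      fix q assume "q \<in> (\<lambda>y. restrict y F') ` X"
      then obtain y where y: "y \<in> X" "q = restrict y F'" by auto
      have "(F' <#> K) \<inter> S = {}" using F'KF S by blast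
      then obtain w where w: "w \<in> X" "\<forall>t\<in>F'. w t = y t" "\<forall>t\<in>S. w t = p t"
        using glue [OF F'(1,2) S(1,2) _ y(1) p(1)] by blast
      then have "q = restrict (restrict w F) F'" using F'F y(2) by (auto simp: restrict_def subset_iff)
      then show "q \<in> (\<lambda>q. restrict q F') ` ?N" using w by blast
    qed
    moreover have fin: "finite ?N"
      by (rule finite_subset [OF _ finite_patterns [OF F]]) auto
    ultimately have "card ((\<lambda>y. restrict y F') ` X) \<le> card ?N"
      by (meson card_image_le card_mono finite_imageI order_trans)
    then show ?thesis using m by simp
  qed
  have *: "\<exists>t\<in>S. override_on p z F (e \<otimes> t) \<noteq> p t" if e: "e \<in> E" "e \<notin> act_kernel" for e z
  proof (cases "e \<in> H")
    case True
    then obtain w where w: "w \<in> S1" "e \<otimes> w \<in> S1" "x1 (e \<otimes> w) \<noteq> x1 w" using brk [of e] e by auto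
    have "p t = x1 t" if "t \<in> S1" for t using pC C(3,6) that by auto
    then have "override_on p z F (e \<otimes> w) \<noteq> p w" using w S1F by (auto simp: override_on_def)
    moreover have "w \<in> S" using w C(3) by (auto simp: S_def)
    ultimately show ?thesis by blast
  next
    case False
    then obtain i where i: "e \<otimes> s i \<notin> Y" "i < n" "(i \<in> V) \<noteq> (x1 (e \<otimes> s i) = \<alpha>)" using V e by blast
    have "F \<subseteq> Y" using CFZ unfolding Z_def Y_def set_mult_def by blast
    then have "e \<otimes> s i \<notin> F" using i by auto
    moreover have "e \<otimes> s i \<in> D" using e i by (auto simp: D_def)
    ultimately have "override_on p z F (e \<otimes> s i) = x1 (e \<otimes> s i)" using p by simp
    moreover have "p (s i) \<noteq> x1 (e \<otimes> s i)" using ps [OF i(2)] i(3) \<alpha>_neq_\<beta> by auto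
    moreover have "s i \<in> S" using i by (simp add: S_def)
    ultimately show ?thesis by (intro bexI [of _ "s i"]) auto
  qed
  have **: "override_on y z F \<in> X"
    if "y \<in> X" "z \<in> X" "\<forall>s\<in>S. y s = p s" "\<forall>s\<in>S. z s = p s" for y z
    using swap [OF that(1,2)] that(3,4) pC by (auto simp: S_def)
  from S(1,2) F S(3) p(1) satF m' ** * show ?thesis
    unfolding E_def R_def by (rule that)
qed

end

section \<open>Rewriting the stored symbols\<close>

text \<open>\<open>S\<close> carries the recognisable pattern and \<open>F\<close> the payload: a
  label in \<open>L\<close> is stored as the filling \<open>enc l\<close>. Isolation is assumed for
  every filling of \<open>F\<close> coming from \<open>X\<close>, so that it cannot depend on the
  stored label.\<close>

locale marker = si_subshift G B X K \<alpha> \<beta>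
  for G (structure) and B :: "'b set" and X :: "('g \<Rightarrow> 'b) set" and K \<alpha> \<beta> +
  fixes S F :: "'g set" and p :: "'g \<Rightarrow> 'b" and L :: "'c set" and enc :: "'c \<Rightarrow> 'g \<Rightarrow> 'b"
  assumes finite_S: "finite S" and S_carrier: "S \<subseteq> carrier G"
    and finite_F: "finite F" and F_carrier: "F \<subseteq> carrier G"
    and S_F_disjoint: "S \<inter> F = {}" and p_in_X: "p \<in> X"
    and act_kernel_F: "n \<in> act_kernel \<Longrightarrow> f \<in> F \<Longrightarrow> n \<otimes> f \<in> F"
    and inj_enc: "inj_on enc L"
    and enc_filling: "l \<in> L \<Longrightarrow> \<exists>z\<in>X. (\<forall>s\<in>S. z s = p s) \<and> enc l = restrict z F"
    and swap: "\<lbrakk>y \<in> X; z \<in> X; \<forall>s\<in>S. y s = p s; \<forall>s\<in>S. z s = p s\<rbrakk> \<Longrightarrow> override_on y z F \<in> X"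
    and isolated: "\<lbrakk>z \<in> X; e \<in> quotients (S \<union> F) <#> quotients (S \<union> F); e \<notin> act_kernel\<rbrakk>
      \<Longrightarrow> \<exists>s\<in>S. override_on p z F (e \<otimes> s) \<noteq> p s"
begin

lemma S_in [simp]: "s \<in> S \<Longrightarrow> s \<in> carrier G" and F_in [simp]: "f \<in> F \<Longrightarrow> f \<in> carrier G"
  using S_carrier F_carrier by auto

lemma kernel_in [simp]: "n \<in> act_kernel \<Longrightarrow> n \<in> carrier G"
  by (rule act_kernel_carrier)

abbreviation EE where "EE \<equiv> quotients (S \<union> F) <#> quotients (S \<union> F)"

lemma EE_carrier: "EE \<subseteq> carrier G"
  by (intro set_mult_closed quotients_carrier) (use S_carrier F_carrier in auto)

lemma quotient_in_EE:
  assumes "a \<in> S \<union> F" "b \<in> S \<union> F" shows "a \<otimes> inv b \<in> EE"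
proof -
  have "(a \<otimes> inv b) \<otimes> (b \<otimes> inv b) \<in> EE" using assms by (intro set_multI quotientsI)
  then show ?thesis using assms S_carrier F_carrier by auto
qed

lemma override_enc:
  assumes "l \<in> L" "y \<in> X" "\<forall>s\<in>S. y s = p s" shows "override_on y (enc l) F \<in> X"
proof -
  obtain z where z: "z \<in> X" "\<forall>s\<in>S. z s = p s" "enc l = restrict z F" using enc_filling assms(1) by blast
  have "override_on y (enc l) F = override_on y z F" by (auto simp: override_on_def z)
  then show ?thesis using swap [OF assms(2) z(1) assms(3) z(2)] by simp
qed

lemma enc_kernel:
  assumes "l \<in> L" "n \<in> act_kernel" "f \<in> F" shows "enc l (n \<otimes> f) = enc l f"
proof -
  obtain z where z: "z \<in> X" "enc l = restrict z F" using enc_filling assms(1) by blast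
  show ?thesis using z assms act_kernel_F act_kernel_apply by auto
qed

section \<open>Markers, labels and their separation\<close>

definition agrees :: "('g \<Rightarrow> 'b) \<Rightarrow> bool"
  where "agrees y \<longleftrightarrow> (\<forall>s\<in>S. y s = p s)"

text \<open>The last condition makes being marked insensitive to rewriting the labels: no other occurrence
  of \<open>p\<close> near the marker can be created in this way.\<close>

definition marked :: "('g \<Rightarrow> 'b) \<Rightarrow> bool"
  where "marked y \<longleftrightarrow> agrees y \<and> restrict y F \<in> enc ` L \<and>
    (\<forall>l\<in>L. \<forall>e\<in>EE - act_kernel. \<exists>s\<in>S. override_on y (enc l) F (e \<otimes> s) \<noteq> p s)"

definition markers :: "('g \<Rightarrow> 'b) \<Rightarrow> 'g set"
  where "markers x = {h \<in> carrier G. marked (tr h x)}"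

definition label :: "('g \<Rightarrow> 'b) \<Rightarrow> 'g \<Rightarrow> 'c"
  where "label x h = inv_into L enc (restrict (tr h x) F)"

text \<open>Markers that differ by \<open>act_kernel\<close> occupy the same label positions, so
  \<open>g\<close> may be reached from several \<open>h\<close>. \<open>SOME\<close> picks one of
  them, and consistency of \<open>r\<close> makes the result independent of the choice.\<close>

definition rewrite_on :: "'g set \<Rightarrow> ('g \<Rightarrow> 'c) \<Rightarrow> ('g \<Rightarrow> 'b) \<Rightarrow> 'g \<Rightarrow> 'b"
  where "rewrite_on J r x g = (if \<exists>h\<in>J. \<exists>f\<in>F. g = h \<otimes> f
    then let h = SOME h. h \<in> J \<and> (\<exists>f\<in>F. g = h \<otimes> f) in enc (r h) (inv h \<otimes> g) else x g)"

definition consistent :: "'g set \<Rightarrow> ('g \<Rightarrow> 'c) \<Rightarrow> bool"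
  where "consistent J r \<longleftrightarrow> (\<forall>h\<in>J. r h \<in> L \<and> (\<forall>n\<in>act_kernel. h \<otimes> n \<in> J \<longrightarrow> r (h \<otimes> n) = r h))"

lemma consistentD: "consistent J r \<Longrightarrow> h \<in> J \<Longrightarrow> r h \<in> L"
  "consistent J r \<Longrightarrow> h \<in> J \<Longrightarrow> n \<in> act_kernel \<Longrightarrow> h \<otimes> n \<in> J \<Longrightarrow> r (h \<otimes> n) = r h"
  by (auto simp: consistent_def)

lemma consistent_subset: "consistent J r \<Longrightarrow> I \<subseteq> J \<Longrightarrow> consistent I r"
  unfolding consistent_def by blast

lemma marker_marked: "h \<in> markers x \<Longrightarrow> marked (tr h x)"
  by (simp add: markers_def)

lemma markersI: "h \<in> carrier G \<Longrightarrow> marked (tr h x) \<Longrightarrow> h \<in> markers x"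
  by (simp add: markers_def)

lemma marker_filling: "h \<in> markers x \<Longrightarrow> restrict (tr h x) F \<in> enc ` L"
  using marker_marked unfolding marked_def by blast

lemma markers_kernel: "x \<in> X \<Longrightarrow> h \<in> markers x \<Longrightarrow> n \<in> act_kernel \<Longrightarrow> h \<otimes> n \<in> markers x"
  by (simp add: markers_def tr_mult_act_kernel)

lemma tr_tr: "g \<in> carrier G \<Longrightarrow> h \<in> carrier G \<Longrightarrow> tr h (tr g x) = tr (g \<otimes> h) x"
  by (simp add: tr_mult)

lemma markers_tr: "g \<in> carrier G \<Longrightarrow> h \<in> carrier G \<Longrightarrow> h \<in> markers (tr g x) \<longleftrightarrow> g \<otimes> h \<in> markers x"
  by (simp add: markers_def tr_tr)

lemma markers_in [simp]: "h \<in> markers x \<Longrightarrow> h \<in> carrier G"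
  by (simp add: markers_def)

lemma marker_agrees:
  assumes "h \<in> markers x" "s \<in> S" shows "x (h \<otimes> s) = p s"
proof -
  have "agrees (tr h x)" using marker_marked [OF assms(1)] unfolding marked_def by blast
  then show ?thesis using assms by (simp add: agrees_def tr_apply)
qed

lemma label_in: "h \<in> markers x \<Longrightarrow> label x h \<in> L"
  unfolding label_def by (intro inv_into_into marker_filling)

lemma enc_label: "h \<in> markers x \<Longrightarrow> enc (label x h) = restrict (tr h x) F"
  unfolding label_def by (intro f_inv_into_f marker_filling)

lemma enc_label_apply: "h \<in> markers x \<Longrightarrow> f \<in> F \<Longrightarrow> enc (label x h) f = x (h \<otimes> f)"
  by (simp add: enc_label tr_apply)

lemma label_eqI: "l \<in> L \<Longrightarrow> restrict (tr h x) F = enc l \<Longrightarrow> label x h = l"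
  by (simp add: label_def inj_enc)

lemma label_kernel: "x \<in> X \<Longrightarrow> h \<in> carrier G \<Longrightarrow> n \<in> act_kernel \<Longrightarrow> label x (h \<otimes> n) = label x h"
  by (simp add: label_def tr_mult_act_kernel)

lemma consistent_label: "x \<in> X \<Longrightarrow> consistent (markers x) (label x)"
  by (simp add: consistent_def label_in label_kernel)

text \<open>The last condition in \<open>marked\<close>, taken for the label already stored, is a
  statement about \<open>x\<close> itself.\<close>

lemma no_occurrence_near_marker:
  assumes "h \<in> markers x" "e \<in> EE" "e \<notin> act_kernel"
  shows "\<exists>s\<in>S. x (h \<otimes> e \<otimes> s) \<noteq> p s"
proof -
  have "\<exists>s\<in>S. override_on (tr h x) (enc (label x h)) F (e \<otimes> s) \<noteq> p s"
    using marker_marked [OF assms(1)] label_in [OF assms(1)] assms(2,3) unfolding marked_def by blast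
  then obtain s where s: "s \<in> S" "override_on (tr h x) (enc (label x h)) F (e \<otimes> s) \<noteq> p s" by blast
  have "override_on (tr h x) (enc (label x h)) F = tr h x"
    by (auto simp: enc_label [OF assms(1)] override_on_def)
  then have "x (h \<otimes> (e \<otimes> s)) \<noteq> p s"
    using s assms EE_carrier by (simp add: tr_apply subset_iff)
  then show ?thesis using s assms EE_carrier by (intro bexI [of _ s]) (auto simp: m_assoc)
qed

lemma markers_separated:
  assumes "h \<in> markers x" "h' \<in> markers x" "inv h \<otimes> h' \<in> EE"
  shows "inv h \<otimes> h' \<in> act_kernel"
proof (rule ccontr)
  assume "\<not> ?thesis"
  then obtain s where s: "s \<in> S" "x (h \<otimes> (inv h \<otimes> h') \<otimes> s) \<noteq> p s"
    using no_occurrence_near_marker [OF assms(1,3)] by blast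
  have "h \<otimes> (inv h \<otimes> h') = h'" using assms by (simp add: m_assoc [symmetric])
  then show False using s marker_agrees [OF assms(2)] by simp
qed

text \<open>An overlap makes \<open>inv h \<otimes> h'\<close> a quotient of the window, hence an
  element of the kernel. Since \<open>F\<close> is invariant under the kernel, a label position can
  then only coincide with a label position.\<close>

lemma marker_overlap:
  assumes h: "h \<in> markers x" "h' \<in> markers x" and f: "f \<in> F" and r: "r \<in> S \<union> F" and eq: "h \<otimes> f = h' \<otimes> r"
  obtains n where "n \<in> act_kernel" "h' = h \<otimes> n" "f = n \<otimes> r" "r \<in> F"
proof -
  have G: "h \<in> carrier G" "h' \<in> carrier G" "f \<in> carrier G" "r \<in> carrier G"
    using h f r S_carrier F_carrier by auto
  have "f = inv h \<otimes> (h' \<otimes> r)" using eq G by (metis inv_solve_left m_closed)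
  then have f': "f = (inv h \<otimes> h') \<otimes> r" using G by (simp add: m_assoc)
  then have "inv h \<otimes> h' = f \<otimes> inv r" using G by (simp add: m_assoc)
  then have n: "inv h \<otimes> h' \<in> act_kernel"
    using markers_separated [OF h] quotient_in_EE [of f r] f r by simp
  have "r = inv (inv h \<otimes> h') \<otimes> f" using f' G by (metis inv_closed inv_solve_left m_closed)
  then have "r \<in> F" using act_kernel_F [OF act_kernel_inv [OF n] f] by simp
  moreover have "h' = h \<otimes> (inv h \<otimes> h')" using G by (simp add: m_assoc [symmetric])
  ultimately show ?thesis using that n f' by blast
qed

section \<open>Rewriting a set of markers\<close>

lemma rewrite_on_out: "(\<And>h f. h \<in> J \<Longrightarrow> f \<in> F \<Longrightarrow> g \<noteq> h \<otimes> f) \<Longrightarrow> rewrite_on J r x g = x g"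
  by (auto simp: rewrite_on_def)

lemma rewrite_on_in:
  assumes J: "J \<subseteq> markers x" "consistent J r" and h: "h \<in> J" "f \<in> F"
  shows "rewrite_on J r x (h \<otimes> f) = enc (r h) f"
proof -
  define h' where "h' = (SOME h'. h' \<in> J \<and> (\<exists>f'\<in>F. h \<otimes> f = h' \<otimes> f'))"
  have "h' \<in> J \<and> (\<exists>f'\<in>F. h \<otimes> f = h' \<otimes> f')" unfolding h'_def by (rule someI) (use h in blast)
  then obtain f' where h': "h' \<in> J" "f' \<in> F" "h \<otimes> f = h' \<otimes> f'" by blast
  have "h \<in> markers x" "h' \<in> markers x" "f' \<in> S \<union> F" using J h h' by auto
  from marker_overlap [OF this(1,2) h(2) this(3) h'(3)]
  obtain n where n: "n \<in> act_kernel" "h' = h \<otimes> n" "f = n \<otimes> f'" .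
  have G: "h' \<in> carrier G" "f' \<in> carrier G" using J h' by auto
  have "rewrite_on J r x (h \<otimes> f) = enc (r h') (inv h' \<otimes> (h \<otimes> f))"
    unfolding rewrite_on_def h'_def [symmetric] Let_def using h by auto
  also have "inv h' \<otimes> (h \<otimes> f) = f'" using G by (simp add: h'(3) m_assoc [symmetric])
  also have "r h' = r h" using J(2) h h' n by (simp add: consistentD)
  also have "enc (r h) f' = enc (r h) f"
    using enc_kernel [of "r h" n f'] consistentD(1) [OF J(2) h(1)] n h' by simp
  finally show ?thesis .
qed

text \<open>By \<open>marker_overlap\<close> the labels rewritten at \<open>J\<close> do not touch
  the translate of \<open>S\<close> at \<open>h\<close>, so \<open>p\<close> is still present there
  and the label can be exchanged by \<open>swap\<close> after translating \<open>h\<close> to the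
  identity.\<close>

lemma rewrite_on_insert:
  assumes x: "x \<in> X" and J: "insert h J \<subseteq> markers x" "consistent (insert h J) r"
    and y: "rewrite_on J r x \<in> X"
  shows "rewrite_on (insert h J) r x \<in> X"
proof -
  let ?y = "rewrite_on J r x"
  have h: "h \<in> markers x" and hG: "h \<in> carrier G" using J by auto
  have J': "J \<subseteq> markers x" "consistent J r" using J by (auto intro: consistent_subset)
  have "?y (h \<otimes> s) = p s" if s: "s \<in> S" for s
  proof -
    have "h \<otimes> s \<noteq> h' \<otimes> f" if h': "h' \<in> J" "f \<in> F" for h' f
    proof
      assume "h \<otimes> s = h' \<otimes> f"
      from marker_overlap [OF _ h h'(2) _ this [symmetric]] h'(1) J'(1) s
      have "s \<in> F" by blast
      then show False using s S_F_disjoint by blast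
    qed
    then show ?thesis using rewrite_on_out [of J "h \<otimes> s"] marker_agrees [OF h s] by auto
  qed
  then have "\<forall>s\<in>S. tr h ?y s = p s" by (simp add: tr_apply)
  then have "override_on (tr h ?y) (enc (r h)) F \<in> X"
    using X_translate [OF hG y] J(2) by (intro override_enc) (auto simp: consistent_def)
  then have w: "tr (inv h) (override_on (tr h ?y) (enc (r h)) F) \<in> X" (is "?w \<in> X")
    using hG by (intro X_translate) auto
  have "rewrite_on (insert h J) r x g = ?w g" for g
  proof (cases "g \<in> carrier G")
    case False
    then have "rewrite_on (insert h J) r x g = x g"
      using J by (intro rewrite_on_out) auto
    then show ?thesis using False extensional_arb [OF X_extensional [OF x]] by (simp add: translate_def)
  next
    case g: True
    have hg: "h \<otimes> (inv h \<otimes> g) = g" using g hG by (simp add: m_assoc [symmetric])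
    have w_eq: "?w g = (if inv h \<otimes> g \<in> F then enc (r h) (inv h \<otimes> g) else ?y g)"
      using g hG hg by (simp add: tr_apply override_on_def)
    show ?thesis
    proof (cases "inv h \<otimes> g \<in> F")
      case True
      then show ?thesis using w_eq rewrite_on_in [OF J, of h "inv h \<otimes> g"] hg by simp
    next
      case False
      have nh: "g \<noteq> h \<otimes> f" if "f \<in> F" for f
        using False that hG by (auto simp: m_assoc [symmetric])
      show ?thesis
      proof (cases "\<exists>h'\<in>J. \<exists>f\<in>F. g = h' \<otimes> f")
        case True
        then obtain h' f where "h' \<in> J" "f \<in> F" "g = h' \<otimes> f" by blast
        then show ?thesis
          using w_eq False rewrite_on_in [OF J, of h' f] rewrite_on_in [OF J', of h' f] by simp
      next
        case no: False
        have "rewrite_on (insert h J) r x g = x g" using no nh by (intro rewrite_on_out) blast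
        moreover have "?y g = x g" using no by (intro rewrite_on_out) blast
        ultimately show ?thesis using w_eq False by simp
      qed
    qed
  qed
  then have "rewrite_on (insert h J) r x = ?w" by (rule ext)
  then show ?thesis using w by simp
qed

lemma rewrite_on_finite:
  assumes "finite J" and x: "x \<in> X" and "J \<subseteq> markers x" "consistent J r"
  shows "rewrite_on J r x \<in> X"
  using assms(1,3,4)
proof (induction J)
  case empty
  have "rewrite_on {} r x = x" by (auto simp: rewrite_on_def)
  then show ?case using x by simp
next
  case (insert h J)
  have "rewrite_on J r x \<in> X"
    by (rule insert.IH) (use insert.prems in \<open>auto intro: consistent_subset\<close>)
  then show ?case using insert.prems by (intro rewrite_on_insert [OF x])
qed

text \<open>By closedness it suffices to look at finite windows, and such a window meets the labels
  of finitely many markers only.\<close>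

lemma rewrite_on_in_X:
  assumes x: "x \<in> X" and J: "J \<subseteq> markers x" "consistent J r"
  shows "rewrite_on J r x \<in> X"
proof (rule X_closed)
  show "rewrite_on J r x \<in> extensional (carrier G)"
    unfolding extensional_def
  proof (intro CollectI allI impI)
    fix g assume g: "g \<notin> carrier G"
    have "rewrite_on J r x g = x g" using g J by (intro rewrite_on_out) auto
    then show "rewrite_on J r x g = undefined" using g extensional_arb [OF X_extensional [OF x]] by simp
  qed
  fix W assume W: "finite W" "W \<subseteq> carrier G"
  define J' where "J' = J \<inter> (\<lambda>(w, f). w \<otimes> inv f) ` (W \<times> F)"
  have J': "finite J'" "J' \<subseteq> J" using W finite_F by (auto simp: J'_def)
  have cJ': "J' \<subseteq> markers x" "consistent J' r" using J J' by (auto intro: consistent_subset)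
  have "rewrite_on J' r x w = rewrite_on J r x w" if w: "w \<in> W" for w
  proof (cases "\<exists>h\<in>J. \<exists>f\<in>F. w = h \<otimes> f")
    case True
    then obtain h f where h: "h \<in> J" "f \<in> F" "w = h \<otimes> f" by blast
    then have "h = w \<otimes> inv f" using J by (auto simp: m_assoc)
    then have "h \<in> J'" using w h(1,2) unfolding J'_def by (intro IntI image_eqI [of _ _ "(w, f)"]) auto
    then show ?thesis
      using h rewrite_on_in [OF J, of h f] rewrite_on_in [OF cJ', of h f] by simp
  next
    case False
    have "rewrite_on J' r x w = x w" using False J'(2) by (intro rewrite_on_out) blast
    moreover have "rewrite_on J r x w = x w" using False by (intro rewrite_on_out) blast
    ultimately show ?thesis by simp
  qed
  then show "\<exists>y\<in>X. \<forall>w\<in>W. y w = rewrite_on J r x w"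
    using rewrite_on_finite [OF J'(1) x cJ'] by blast
qed

text \<open>A translate of \<open>S\<close> meets the rewritten labels of at most one marker (up to \<open>act_kernel\<close>), so
  the condition defining \<open>marked\<close> excludes both new and destroyed occurrences of \<open>p\<close>.\<close>

lemma agrees_rewrite_on:
  assumes x: "x \<in> X" and J: "J \<subseteq> markers x" "consistent J r" and k: "k \<in> carrier G"
  shows "agrees (tr k (rewrite_on J r x)) \<longleftrightarrow> agrees (tr k x)"
proof (cases "\<exists>h\<in>J. \<exists>f\<in>F. \<exists>s\<in>S. k \<otimes> s = h \<otimes> f")
  case False
  then have "rewrite_on J r x (k \<otimes> s) = x (k \<otimes> s)" if "s \<in> S" for s
    using that by (intro rewrite_on_out) blast
  then show ?thesis by (simp add: agrees_def tr_apply)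
next
  case True
  then obtain h f s where h: "h \<in> J" "f \<in> F" "s \<in> S" "k \<otimes> s = h \<otimes> f" by blast
  have hm: "h \<in> markers x" and hG: "h \<in> carrier G" using h J by auto
  define e where "e = inv h \<otimes> k"
  have eG: "e \<in> carrier G" and k_eq: "k = h \<otimes> e"
    using hG k by (simp_all add: e_def m_assoc [symmetric])
  have "e \<otimes> s = inv h \<otimes> (k \<otimes> s)" using hG k h by (simp add: e_def m_assoc)
  then have es: "e \<otimes> s = f" using hG h by (simp add: m_assoc [symmetric])
  then have e_eq: "e = f \<otimes> inv s" using eG h by (auto simp: m_assoc)
  then have eEE: "e \<in> EE" using h by (auto intro: quotient_in_EE)
  have eker: "e \<notin> act_kernel"
  proof
    assume "e \<in> act_kernel"
    then have "inv e \<otimes> f \<in> F" using h act_kernel_inv act_kernel_F by blast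
    moreover have "inv e \<otimes> f = s" using eG h es by (auto simp: m_assoc [symmetric])
    ultimately show False using h S_F_disjoint by auto
  qed
  obtain s0 where s0: "s0 \<in> S" "x (k \<otimes> s0) \<noteq> p s0"
    using no_occurrence_near_marker [OF hm eEE eker] by (auto simp: k_eq)
  obtain s1 where s1: "s1 \<in> S" "override_on (tr h x) (enc (r h)) F (e \<otimes> s1) \<noteq> p s1"
    using marker_marked [OF hm] eEE eker consistentD(1) [OF J(2) h(1)] unfolding marked_def by blast
  \<comment> \<open>From \<open>k\<close> the rewriting is visible through the marker
    \<open>h\<close> alone: another \<open>h'\<close> in \<open>J\<close> whose label meets the
    translate of \<open>S\<close> at \<open>k\<close> would make \<open>inv h' \<otimes> h\<close> a
    product of two quotients. This is why isolation is demanded on \<open>EE\<close> and not only on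
    \<open>quotients (S \<union> F)\<close>.\<close>
  have "rewrite_on J r x (k \<otimes> s1) = override_on (tr h x) (enc (r h)) F (e \<otimes> s1)"
  proof (cases "e \<otimes> s1 \<in> F")
    case True
    then show ?thesis
      using rewrite_on_in [OF J h(1) True] hG eG s1 by (simp add: k_eq m_assoc)
  next
    case False
    have "k \<otimes> s1 \<noteq> h' \<otimes> f'" if h': "h' \<in> J" "f' \<in> F" for h' f'
    proof
      assume eq: "k \<otimes> s1 = h' \<otimes> f'"
      have h'm: "h' \<in> markers x" and h'G: "h' \<in> carrier G" using h' J by auto
      have "h = k \<otimes> (s \<otimes> inv f)" using hG eG h by (simp add: k_eq e_eq m_assoc) (simp add: m_assoc [symmetric])
      moreover have "inv h' \<otimes> k = f' \<otimes> inv s1"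
        using eq h'G k h' s1 by (metis F_in S_in inv_solve_left inv_solve_right m_assoc m_closed inv_closed)
      ultimately have "inv h' \<otimes> h = (f' \<otimes> inv s1) \<otimes> (s \<otimes> inv f)"
        using h'G k h by (metis F_in S_in inv_closed m_assoc m_closed)
      moreover have "(f' \<otimes> inv s1) \<otimes> (s \<otimes> inv f) \<in> EE"
        using h h' s1 by (intro set_multI quotientsI) auto
      ultimately have n: "inv h' \<otimes> h \<in> act_kernel" using markers_separated [OF h'm hm] by simp
      have "e \<otimes> s1 = inv h \<otimes> (h' \<otimes> f')"
        using eq hG k s1 by (simp add: e_def m_assoc)
      also have "\<dots> = inv (inv h' \<otimes> h) \<otimes> f'" using hG h'G h' by (simp add: inv_mult_group m_assoc)
      also have "\<dots> \<in> F" using act_kernel_inv [OF n] h'(2) by (rule act_kernel_F)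
      finally show False using False by simp
    qed
    then have "rewrite_on J r x (k \<otimes> s1) = x (k \<otimes> s1)" by (intro rewrite_on_out)
    then show ?thesis using False hG eG s1 by (simp add: k_eq tr_apply m_assoc)
  qed
  then have "tr k (rewrite_on J r x) s1 \<noteq> p s1" using s1 by (simp add: tr_apply)
  then have "\<not> agrees (tr k (rewrite_on J r x))" using s1(1) unfolding agrees_def by blast
  moreover have "\<not> agrees (tr k x)" using s0 by (auto simp: agrees_def tr_apply)
  ultimately show ?thesis by simp
qed

text \<open>Overriding the label of \<open>h\<close> by \<open>l\<close> after the rewriting
  amounts, on the translate at \<open>h\<close>, to a single rewriting of \<open>x\<close>, at
  \<open>J2\<close> with labels \<open>r2\<close>; such a rewriting creates no occurrence of
  \<open>p\<close>, which gives the last condition of \<open>marked\<close> for all \<open>l\<close>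
  at once. Saturation \<open>sat\<close> ensures that a marker outside \<open>J\<close> shares no
  label position with one in \<open>J\<close>.\<close>

lemma markers_rewrite_on_superset:
  assumes x: "x \<in> X" and J: "J \<subseteq> markers x" "consistent J r"
    and sat: "\<And>h n. h \<in> J \<Longrightarrow> n \<in> act_kernel \<Longrightarrow> h \<otimes> n \<in> J"
  shows "markers x \<subseteq> markers (rewrite_on J r x)"
proof
  fix h assume h: "h \<in> markers x"
  then have hG: "h \<in> carrier G" by simp
  let ?x = "rewrite_on J r x"
  have "agrees (tr h x)" using marker_marked [OF h] unfolding marked_def by blast
  then have 1: "agrees (tr h ?x)" using agrees_rewrite_on [OF x J hG] by simp
  have 2: "restrict (tr h ?x) F \<in> enc ` L"
  proof (cases "h \<in> J")
    case True
    obtain z where z: "enc (r h) = restrict z F" using enc_filling consistentD(1) [OF J(2) True] by blast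
    have "restrict (tr h ?x) F = enc (r h)"
      using rewrite_on_in [OF J True] z by (auto simp: tr_apply restrict_def fun_eq_iff)
    then show ?thesis using consistentD(1) [OF J(2) True] by simp
  next
    case False
    have "?x (h \<otimes> f) = x (h \<otimes> f)" if f: "f \<in> F" for f
    proof (rule rewrite_on_out, rule notI)
      fix h' f' assume h': "h' \<in> J" "f' \<in> F" "h \<otimes> f = h' \<otimes> f'"
      have "h' \<in> markers x" "f \<in> S \<union> F" using h' J f by auto
      from marker_overlap [OF this(1) h h'(2) this(2) h'(3) [symmetric]]
      have "h \<in> J" using sat [OF h'(1)] by metis
      then show False using False by simp
    qed
    then have "restrict (tr h ?x) F = restrict (tr h x) F" by (auto simp: tr_apply)
    then show ?thesis using marker_filling [OF h] by simp
  qed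
  have 3: "\<exists>s\<in>S. override_on (tr h ?x) (enc l) F (e \<otimes> s) \<noteq> p s"
    if l: "l \<in> L" and e: "e \<in> EE" "e \<notin> act_kernel" for l e
  proof -
    define J2 where "J2 = J \<union> (\<lambda>n. h \<otimes> n) ` act_kernel"
    define r2 where "r2 k = (if inv h \<otimes> k \<in> act_kernel then l else r k)" for k
    have eG: "e \<in> carrier G" using e EE_carrier by auto
    have J2: "J2 \<subseteq> markers x" using J h markers_kernel [OF x] by (auto simp: J2_def)
    have "r2 k \<in> L \<and> (\<forall>n\<in>act_kernel. k \<otimes> n \<in> J2 \<longrightarrow> r2 (k \<otimes> n) = r2 k)" if k: "k \<in> J2" for k
    proof (cases "inv h \<otimes> k \<in> act_kernel")
      case True
      then have "inv h \<otimes> (k \<otimes> n) \<in> act_kernel" if "n \<in> act_kernel" for n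
        using that act_kernel_mult [OF True that] hG markers_in [OF subsetD [OF J2 k]]
        by (simp add: m_assoc)
      then show ?thesis using True l by (simp add: r2_def)
    next
      case False
      have kG: "k \<in> carrier G" using k J2 by auto
      have kJ: "k \<in> J"
      proof (rule ccontr)
        assume "k \<notin> J"
        then obtain n where "n \<in> act_kernel" "k = h \<otimes> n" using k by (auto simp: J2_def)
        then show False using False hG by (simp add: m_assoc [symmetric])
      qed
      have "r2 (k \<otimes> n) = r2 k" if n: "n \<in> act_kernel" for n
      proof -
        have "inv h \<otimes> (k \<otimes> n) \<notin> act_kernel"
        proof
          assume "inv h \<otimes> (k \<otimes> n) \<in> act_kernel"
          from act_kernel_mult [OF this act_kernel_inv [OF n]]
          show False using False hG kG n by (simp add: m_assoc)
        qed
        then show ?thesis using False consistentD(2) [OF J(2) kJ n sat [OF kJ n]] by (simp add: r2_def)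
      qed
      then show ?thesis using False consistentD(1) [OF J(2) kJ] by (simp add: r2_def)
    qed
    then have c2: "consistent J2 r2" by (simp add: consistent_def)
    have hJ2: "h \<in> J2" and r2h: "r2 h = l"
      using act_kernel_one hG by (auto simp: J2_def r2_def intro: rev_image_eqI)
    have eq: "rewrite_on J2 r2 x (h \<otimes> g) = override_on (tr h ?x) (enc l) F g" if g: "g \<in> carrier G" for g
    proof (cases "g \<in> F")
      case True
      then show ?thesis using rewrite_on_in [OF J2 c2 hJ2 True] r2h by simp
    next
      case False
      have out: "h \<otimes> g \<noteq> (h \<otimes> n) \<otimes> f" if "n \<in> act_kernel" "f \<in> F" for n f
      proof
        assume "h \<otimes> g = (h \<otimes> n) \<otimes> f"
        then have "g = n \<otimes> f" using g that hG by (simp add: m_assoc)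
        then show False using False act_kernel_F that by simp
      qed
      show ?thesis
      proof (cases "\<exists>h'\<in>J. \<exists>f\<in>F. h \<otimes> g = h' \<otimes> f")
        case True
        then obtain h' f where h': "h' \<in> J" "f \<in> F" "h \<otimes> g = h' \<otimes> f" by blast
        have h'G: "h' \<in> carrier G" using h' J by auto
        have "inv h \<otimes> h' \<notin> act_kernel"
        proof
          assume "inv h \<otimes> h' \<in> act_kernel"
          moreover have "h' = h \<otimes> (inv h \<otimes> h')" using hG h'G by (simp add: m_assoc [symmetric])
          ultimately show False using out [of "inv h \<otimes> h'" f] h' by simp
        qed
        then have "rewrite_on J2 r2 x (h \<otimes> g) = enc (r h') f"
          using rewrite_on_in [OF J2 c2, of h' f] h' by (simp add: J2_def r2_def)
        moreover have "?x (h \<otimes> g) = enc (r h') f" using rewrite_on_in [OF J h'(1,2)] h' by simp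
        ultimately show ?thesis using False g by (simp add: tr_apply)
      next
        case no: False
        have "rewrite_on J2 r2 x (h \<otimes> g) = x (h \<otimes> g)"
          using no out by (intro rewrite_on_out) (auto simp: J2_def)
        moreover have "?x (h \<otimes> g) = x (h \<otimes> g)" using no by (intro rewrite_on_out) blast
        ultimately show ?thesis using False g by (simp add: tr_apply)
      qed
    qed
    have "\<not> agrees (tr (h \<otimes> e) x)"
      using no_occurrence_near_marker [OF h e] by (auto simp: agrees_def tr_apply)
    then have "\<not> agrees (tr (h \<otimes> e) (rewrite_on J2 r2 x))"
      using agrees_rewrite_on [OF x J2 c2, of "h \<otimes> e"] hG eG by simp
    then obtain s where s: "s \<in> S" "rewrite_on J2 r2 x (h \<otimes> e \<otimes> s) \<noteq> p s"
      by (auto simp: agrees_def tr_apply)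
    then have "rewrite_on J2 r2 x (h \<otimes> (e \<otimes> s)) \<noteq> p s" using hG eG by (simp add: m_assoc)
    then have "override_on (tr h ?x) (enc l) F (e \<otimes> s) \<noteq> p s" using eq [of "e \<otimes> s"] eG s(1) by simp
    then show ?thesis using s(1) by blast
  qed
  have "marked (tr h ?x)" unfolding marked_def using 1 2 3 by blast
  then show "h \<in> markers ?x" by (rule markersI [OF hG])
qed

section \<open>Rewriting all markers at once\<close>

definition rewrite :: "('g \<Rightarrow> 'c) \<Rightarrow> ('g \<Rightarrow> 'b) \<Rightarrow> 'g \<Rightarrow> 'b"
  where "rewrite r x = rewrite_on (markers x) r x"

lemma rewrite_in_X: "x \<in> X \<Longrightarrow> consistent (markers x) r \<Longrightarrow> rewrite r x \<in> X"
  unfolding rewrite_def by (rule rewrite_on_in_X) auto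

lemma rewrite_in:
  "consistent (markers x) r \<Longrightarrow> h \<in> markers x \<Longrightarrow> f \<in> F \<Longrightarrow> rewrite r x (h \<otimes> f) = enc (r h) f"
  unfolding rewrite_def by (rule rewrite_on_in) auto

lemma rewrite_out: "(\<And>h f. h \<in> markers x \<Longrightarrow> f \<in> F \<Longrightarrow> g \<noteq> h \<otimes> f) \<Longrightarrow> rewrite r x g = x g"
  unfolding rewrite_def by (rule rewrite_on_out)

text \<open>The reverse inclusion comes from undoing: writing the old labels back into
  \<open>rewrite r x\<close> restores \<open>x\<close>.\<close>

lemma markers_rewrite:
  assumes x: "x \<in> X" and r: "consistent (markers x) r"
  shows "markers (rewrite r x) = markers x"
proof
  let ?y = "rewrite r x" and ?M = "markers x"
  have y: "?y \<in> X" using x r by (rule rewrite_in_X)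
  have sat: "h \<otimes> n \<in> ?M" if "h \<in> ?M" "n \<in> act_kernel" for h n using markers_kernel [OF x that] .
  show sub: "?M \<subseteq> markers ?y"
    unfolding rewrite_def using markers_rewrite_on_superset [OF x order_refl r sat] .
  have c: "consistent ?M (label x)" using consistent_label x by blast
  have "rewrite_on ?M (label x) ?y g = x g" for g
  proof (cases "\<exists>h\<in>?M. \<exists>f\<in>F. g = h \<otimes> f")
    case True
    then obtain h f where h: "h \<in> ?M" "f \<in> F" "g = h \<otimes> f" by blast
    then show ?thesis using rewrite_on_in [OF sub c h(1,2)] enc_label_apply [OF h(1,2)] by simp
  next
    case False
    have "rewrite_on ?M (label x) ?y g = ?y g" using False by (intro rewrite_on_out) blast
    also have "?y g = x g" using False by (intro rewrite_out) blast
    finally show ?thesis .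
  qed
  then have "rewrite_on ?M (label x) ?y = x" by (rule ext)
  then show "markers ?y \<subseteq> ?M" using markers_rewrite_on_superset [OF y sub c sat] by simp
qed

lemma label_rewrite:
  assumes r: "consistent (markers x) r" and h: "h \<in> markers x"
  shows "label (rewrite r x) h = r h"
proof (rule label_eqI)
  show l: "r h \<in> L" using r h by (rule consistentD)
  obtain z where z: "enc (r h) = restrict z F" using enc_filling l by blast
  show "restrict (tr h (rewrite r x)) F = enc (r h)"
    using rewrite_in [OF r h] z by (auto simp: tr_apply restrict_def fun_eq_iff)
qed

lemma rewrite_rewrite:
  assumes x: "x \<in> X" and r: "consistent (markers x) r" "consistent (markers x) r'"
  shows "rewrite r' (rewrite r x) = rewrite r' x"
proof
  fix g
  have m: "markers (rewrite r x) = markers x" using x r(1) by (rule markers_rewrite)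
  show "rewrite r' (rewrite r x) g = rewrite r' x g"
  proof (cases "\<exists>h\<in>markers x. \<exists>f\<in>F. g = h \<otimes> f")
    case True
    then show ?thesis using rewrite_in r m by metis
  next
    case False
    have "rewrite r' (rewrite r x) g = rewrite r x g" using False m by (intro rewrite_out) blast
    moreover have "rewrite r x g = x g" "rewrite r' x g = x g" using False by (auto intro!: rewrite_out)
    ultimately show ?thesis by simp
  qed
qed

lemma rewrite_cong:
  assumes "consistent (markers x) r" "consistent (markers x) r'" "\<And>h. h \<in> markers x \<Longrightarrow> r h = r' h"
  shows "rewrite r x = rewrite r' x"
proof
  fix g
  show "rewrite r x g = rewrite r' x g"
  proof (cases "\<exists>h\<in>markers x. \<exists>f\<in>F. g = h \<otimes> f")
    case True
    then show ?thesis using rewrite_in assms by metis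
  next
    case False
    then have "rewrite r x g = x g" "rewrite r' x g = x g" by (auto intro!: rewrite_out)
    then show ?thesis by simp
  qed
qed

lemma rewrite_label: "x \<in> X \<Longrightarrow> rewrite (label x) x = x"
proof
  fix g assume x: "x \<in> X"
  show "rewrite (label x) x g = x g"
  proof (cases "\<exists>h\<in>markers x. \<exists>f\<in>F. g = h \<otimes> f")
    case True
    then show ?thesis using rewrite_in [OF consistent_label [OF x]] enc_label_apply by metis
  next
    case False
    then show ?thesis by (intro rewrite_out) blast
  qed
qed

lemma label_tr: "g \<in> carrier G \<Longrightarrow> h \<in> carrier G \<Longrightarrow> label (tr g x) h = label x (g \<otimes> h)"
  by (simp add: label_def tr_tr)

lemma rewrite_tr:
  assumes g: "g \<in> carrier G" and r: "consistent (markers x) r" "consistent (markers (tr g x)) r'"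
    and rr': "\<And>h. h \<in> markers (tr g x) \<Longrightarrow> r' h = r (g \<otimes> h)"
    and k: "k \<in> carrier G"
  shows "rewrite r' (tr g x) k = rewrite r x (g \<otimes> k)"
proof (cases "\<exists>h\<in>markers (tr g x). \<exists>f\<in>F. k = h \<otimes> f")
  case True
  then obtain h f where h: "h \<in> markers (tr g x)" "f \<in> F" "k = h \<otimes> f" by blast
  then have "g \<otimes> h \<in> markers x" using markers_tr [OF g markers_in [OF h(1)]] by simp
  from rewrite_in [OF r(1) this h(2)] show ?thesis
    using rewrite_in [OF r(2) h(1,2)] rr' [OF h(1)] h g by (simp add: m_assoc)
next
  case False
  have "rewrite r' (tr g x) k = tr g x k" using False by (intro rewrite_out) blast
  moreover have "rewrite r x (g \<otimes> k) = x (g \<otimes> k)"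
  proof (rule rewrite_out, rule notI)
    fix h f assume h: "h \<in> markers x" "f \<in> F" "g \<otimes> k = h \<otimes> f"
    then have hG: "h \<in> carrier G" by simp
    have "inv g \<otimes> h \<in> markers (tr g x)" using h(1) hG g by (simp add: markers_tr m_assoc [symmetric])
    moreover have "k = inv g \<otimes> (g \<otimes> k)" using g k by (simp add: m_assoc [symmetric])
    then have "k = (inv g \<otimes> h) \<otimes> f" using h(2,3) hG g by (simp add: m_assoc)
    ultimately show False using False h(2) by blast
  qed
  ultimately show ?thesis using k by (simp add: tr_apply)
qed

section \<open>Locality and existence of markers\<close>

definition marker_window :: "'g set"
  where "marker_window = S \<union> F \<union> (EE <#> S)"

lemma finite_marker_window: "finite marker_window"
  using finite_S finite_F by (simp add: marker_window_def)

lemma marker_window_carrier: "marker_window \<subseteq> carrier G"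
  unfolding marker_window_def
  using S_carrier F_carrier set_mult_closed [OF EE_carrier S_carrier] by blast

lemma marked_cong:
  assumes "\<And>w. w \<in> marker_window \<Longrightarrow> y w = y' w" shows "marked y \<longleftrightarrow> marked y'"
proof -
  have "agrees y \<longleftrightarrow> agrees y'" using assms by (simp add: agrees_def marker_window_def)
  moreover have "restrict y F = restrict y' F" using assms by (auto simp: marker_window_def)
  moreover have "override_on y (enc l) F (e \<otimes> s) = override_on y' (enc l) F (e \<otimes> s)"
    if "e \<in> EE" "s \<in> S" for l e s
    using assms [of "e \<otimes> s"] set_multI [OF that] by (simp add: override_on_def marker_window_def)
  ultimately show ?thesis unfolding marked_def by auto
qed

lemma markers_cong:
  assumes "h \<in> carrier G" "\<And>w. w \<in> marker_window \<Longrightarrow> x' (h \<otimes> w) = x (h \<otimes> w)"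
  shows "h \<in> markers x' \<longleftrightarrow> h \<in> markers x" "label x' h = label x h"
proof -
  have "marked (tr h x') \<longleftrightarrow> marked (tr h x)"
    using assms marker_window_carrier by (intro marked_cong) (auto simp: tr_apply)
  then show "h \<in> markers x' \<longleftrightarrow> h \<in> markers x" using assms(1) marker_marked markersI by blast
  have "restrict (tr h x') F = restrict (tr h x) F"
    using assms by (auto simp: tr_apply marker_window_def)
  then show "label x' h = label x h" by (simp add: label_def)
qed

lemma markers_exist:
  assumes "L \<noteq> {}"
  obtains D where "finite D" "act_kernel \<subseteq> D"
    "\<And>W. \<lbrakk>finite W; W \<subseteq> carrier G; \<And>w w'. w \<in> W \<Longrightarrow> w' \<in> W \<Longrightarrow> inv w \<otimes> w' \<in> D \<Longrightarrow> w = w'\<rbrakk>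
      \<Longrightarrow> \<exists>x\<in>X. W \<subseteq> markers x"
proof -
  let ?Wd = marker_window
  obtain l0 where l0: "l0 \<in> L" using assms by blast
  \<comment> \<open>Filled with an encoded label, \<open>p\<close> is marked at the identity because
    of \<open>isolated\<close>. Its window is then copied to every element of \<open>W\<close> by
    gluing.\<close>
  define x0 where "x0 = override_on p (enc l0) F"
  have x0: "x0 \<in> X" unfolding x0_def using l0 p_in_X by (intro override_enc) auto
  have "marked x0"
    unfolding marked_def
  proof (intro conjI ballI)
    show "agrees x0" using S_F_disjoint by (auto simp: agrees_def x0_def override_on_def)
    obtain z where "enc l0 = restrict z F" using enc_filling l0 by blast
    then have "restrict x0 F = enc l0" by (auto simp: x0_def override_on_def)
    then show "restrict x0 F \<in> enc ` L" using l0 by simp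
    fix l e assume l: "l \<in> L" and e: "e \<in> EE - act_kernel"
    obtain z where z: "z \<in> X" "enc l = restrict z F" using enc_filling l by blast
    have "override_on x0 (enc l) F = override_on p z F" by (auto simp: x0_def override_on_def z)
    then show "\<exists>s\<in>S. override_on x0 (enc l) F (e \<otimes> s) \<noteq> p s" using isolated [OF z(1)] e by simp
  qed
  \<comment> \<open>The second part lets the windows at distinct elements of \<open>W\<close> be
    glued. The first keeps distinct elements of \<open>W\<close> in distinct cosets of
    \<open>act_kernel\<close>, so that their labels can be chosen independently.\<close>
  define D where "D = act_kernel \<union> ((?Wd <#> K) <#> m_inv G ` ?Wd)"
  show ?thesis
  proof (rule that)
    show "finite D" using finite_marker_window finite_K finite_act_kernel by (simp add: D_def)
    show "act_kernel \<subseteq> D" by (simp add: D_def)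
    fix W assume W: "finite W" "W \<subseteq> carrier G"
      and sep: "\<And>w w'. w \<in> W \<Longrightarrow> w' \<in> W \<Longrightarrow> inv w \<otimes> w' \<in> D \<Longrightarrow> w = w'"
    have "\<exists>z\<in>X. \<forall>w\<in>W. \<forall>t\<in>(\<lambda>v. w \<otimes> v) ` ?Wd. z t = tr (inv w) x0 t"
    proof (rule glue_family [OF W(1)])
      fix w assume "w \<in> W"
      then have w: "w \<in> carrier G" using W by auto
      show "finite ((\<lambda>v. w \<otimes> v) ` ?Wd)" using finite_marker_window by simp
      show "(\<lambda>v. w \<otimes> v) ` ?Wd \<subseteq> carrier G" using w marker_window_carrier by auto
      show "tr (inv w) x0 \<in> X" using x0 w by (intro X_translate) auto
    next
      fix w w' assume ww': "w \<in> W" "w' \<in> W" "w \<noteq> w'"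
      then have G: "w \<in> carrier G" "w' \<in> carrier G" using W by auto
      show "((\<lambda>v. w \<otimes> v) ` ?Wd <#> K) \<inter> (\<lambda>v. w' \<otimes> v) ` ?Wd = {}"
      proof (rule ccontr)
        assume "\<not> ?thesis"
        then obtain v k v' where v: "v \<in> ?Wd" "k \<in> K" "v' \<in> ?Wd" "w' \<otimes> v' = w \<otimes> v \<otimes> k"
          by (auto simp: set_mult_def)
        then have vG: "v \<in> carrier G" "k \<in> carrier G" "v' \<in> carrier G" using marker_window_carrier by auto
        have "w' = w \<otimes> v \<otimes> k \<otimes> inv v'" using v(4) G vG by (metis inv_solve_right m_closed)
        then have "inv w \<otimes> w' = v \<otimes> k \<otimes> inv v'"
          using G vG by (simp add: m_assoc) (simp add: m_assoc [symmetric])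
        moreover have "v \<otimes> k \<otimes> inv v' \<in> D" using v unfolding D_def by (intro UnI2 set_multI imageI)
        ultimately show False using sep ww' by simp
      qed
    qed
    then obtain z where z: "z \<in> X" "\<And>w v. w \<in> W \<Longrightarrow> v \<in> ?Wd \<Longrightarrow> z (w \<otimes> v) = tr (inv w) x0 (w \<otimes> v)"
      by blast
    have "w \<in> markers z" if w: "w \<in> W" for w
    proof -
      have wG: "w \<in> carrier G" using w W by auto
      have "tr w z v = x0 v" if v: "v \<in> ?Wd" for v
      proof -
        have "v \<in> carrier G" using v marker_window_carrier by auto
        then show ?thesis using z(2) [OF w v] wG by (simp add: tr_apply m_assoc [symmetric])
      qed
      then have "marked (tr w z)" using marked_cong \<open>marked x0\<close> by metis
      then show ?thesis by (rule markersI [OF wG])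
    qed
    then show "\<exists>x\<in>X. W \<subseteq> markers x" using z(1) by blast
  qed
qed

end

section \<open>Conveyor belts\<close>

text \<open>Continuity into a product of discrete spaces means that every coordinate is locally
  constant. The window \<open>W\<close> depends on the point \<open>x\<close> as well as on
  \<open>g\<close>.\<close>

lemma continuous_map_prodiscrete:
  assumes X: "X \<subseteq> full_shift G B" and Y: "Y \<subseteq> full_shift G B"
  shows "continuous_map (subtopology (prodiscrete G B) X) (subtopology (prodiscrete G B) Y) f \<longleftrightarrow>
    f \<in> X \<rightarrow> Y \<and> (\<forall>x\<in>X. \<forall>g\<in>carrier G. \<exists>W. finite W \<and> W \<subseteq> carrier G \<and>
      (\<forall>x'\<in>X. (\<forall>w\<in>W. x' w = x w) \<longrightarrow> f x' g = f x g))" (is "?L \<longleftrightarrow> ?R")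
proof
  let ?T = "subtopology (prodiscrete G B) X"
  have top: "topspace ?T = X" using X by auto
  {
    assume L: ?L
    then have maps: "f \<in> X \<rightarrow> Y" and comp: "\<And>g. g \<in> carrier G \<Longrightarrow> continuous_map ?T (discrete_topology B) (\<lambda>x. f x g)"
      using top by (auto simp: continuous_map_in_subtopology prodiscrete_def continuous_map_componentwise)
    have "\<exists>W. finite W \<and> W \<subseteq> carrier G \<and> (\<forall>x'\<in>X. (\<forall>w\<in>W. x' w = x w) \<longrightarrow> f x' g = f x g)"
      if x: "x \<in> X" and g: "g \<in> carrier G" for x g
    proof -
      have "f x g \<in> B" using maps x Y g by (auto simp: full_shift_def)
      then have "openin ?T {x' \<in> topspace ?T. f x' g \<in> {f x g}}"
        using comp [OF g] by (intro openin_continuous_map_preimage) auto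
      then obtain S where S: "openin (prodiscrete G B) S" "{x' \<in> X. f x' g = f x g} = S \<inter> X"
        using top by (auto simp: openin_subtopology)
      then have "x \<in> S" using x by auto
      then obtain U where U: "finite {i \<in> carrier G. U i \<noteq> B}" "x \<in> Pi\<^sub>E (carrier G) U" "Pi\<^sub>E (carrier G) U \<subseteq> S"
        using S(1) by (auto simp: prodiscrete_def openin_product_topology_alt)
      have "f x' g = f x g" if x': "x' \<in> X" "\<forall>w\<in>{i \<in> carrier G. U i \<noteq> B}. x' w = x w" for x'
      proof -
        have "x' i \<in> U i" if i: "i \<in> carrier G" for i
        proof (cases "U i = B")
          case True
          then show ?thesis using x' X i by (auto simp: full_shift_def)
        next
          case False
          then show ?thesis using x'(2) U(2) i by auto
        qed
        then have "x' \<in> Pi\<^sub>E (carrier G) U" using x' X by (auto simp: full_shift_def PiE_iff)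
        then show ?thesis using U(3) S(2) x' by blast
      qed
      then show ?thesis using U(1) by (intro exI [of _ "{i \<in> carrier G. U i \<noteq> B}"]) auto
    qed
    then show ?R using maps by blast
  }
  assume R: ?R
  then have maps: "f \<in> X \<rightarrow> Y" by blast
  have "continuous_map ?T (discrete_topology B) (\<lambda>x. f x g)" if g: "g \<in> carrier G" for g
    unfolding continuous_map_def
  proof (intro conjI allI impI)
    show "(\<lambda>x. f x g) \<in> topspace ?T \<rightarrow> topspace (discrete_topology B)"
      using maps Y g top by (force simp: full_shift_def)
    fix U assume "openin (discrete_topology B) U"
    show "openin ?T {x \<in> topspace ?T. f x g \<in> U}"
    proof (subst openin_subopen, rule ballI)
      fix x assume x: "x \<in> {x \<in> topspace ?T. f x g \<in> U}"
      then have xX: "x \<in> X" by auto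
      obtain W where W: "finite W" "W \<subseteq> carrier G" "\<And>x'. x' \<in> X \<Longrightarrow> \<forall>w\<in>W. x' w = x w \<Longrightarrow> f x' g = f x g"
        using R xX g by meson
      define N where "N = Pi\<^sub>E (carrier G) (\<lambda>i. if i \<in> W then {x i} else B)"
      have xB: "x i \<in> B" if "i \<in> carrier G" for i using xX X that by (auto simp: full_shift_def)
      have "openin (prodiscrete G B) N"
        unfolding prodiscrete_def N_def openin_PiE_gen
        using W(1) xB W(2) by (auto intro: finite_subset [of _ W])
      then have "openin ?T (N \<inter> X)" by (auto simp: openin_subtopology)
      moreover have "x \<in> N \<inter> X"
        using xX X by (auto simp: N_def full_shift_def PiE_iff)
      moreover have "N \<inter> X \<subseteq> {x \<in> topspace ?T. f x g \<in> U}"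
      proof
        fix x' assume x': "x' \<in> N \<inter> X"
        have "x' w = x w" if "w \<in> W" for w
        proof -
          have "w \<in> carrier G" using that W(2) by blast
          then show ?thesis using x' that PiE_mem [of x' "carrier G" _ w] by (force simp: N_def)
        qed
        then have "f x' g = f x g" using W(3) x' by blast
        then show "x' \<in> {x \<in> topspace ?T. f x g \<in> U}" using x x' top by auto
      qed
      ultimately show "\<exists>N. openin ?T N \<and> x \<in> N \<and> N \<subseteq> {x \<in> topspace ?T. f x g \<in> U}" by blast
    qed
  qed
  moreover have "f ` X \<subseteq> extensional (carrier G)"
    using maps Y by (force simp: full_shift_def PiE_def)
  ultimately show ?L
    using maps top by (auto simp: continuous_map_in_subtopology prodiscrete_def continuous_map_componentwise)
qed

section \<open>The free group acting on cells\<close>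

text \<open>A label is a pair of symbols, one per track. \<open>\<theta>\<close> places
  \<open>H\<close> inside the free group and \<open>\<phi>\<close> lays the belts out in
  \<open>G\<close>; injectivity of \<open>\<theta>\<close> and avoidance by \<open>\<phi>\<close>
  are hypotheses of the faithfulness lemmas only, since a homomorphism of automorphism groups arises
  in any case.\<close>

locale conveyor = marker G B X K \<alpha> \<beta> S F p "A \<times> A" enc
  for G (structure) and B :: "'b set" and X :: "('g \<Rightarrow> 'b) set" and K \<alpha> \<beta> S F p
    and A :: "'a set" and enc +
  fixes H :: "('h, 'n) monoid_scheme" and k :: nat and \<theta> :: "'h \<Rightarrow> letter list" and \<phi> :: "letter list \<Rightarrow> 'g"
  assumes group_H: "group H"
    and \<theta>_hom: "\<theta> \<in> hom H (free_group k)" and \<phi>_hom: "\<phi> \<in> hom (free_group k) G"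
begin

sublocale H: group H by (rule group_H)
sublocale Fk: group "free_group k" by (rule group_free_group)
sublocale \<theta>: group_hom H "free_group k" \<theta> by unfold_locales (rule \<theta>_hom)
sublocale \<phi>: group_hom "free_group k" G \<phi> by unfold_locales (rule \<phi>_hom)

text \<open>With the default value a letter outside the alphabet fixes every cell, so the inverse
  laws hold for all letters without side conditions.\<close>

definition val :: "letter \<Rightarrow> 'g"
  where "val a = (if fst a < k then \<phi> [a] else \<one>)"

lemma letter_in_free_group: "fst a < k \<Longrightarrow> [a] \<in> carrier (free_group k)"
  by (cases a) (auto simp: free_group_def reduced_word_def)

lemma val_in [simp]: "val a \<in> carrier G"
  by (simp add: val_def letter_in_free_group)

lemma val_inv_letter: "val (inv_letter a) \<otimes> val a = \<one>" "val a \<otimes> val (inv_letter a) = \<one>"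
proof -
  have *: "val (inv_letter a) \<otimes> val a = \<one>" for a
  proof (cases "fst a < k")
    case True
    then have "fst (inv_letter a) < k" by (simp add: inv_letter_def)
    then have "\<phi> [inv_letter a] \<otimes> \<phi> [a] = \<phi> ([inv_letter a] \<otimes>\<^bsub>free_group k\<^esub> [a])"
      using True letter_in_free_group by simp
    also have "[inv_letter a] \<otimes>\<^bsub>free_group k\<^esub> [a] = \<one>\<^bsub>free_group k\<^esub>" by (simp add: free_group_def)
    finally show ?thesis using True by (simp add: val_def inv_letter_def)
  qed (simp add: val_def inv_letter_def)
  show "val (inv_letter a) \<otimes> val a = \<one>" by (rule *)
  show "val a \<otimes> val (inv_letter a) = \<one>" using * [of "inv_letter a"] by simp
qed

text \<open>Each marker carries two cells, one on each of two tracks running in opposite directions; at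
  the end of a chain of markers one switches tracks, so that every letter permutes the cells.\<close>

definition step :: "'g set \<Rightarrow> letter \<Rightarrow> 'g \<times> bool \<Rightarrow> 'g \<times> bool"
  where "step M a = (\<lambda>(h, b). if h \<in> M
    then let h' = h \<otimes> val (if b then a else inv_letter a) in if h' \<in> M then (h', b) else (h, \<not> b)
    else (h, b))"

text \<open>At a blocked end the track is flipped, and on the flipped track the inverse letter means
  the same displacement as before; the move is blocked again and flips back.\<close>

lemma step_inv_letter:
  assumes "M \<subseteq> carrier G" shows "step M (inv_letter a) (step M a c) = c"
  using assms by (cases c) (auto simp: step_def Let_def m_assoc val_inv_letter subset_iff)

lemma step_in: "c \<in> M \<times> UNIV \<Longrightarrow> step M a c \<in> M \<times> UNIV"
  by (auto simp: step_def Let_def)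

definition walk :: "'g set \<Rightarrow> 'g \<times> bool \<Rightarrow> letter list \<Rightarrow> 'g \<times> bool"
  where "walk M = foldl (\<lambda>c a. step M a c)"

lemma walk_simps [simp]: "walk M c [] = c" "walk M c (a # w) = walk M (step M a c) w"
  by (simp_all add: walk_def)

lemma walk_in: "c \<in> M \<times> UNIV \<Longrightarrow> walk M c w \<in> M \<times> UNIV"
  by (induction w arbitrary: c) (use step_in in auto)

lemma walk_push: "M \<subseteq> carrier G \<Longrightarrow> walk M c (push a w) = walk M (step M a c) w"
  by (cases w) (auto simp: step_inv_letter)

text \<open>Cancelling a letter against its inverse leaves a walk unchanged, so walking is a right
  action of the free group on the cells.\<close>

lemma walk_foldr_push: "M \<subseteq> carrier G \<Longrightarrow> walk M c (foldr push u v) = walk M (walk M c u) v"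
  by (induction u arbitrary: c) (auto simp: walk_push)

lemma walk_\<theta>_mult:
  assumes "M \<subseteq> carrier G" "v \<in> carrier H" "w \<in> carrier H"
  shows "walk M c (\<theta> (v \<otimes>\<^bsub>H\<^esub> w)) = walk M (walk M c (\<theta> v)) (\<theta> w)"
  using walk_foldr_push [OF assms(1)] \<theta>.hom_mult [OF assms(2,3)] by (simp add: free_group_def)

lemma walk_\<theta>_one: "walk M c (\<theta> \<one>\<^bsub>H\<^esub>) = c"
  using \<theta>.hom_one by (simp add: free_group_def)

section \<open>Transport by an automorphism of the full shift\<close>

definition cell :: "('g \<Rightarrow> 'b) \<Rightarrow> 'g \<times> bool \<Rightarrow> 'a"
  where "cell x = (\<lambda>(h, b). (if b then fst else snd) (label x h))"

definition reading :: "('g \<Rightarrow> 'b) \<Rightarrow> 'g \<times> bool \<Rightarrow> 'h \<Rightarrow> 'a"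
  where "reading x c = (\<lambda>w \<in> carrier H. cell x (walk (markers x) c (\<theta> w)))"

definition new_label :: "(('h \<Rightarrow> 'a) \<Rightarrow> 'h \<Rightarrow> 'a) \<Rightarrow> ('g \<Rightarrow> 'b) \<Rightarrow> 'g \<Rightarrow> 'a \<times> 'a"
  where "new_label f x h = (f (reading x (h, True)) \<one>\<^bsub>H\<^esub>, f (reading x (h, False)) \<one>\<^bsub>H\<^esub>)"

definition transport :: "(('h \<Rightarrow> 'a) \<Rightarrow> 'h \<Rightarrow> 'a) \<Rightarrow> ('g \<Rightarrow> 'b) \<Rightarrow> 'g \<Rightarrow> 'b"
  where "transport f x = rewrite (new_label f x) x"

abbreviation cells where "cells x \<equiv> markers x \<times> (UNIV :: bool set)"

lemma markers_carrier: "markers x \<subseteq> carrier G" by auto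

lemma cell_in: "c \<in> cells x \<Longrightarrow> cell x c \<in> A"
  using label_in [of "fst c" x] by (auto simp: cell_def split: prod.splits)

lemma reading_in:
  assumes "c \<in> cells x" shows "reading x c \<in> full_shift H A"
  using cell_in [OF walk_in [OF assms]] by (simp add: reading_def full_shift_def)

text \<open>Moving the starting cell along its orbit shifts the configuration read from it. Through
  the equivariance of \<open>f\<close>, the symbols computed separately at the cells of an orbit
  therefore fit together into one configuration.\<close>

lemma reading_walk:
  assumes "w \<in> carrier H"
  shows "reading x (walk (markers x) c (\<theta> w)) = shift H (inv\<^bsub>H\<^esub> w) (reading x c)"
proof (rule ext)
  fix u
  show "reading x (walk (markers x) c (\<theta> w)) u = shift H (inv\<^bsub>H\<^esub> w) (reading x c) u"
    using assms walk_\<theta>_mult [OF markers_carrier assms, of u]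
    by (cases "u \<in> carrier H") (simp_all add: reading_def shift_def del: \<theta>.hom_mult)
qed

abbreviation full where "full \<equiv> full_shift H A"

abbreviation autos where "autos \<equiv> shift_automorphisms H A full"

lemma topspace_full: "topspace (subtopology (prodiscrete H A) full) = full"
  by simp

lemma auto_homeo:
  "f \<in> autos \<Longrightarrow> homeomorphic_map (subtopology (prodiscrete H A) full) (subtopology (prodiscrete H A) full) f"
  by (simp add: shift_automorphisms_def)

lemma auto_in: "f \<in> autos \<Longrightarrow> y \<in> full \<Longrightarrow> f y \<in> full"
  using homeomorphic_imp_surjective_map [OF auto_homeo [of f]] topspace_full by auto

lemma auto_Bij: "f \<in> autos \<Longrightarrow> f \<in> Bij full"
  using auto_homeo [of f] topspace_full
  by (auto simp: Bij_def shift_automorphisms_def bij_betw_def homeomorphic_eq_everything_map)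

lemma auto_shift: "f \<in> autos \<Longrightarrow> w \<in> carrier H \<Longrightarrow> y \<in> full \<Longrightarrow> f (shift H w y) = shift H w (f y)"
  by (simp add: shift_automorphisms_def)

lemma auto_local:
  assumes "f \<in> autos" "y \<in> full" "w \<in> carrier H"
  obtains V where "finite V" "V \<subseteq> carrier H"
    "\<And>y'. y' \<in> full \<Longrightarrow> (\<And>v. v \<in> V \<Longrightarrow> y' v = y v) \<Longrightarrow> f y' w = f y w"
proof -
  have "continuous_map (subtopology (prodiscrete H A) full) (subtopology (prodiscrete H A) full) f"
    using auto_homeo [OF assms(1)] by (rule homeomorphic_imp_continuous_map)
  then show ?thesis using that assms(2,3) unfolding continuous_map_prodiscrete [OF order_refl order_refl] by meson
qed

lemma full_eqI: "y \<in> full \<Longrightarrow> y' \<in> full \<Longrightarrow> (\<And>w. w \<in> carrier H \<Longrightarrow> y w = y' w) \<Longrightarrow> y = y'"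
  unfolding full_shift_def by (rule PiE_ext)

lemma auto_reading_walk:
  assumes f: "f \<in> autos" and c: "c \<in> cells x" and w: "w \<in> carrier H"
  shows "f (reading x (walk (markers x) c (\<theta> w))) \<one>\<^bsub>H\<^esub> = f (reading x c) w"
proof -
  have "f (reading x (walk (markers x) c (\<theta> w))) = shift H (inv\<^bsub>H\<^esub> w) (f (reading x c))"
    using auto_shift [OF f _ reading_in [OF c]] w by (simp add: reading_walk)
  then show ?thesis using w by (simp add: shift_def)
qed

text \<open>Letters displace markers by right multiplication while the shift multiplies from the
  left, so the two commute.\<close>

lemma step_tr:
  assumes "g \<in> carrier G" "h \<in> carrier G"
  shows "step (markers x) a (g \<otimes> h, b) = map_prod (\<lambda>v. g \<otimes> v) id (step (markers (tr g x)) a (h, b))"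
  using assms by (auto simp: step_def Let_def markers_tr m_assoc)

lemma fst_step_in: "fst c \<in> carrier G \<Longrightarrow> fst (step M a c) \<in> carrier G"
  by (auto simp: step_def Let_def split: prod.splits)

lemma walk_tr:
  assumes "g \<in> carrier G" "fst c \<in> carrier G"
  shows "walk (markers x) (map_prod (\<lambda>v. g \<otimes> v) id c) w = map_prod (\<lambda>v. g \<otimes> v) id (walk (markers (tr g x)) c w)"
  using assms(2)
proof (induction w arbitrary: c)
  case (Cons a w)
  have "step (markers x) a (map_prod (\<lambda>v. g \<otimes> v) id c) = map_prod (\<lambda>v. g \<otimes> v) id (step (markers (tr g x)) a c)"
    using step_tr [OF assms(1) Cons.prems, of x a "snd c"] by (cases c) simp
  then show ?case unfolding walk_simps by (simp only: Cons.IH [OF fst_step_in [OF Cons.prems]])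
qed simp

lemma fst_walk_in: "fst c \<in> carrier G \<Longrightarrow> fst (walk M c w) \<in> carrier G"
  by (induction w arbitrary: c) (auto simp: fst_step_in)

lemma reading_tr:
  assumes "g \<in> carrier G" "h \<in> carrier G"
  shows "reading (tr g x) (h, b) = reading x (g \<otimes> h, b)"
proof (rule ext)
  fix w
  obtain h' b' where h': "walk (markers (tr g x)) (h, b) (\<theta> w) = (h', b')" by (cases "walk (markers (tr g x)) (h, b) (\<theta> w)")
  then have "h' \<in> carrier G" using fst_walk_in [of "(h, b)"] assms(2) by (metis fst_conv)
  then show "reading (tr g x) (h, b) w = reading x (g \<otimes> h, b) w"
    using walk_tr [OF assms(1), of "(h, b)" x "\<theta> w"] assms h' by (simp add: reading_def cell_def label_tr)
qed

lemma new_label_tr: "g \<in> carrier G \<Longrightarrow> h \<in> carrier G \<Longrightarrow> new_label f (tr g x) h = new_label f x (g \<otimes> h)"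
  by (simp add: new_label_def reading_tr)

text \<open>By equivariance the new label at \<open>h\<close> depends only on \<open>tr h x\<close>,
  and \<open>tr (h \<otimes> n) x\<close> is the same point for \<open>n\<close> in the
  kernel.\<close>

lemma consistent_new_label:
  assumes x: "x \<in> X" and f: "f \<in> autos"
  shows "consistent (markers x) (new_label f x)"
  unfolding consistent_def
proof (intro ballI conjI impI)
  fix h assume h: "h \<in> markers x"
  have "f (reading x (h, b)) \<one>\<^bsub>H\<^esub> \<in> A" for b
    using auto_in [OF f reading_in, of "(h, b)" x] h by (auto simp: full_shift_def)
  then show "new_label f x h \<in> A \<times> A" by (simp add: new_label_def)
  fix n assume n: "n \<in> act_kernel"
  have hG: "h \<in> carrier G" using h by simp
  have "new_label f x (h \<otimes> n) = new_label f (tr (h \<otimes> n) x) \<one>"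
    using hG n new_label_tr [of "h \<otimes> n" \<one> f x] by simp
  also have "tr (h \<otimes> n) x = tr h x" by (rule tr_mult_act_kernel [OF hG n x])
  also have "new_label f (tr h x) \<one> = new_label f x h" using hG new_label_tr [of h \<one> f x] by simp
  finally show "new_label f x (h \<otimes> n) = new_label f x h" .
qed

lemma transport_in: "x \<in> X \<Longrightarrow> f \<in> autos \<Longrightarrow> transport f x \<in> X"
  by (simp add: transport_def rewrite_in_X consistent_new_label)

lemma markers_transport: "x \<in> X \<Longrightarrow> f \<in> autos \<Longrightarrow> markers (transport f x) = markers x"
  by (simp add: transport_def markers_rewrite consistent_new_label)

lemma label_transport: "x \<in> X \<Longrightarrow> f \<in> autos \<Longrightarrow> h \<in> markers x \<Longrightarrow> label (transport f x) h = new_label f x h"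
  by (simp add: transport_def label_rewrite consistent_new_label)

lemma cell_transport:
  assumes "x \<in> X" "f \<in> autos" "c \<in> cells x"
  shows "cell (transport f x) c = f (reading x c) \<one>\<^bsub>H\<^esub>"
  using assms label_transport [OF assms(1,2), of "fst c"]
  by (auto simp: cell_def new_label_def split: prod.splits)

text \<open>The markers, and with them all walks, survive the transport; so the configuration along
  an orbit is replaced by its image under \<open>f\<close>. This is what turns composition of
  automorphisms into composition of transports.\<close>

lemma reading_transport:
  assumes x: "x \<in> X" and f: "f \<in> autos" and c: "c \<in> cells x"
  shows "reading (transport f x) c = f (reading x c)"
proof (rule full_eqI)
  show "reading (transport f x) c \<in> full" using reading_in c markers_transport [OF x f] by metis
  show "f (reading x c) \<in> full" using auto_in [OF f reading_in [OF c]] .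
  fix w assume w: "w \<in> carrier H"
  show "reading (transport f x) c w = f (reading x c) w"
    using cell_transport [OF x f walk_in [OF c]] auto_reading_walk [OF f c w] w
    by (simp add: reading_def [of "transport f x"] markers_transport [OF x f])
qed

text \<open>The second rewriting overwrites the labels written by the first, so only the labels
  computed last have to be compared.\<close>

lemma transport_compose:
  assumes x: "x \<in> X" and f: "f \<in> autos" and g: "g \<in> autos" and fg: "fg \<in> autos"
    and eq: "\<And>y. y \<in> full \<Longrightarrow> fg y = f (g y)"
  shows "transport f (transport g x) = transport fg x"
proof -
  have c: "consistent (markers x) (new_label f (transport g x))"
    using consistent_new_label [OF transport_in [OF x g] f] markers_transport [OF x g] by simp
  have "transport f (transport g x) = rewrite (new_label f (transport g x)) x"
    unfolding transport_def [of f] transport_def [of g x, symmetric]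
    using rewrite_rewrite [OF x consistent_new_label [OF x g] c] by (simp add: transport_def)
  also have "\<dots> = rewrite (new_label fg x) x"
  proof (rule rewrite_cong [OF c consistent_new_label [OF x fg]])
    fix h assume "h \<in> markers x"
    then have "(h, b) \<in> cells x" for b by simp
    then show "new_label f (transport g x) h = new_label fg x h"
      by (simp add: new_label_def reading_transport [OF x g] eq reading_in)
  qed
  finally show ?thesis by (simp add: transport_def)
qed

lemma transport_id:
  assumes x: "x \<in> X" and f: "f \<in> autos" and eq: "\<And>y. y \<in> full \<Longrightarrow> f y = y"
  shows "transport f x = x"
proof -
  have "transport f x = rewrite (label x) x"
    unfolding transport_def
  proof (rule rewrite_cong [OF consistent_new_label [OF x f] consistent_label [OF x]])
    fix h assume "h \<in> markers x"
    then have "(h, b) \<in> cells x" for b by simp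
    then show "new_label f x h = label x h"
      by (simp add: new_label_def eq reading_in) (simp add: reading_def walk_\<theta>_one cell_def del: \<theta>.hom_one)
  qed
  then show ?thesis using rewrite_label [OF x] by simp
qed

lemma transport_tr:
  assumes x: "x \<in> X" and f: "f \<in> autos" and g: "g \<in> carrier G"
  shows "transport f (tr g x) = tr g (transport f x)"
proof (rule ext)
  fix k
  show "transport f (tr g x) k = tr g (transport f x) k"
  proof (cases "k \<in> carrier G")
    case True
    have "transport f (tr g x) k = transport f x (g \<otimes> k)"
      unfolding transport_def
      by (rule rewrite_tr [OF g consistent_new_label [OF x f] consistent_new_label [OF X_translate [OF g x] f] _ True])
        (simp add: new_label_tr g)
    then show ?thesis using True by (simp add: tr_apply)
  next
    case False
    then show ?thesis
      using extensional_arb [OF X_extensional [OF transport_in [OF X_translate [OF g x] f]]]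
      by (simp add: translate_def)
  qed
qed

section \<open>Continuity of the transport\<close>

text \<open>This says that \<open>P\<close> holds on a cylinder neighbourhood of \<open>x\<close> in
  \<open>X\<close>. In this form neighbourhoods can be intersected without naming their
  windows.\<close>

definition locally :: "('g \<Rightarrow> 'b) \<Rightarrow> (('g \<Rightarrow> 'b) \<Rightarrow> bool) \<Rightarrow> bool"
  where "locally x P \<longleftrightarrow> (\<exists>W. finite W \<and> W \<subseteq> carrier G \<and> (\<forall>x'\<in>X. (\<forall>w\<in>W. x' w = x w) \<longrightarrow> P x'))"

lemma locallyI: "finite W \<Longrightarrow> W \<subseteq> carrier G \<Longrightarrow> (\<And>x'. x' \<in> X \<Longrightarrow> \<forall>w\<in>W. x' w = x w \<Longrightarrow> P x') \<Longrightarrow> locally x P"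
  unfolding locally_def by blast

lemma locally_mono: "locally x P \<Longrightarrow> (\<And>x'. x' \<in> X \<Longrightarrow> P x' \<Longrightarrow> Q x') \<Longrightarrow> locally x Q"
  unfolding locally_def by blast

lemma locally_conj:
  assumes "locally x P" "locally x Q" shows "locally x (\<lambda>x'. P x' \<and> Q x')"
proof -
  obtain V W where "finite V" "V \<subseteq> carrier G" "\<forall>x'\<in>X. (\<forall>w\<in>V. x' w = x w) \<longrightarrow> P x'"
    "finite W" "W \<subseteq> carrier G" "\<forall>x'\<in>X. (\<forall>w\<in>W. x' w = x w) \<longrightarrow> Q x'"
    using assms unfolding locally_def by blast
  then show ?thesis by (intro locallyI [of "V \<union> W"]) auto
qed

lemma locally_ball:
  assumes "finite V" "\<And>v. v \<in> V \<Longrightarrow> locally x (P v)" shows "locally x (\<lambda>x'. \<forall>v\<in>V. P v x')"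
  using assms
proof (induction V)
  case empty
  then show ?case by (intro locallyI [of "{}"]) auto
next
  case (insert v V)
  have "locally x (\<lambda>x'. P v x' \<and> (\<forall>v\<in>V. P v x'))"
    by (rule locally_conj) (use insert in auto)
  then show ?case by simp
qed

lemma locally_markers:
  assumes "h \<in> carrier G"
  shows "locally x (\<lambda>x'. (h \<in> markers x' \<longleftrightarrow> h \<in> markers x) \<and> label x' h = label x h)"
proof (rule locallyI)
  show "finite ((\<lambda>w. h \<otimes> w) ` marker_window)" using finite_marker_window by simp
  show "(\<lambda>w. h \<otimes> w) ` marker_window \<subseteq> carrier G" using assms marker_window_carrier by auto
  fix x' assume "\<forall>w\<in>(\<lambda>w. h \<otimes> w) ` marker_window. x' w = x w"
  then show "(h \<in> markers x' \<longleftrightarrow> h \<in> markers x) \<and> label x' h = label x h"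
    using markers_cong [OF assms, of x' x] by blast
qed

lemma locally_walk: "fst c \<in> carrier G \<Longrightarrow> locally x (\<lambda>x'. walk (markers x') c w = walk (markers x) c w)"
proof (induction w arbitrary: c)
  case Nil
  then show ?case by (intro locallyI [of "{}"]) auto
next
  case (Cons a w)
  obtain h b where c: "c = (h, b)" by (cases c)
  let ?h' = "h \<otimes> val (if b then a else inv_letter a)"
  have G: "h \<in> carrier G" "?h' \<in> carrier G" using Cons.prems by (auto simp: c)
  have "locally x (\<lambda>x'. ((h \<in> markers x' \<longleftrightarrow> h \<in> markers x) \<and> label x' h = label x h) \<and>
      ((?h' \<in> markers x' \<longleftrightarrow> ?h' \<in> markers x) \<and> label x' ?h' = label x ?h') \<and>
      walk (markers x') (step (markers x) a c) w = walk (markers x) (step (markers x) a c) w)"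
    using G by (intro locally_conj locally_markers Cons.IH fst_step_in Cons.prems)
  then show ?case
  proof (rule locally_mono)
    fix x'
    assume *: "((h \<in> markers x' \<longleftrightarrow> h \<in> markers x) \<and> label x' h = label x h) \<and>
      ((?h' \<in> markers x' \<longleftrightarrow> ?h' \<in> markers x) \<and> label x' ?h' = label x ?h') \<and>
      walk (markers x') (step (markers x) a c) w = walk (markers x) (step (markers x) a c) w"
    then have "step (markers x') a c = step (markers x) a c" by (simp add: step_def Let_def c)
    then show "walk (markers x') c (a # w) = walk (markers x) c (a # w)" using * by simp
  qed
qed

lemma locally_reading:
  assumes "fst c \<in> carrier G" "w \<in> carrier H"
  shows "locally x (\<lambda>x'. reading x' c w = reading x c w)"
proof -
  obtain h b where h: "walk (markers x) c (\<theta> w) = (h, b)" by (cases "walk (markers x) c (\<theta> w)")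
  then have "h \<in> carrier G" using fst_walk_in [OF assms(1)] by (metis fst_conv)
  then have "locally x (\<lambda>x'. walk (markers x') c (\<theta> w) = walk (markers x) c (\<theta> w) \<and>
      ((h \<in> markers x' \<longleftrightarrow> h \<in> markers x) \<and> label x' h = label x h))"
    by (intro locally_conj locally_walk locally_markers assms)
  then show ?thesis
    by (rule locally_mono) (use assms(2) h in \<open>auto simp: reading_def cell_def\<close>)
qed

lemma locally_new_label:
  assumes h: "h \<in> markers x" and f: "f \<in> autos"
  shows "locally x (\<lambda>x'. new_label f x' h = new_label f x h)"
proof -
  have hG: "h \<in> carrier G" using h by simp
  have *: "locally x (\<lambda>x'. f (reading x' (h, b)) \<one>\<^bsub>H\<^esub> = f (reading x (h, b)) \<one>\<^bsub>H\<^esub>)" for b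
  proof -
    have c: "(h, b) \<in> cells x" using h by simp
    obtain V where V: "finite V" "V \<subseteq> carrier H"
      "\<And>y'. y' \<in> full \<Longrightarrow> (\<And>v. v \<in> V \<Longrightarrow> y' v = reading x (h, b) v) \<Longrightarrow> f y' \<one>\<^bsub>H\<^esub> = f (reading x (h, b)) \<one>\<^bsub>H\<^esub>"
      using auto_local [OF f reading_in [OF c] H.one_closed] by blast
    \<comment> \<open>The clause on markers keeps the reading of \<open>x'\<close> inside the full
      shift, where \<open>f\<close> is known to depend on \<open>V\<close> only.\<close>
    have "locally x (\<lambda>x'. ((h \<in> markers x' \<longleftrightarrow> h \<in> markers x) \<and> label x' h = label x h) \<and>
        (\<forall>v\<in>V. reading x' (h, b) v = reading x (h, b) v))"
      using V(1,2) hG by (intro locally_conj locally_markers locally_ball locally_reading) auto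
    then show ?thesis
    proof (rule locally_mono)
      fix x' assume x': "((h \<in> markers x' \<longleftrightarrow> h \<in> markers x) \<and> label x' h = label x h) \<and>
        (\<forall>v\<in>V. reading x' (h, b) v = reading x (h, b) v)"
      then have "(h, b) \<in> cells x'" using h by simp
      from V(3) [OF reading_in [OF this]] x'
      show "f (reading x' (h, b)) \<one>\<^bsub>H\<^esub> = f (reading x (h, b)) \<one>\<^bsub>H\<^esub>" by blast
    qed
  qed
  show ?thesis
    using locally_conj [OF * [of True] * [of False]] by (rule locally_mono) (simp add: new_label_def)
qed

lemma locally_transport:
  assumes x: "x \<in> X" and f: "f \<in> autos" and g: "g \<in> carrier G"
  shows "locally x (\<lambda>x'. transport f x' g = transport f x g)"
proof (cases "\<exists>h\<in>markers x. \<exists>v\<in>F. g = h \<otimes> v")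
  case True
  then obtain h v where h: "h \<in> markers x" "v \<in> F" "g = h \<otimes> v" by blast
  have "locally x (\<lambda>x'. ((h \<in> markers x' \<longleftrightarrow> h \<in> markers x) \<and> label x' h = label x h) \<and>
      new_label f x' h = new_label f x h)"
    using h by (intro locally_conj locally_markers locally_new_label f) auto
  then show ?thesis
  proof (rule locally_mono)
    fix x' assume x': "x' \<in> X" and *: "((h \<in> markers x' \<longleftrightarrow> h \<in> markers x) \<and> label x' h = label x h) \<and>
      new_label f x' h = new_label f x h"
    then have h': "h \<in> markers x'" using h by simp
    show "transport f x' g = transport f x g"
      using rewrite_in [OF consistent_new_label [OF x f] h(1,2)] rewrite_in [OF consistent_new_label [OF x' f] h' h(2)] *
      by (simp add: transport_def h(3))
  qed
next
  case False
  have "locally x (\<lambda>x'. x' g = x g)" using g by (intro locallyI [of "{g}"]) auto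
  \<comment> \<open>Only the finitely many elements \<open>g \<otimes> inv v\<close> could have a
    label covering \<open>g\<close>; none of them becomes a marker near \<open>x\<close>.\<close>
  moreover have "locally x (\<lambda>x'. \<forall>h\<in>(\<lambda>v. g \<otimes> inv v) ` F. (h \<in> markers x' \<longleftrightarrow> h \<in> markers x) \<and> label x' h = label x h)"
    using finite_F g by (intro locally_ball locally_markers) auto
  ultimately have "locally x (\<lambda>x'. x' g = x g \<and> (\<forall>h\<in>(\<lambda>v. g \<otimes> inv v) ` F. (h \<in> markers x' \<longleftrightarrow> h \<in> markers x) \<and> label x' h = label x h))"
    by (rule locally_conj)
  then show ?thesis
  proof (rule locally_mono)
    fix x' assume *: "x' g = x g \<and> (\<forall>h\<in>(\<lambda>v. g \<otimes> inv v) ` F. (h \<in> markers x' \<longleftrightarrow> h \<in> markers x) \<and> label x' h = label x h)"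
    have "g \<noteq> h \<otimes> v" if "h \<in> markers x'" "v \<in> F" for h v
    proof
      assume eq: "g = h \<otimes> v"
      then have "h = g \<otimes> inv v" using that by (auto simp: m_assoc)
      then have "h \<in> markers x" using * that by blast
      then show False using False that eq by blast
    qed
    then have "transport f x' g = x' g" unfolding transport_def by (intro rewrite_out) blast
    moreover have "transport f x g = x g" unfolding transport_def using False by (intro rewrite_out) blast
    ultimately show "transport f x' g = transport f x g" using * by simp
  qed
qed

section \<open>The induced homomorphism\<close>

definition induced :: "(('h \<Rightarrow> 'a) \<Rightarrow> 'h \<Rightarrow> 'a) \<Rightarrow> ('g \<Rightarrow> 'b) \<Rightarrow> 'g \<Rightarrow> 'b"
  where "induced f = restrict (transport f) X"

lemma X_full: "X \<subseteq> full_shift G B"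
  using X_PiE by (simp add: full_shift_def)

lemma continuous_induced:
  assumes f: "f \<in> autos"
  shows "continuous_map (subtopology (prodiscrete G B) X) (subtopology (prodiscrete G B) X) (induced f)"
  unfolding continuous_map_prodiscrete [OF X_full X_full]
  using transport_in [OF _ f] locally_transport [OF _ f] unfolding locally_def by (simp add: induced_def)

lemma auto_inverse:
  assumes f: "f \<in> autos" and A: "finite A"
  obtains g where "g \<in> autos" "\<And>y. y \<in> full \<Longrightarrow> g (f y) = y" "\<And>y. y \<in> full \<Longrightarrow> f (g y) = y"
proof -
  let ?U = "Aut_shift H A full"
  interpret U: group ?U using group_Aut_shift [OF subshift_full_shift [OF group_H A]] .
  have carr: "carrier ?U = autos" by (simp add: Aut_shift_def)
  have mult: "a \<otimes>\<^bsub>?U\<^esub> b = compose full a b" if "a \<in> autos" "b \<in> autos" for a b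
    using that auto_Bij by (simp add: Aut_shift_def BijGroup_def)
  have one: "\<one>\<^bsub>?U\<^esub> = (\<lambda>x\<in>full. x)" by (simp add: Aut_shift_def BijGroup_def)
  let ?g = "inv\<^bsub>?U\<^esub> f"
  have g: "?g \<in> autos" using U.inv_closed f carr by simp
  have "compose full ?g f = (\<lambda>x\<in>full. x)" using U.l_inv f carr mult [OF g f] one by simp
  moreover have "compose full f ?g = (\<lambda>x\<in>full. x)" using U.r_inv f carr mult [OF f g] one by simp
  ultimately have "?g (f y) = y" "f (?g y) = y" if "y \<in> full" for y
    using that by (metis compose_eq restrict_apply')+
  then show ?thesis using that g by blast
qed

lemma id_auto: "(\<lambda>y\<in>full. y) \<in> autos" if "finite A"
proof -
  interpret U: group "Aut_shift H A full" using group_Aut_shift [OF subshift_full_shift [OF group_H that]] .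
  show ?thesis using U.one_closed by (simp add: Aut_shift_def BijGroup_def)
qed

lemma induced_auto:
  assumes f: "f \<in> autos" and A: "finite A"
  shows "induced f \<in> shift_automorphisms G B X"
proof -
  obtain f' where f': "f' \<in> autos" "\<And>y. y \<in> full \<Longrightarrow> f' (f y) = y" "\<And>y. y \<in> full \<Longrightarrow> f (f' y) = y"
    using auto_inverse [OF f A] by metis
  have "transport f' (transport f x) = x" "transport f (transport f' x) = x" if x: "x \<in> X" for x
    using transport_compose [OF x f'(1) f id_auto [OF A]] transport_compose [OF x f f'(1) id_auto [OF A]]
      transport_id [OF x id_auto [OF A]] f' by simp_all
  then have "homeomorphic_maps (subtopology (prodiscrete G B) X) (subtopology (prodiscrete G B) X) (induced f) (induced f')"
    using continuous_induced f f'(1) transport_in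
    by (auto simp: homeomorphic_maps_def induced_def)
  then have "homeomorphic_map (subtopology (prodiscrete G B) X) (subtopology (prodiscrete G B) X) (induced f)"
    using homeomorphic_map_maps by blast
  moreover have "induced f (shift G g x) = shift G g (induced f x)" if g: "g \<in> carrier G" and x: "x \<in> X" for g x
  proof -
    have "shift G g y = tr (inv g) y" for y :: "'g \<Rightarrow> 'b" by (simp add: shift_def translate_def)
    then show ?thesis
      using transport_tr [OF x f, of "inv g"] X_translate [of "inv g" x] g x by (simp add: induced_def)
  qed
  ultimately show ?thesis by (simp add: shift_automorphisms_def induced_def)
qed

lemma induced_hom:
  assumes A: "finite A"
  shows "induced \<in> hom (Aut_shift H A full) (Aut_shift G B X)"
proof (rule homI)
  show "induced f \<in> carrier (Aut_shift G B X)" if "f \<in> carrier (Aut_shift H A full)" for f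
    using induced_auto [OF _ A] that by (simp add: Aut_shift_def)
  fix f g assume "f \<in> carrier (Aut_shift H A full)" "g \<in> carrier (Aut_shift H A full)"
  then have f: "f \<in> autos" and g: "g \<in> autos" by (simp_all add: Aut_shift_def)
  interpret U: group "Aut_shift H A full" using group_Aut_shift [OF subshift_full_shift [OF group_H A]] .
  have m: "f \<otimes>\<^bsub>Aut_shift H A full\<^esub> g = compose full f g"
    using f g auto_Bij by (simp add: Aut_shift_def BijGroup_def)
  then have fg: "compose full f g \<in> autos"
    using U.m_closed [of f g] f g by (simp add: Aut_shift_def)
  have Bij: "induced h \<in> Bij X" if "h \<in> autos" for h
  proof -
    have "homeomorphic_map (subtopology (prodiscrete G B) X) (subtopology (prodiscrete G B) X) (induced h)"
      using induced_auto [OF that A] by (simp add: shift_automorphisms_def)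
    moreover have "topspace (subtopology (prodiscrete G B) X) = X" using X_full by auto
    ultimately show ?thesis
      by (auto simp: Bij_def induced_def bij_betw_def homeomorphic_eq_everything_map)
  qed
  have "induced (compose full f g) = compose X (induced f) (induced g)"
    using transport_compose [OF _ f g fg] transport_in [OF _ g]
    by (auto simp: induced_def compose_def fun_eq_iff)
  then show "induced (f \<otimes>\<^bsub>Aut_shift H A full\<^esub> g) = induced f \<otimes>\<^bsub>Aut_shift G B X\<^esub> induced g"
    using Bij [OF f] Bij [OF g] m by (simp add: Aut_shift_def BijGroup_def)
qed

section \<open>Storing configurations and faithfulness\<close>

lemma take_free_group: "w \<in> carrier (free_group k) \<Longrightarrow> take n w \<in> carrier (free_group k)"
  by (auto simp: free_group_def reduced_word_def successively_conv_nth dest: in_set_takeD)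

text \<open>No move is blocked, since every prefix leads to a marker; so the walk never changes
  tracks.\<close>

lemma walk_True:
  assumes "w \<in> carrier (free_group k)" "h \<in> carrier G" "\<And>n. h \<otimes> \<phi> (take n w) \<in> M"
  shows "walk M (h, True) w = (h \<otimes> \<phi> w, True)"
  using assms
proof (induction w arbitrary: h)
  case Nil
  then show ?case using \<phi>.hom_one by (simp add: free_group_def)
next
  case (Cons a w)
  have a: "fst a < k" and w: "w \<in> carrier (free_group k)"
    using Cons.prems(1) by (auto simp: free_group_def dest: reduced_ConsD)
  have split: "\<phi> (a # v) = val a \<otimes> \<phi> v" if "a # v \<in> carrier (free_group k)" "v \<in> carrier (free_group k)" for v
  proof -
    have "a # v = [a] \<otimes>\<^bsub>free_group k\<^esub> v"
      using that(1) by (simp add: free_group_def push_reduced_Cons)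
    then show ?thesis using \<phi>.hom_mult [OF letter_in_free_group [OF a] that(2)] a by (simp add: val_def)
  qed
  have split_take: "\<phi> (take (Suc n) (a # w)) = val a \<otimes> \<phi> (take n w)" for n
    using split [of "take n w"] take_free_group [OF Cons.prems(1), of "Suc n"] take_free_group [OF w] by simp
  have one: "\<phi> [] = \<one>" using \<phi>.hom_one by (simp add: free_group_def)
  have "h \<in> M" using Cons.prems(3) [of 0] one Cons.prems(2) by simp
  moreover have hv: "h \<otimes> val a \<otimes> \<phi> (take n w) \<in> M" for n
    using Cons.prems(3) [of "Suc n"] Cons.prems(2) take_free_group [OF w] unfolding split_take
    by (simp add: m_assoc)
  then have "h \<otimes> val a \<in> M" using hv [of 0] one Cons.prems(2) by simp
  ultimately have "step M a (h, True) = (h \<otimes> val a, True)" by (simp add: step_def Let_def)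
  then have "walk M (h, True) (a # w) = (h \<otimes> val a \<otimes> \<phi> w, True)"
    using Cons.IH [OF w _ hv] Cons.prems(2) by simp
  then show ?case using split [OF Cons.prems(1) w] Cons.prems(2) w by (simp add: m_assoc)
qed

text \<open>Avoidance of \<open>D\<close> makes the images under \<open>\<phi>\<close> of distinct
  words far enough apart for markers to exist at all of them, and injectivity of
  \<open>\<theta>\<close> keeps the values of \<open>y\<close> at distinct elements of
  \<open>V\<close> from competing for one cell.\<close>

lemma reading_exists:
  assumes D: "act_kernel \<subseteq> D" "\<And>w. w \<in> carrier (free_group k) \<Longrightarrow> \<phi> w \<in> D \<Longrightarrow> w = []"
    and exist: "\<And>W. \<lbrakk>finite W; W \<subseteq> carrier G; \<And>w w'. w \<in> W \<Longrightarrow> w' \<in> W \<Longrightarrow> inv w \<otimes> w' \<in> D \<Longrightarrow> w = w'\<rbrakk>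
      \<Longrightarrow> \<exists>x\<in>X. W \<subseteq> markers x"
    and inj: "inj_on \<theta> (carrier H)" and V: "finite V" "V \<subseteq> carrier H" and y: "y \<in> full"
  shows "\<exists>x\<in>X. \<one> \<in> markers x \<and> (\<forall>v\<in>V. reading x (\<one>, True) v = y v)"
proof -
  have sep: "u = u'"
    if u: "u \<in> carrier (free_group k)" "u' \<in> carrier (free_group k)" "inv \<phi> u \<otimes> \<phi> u' \<in> D" for u u'
  proof -
    have "\<phi> (inv\<^bsub>free_group k\<^esub> u \<otimes>\<^bsub>free_group k\<^esub> u') \<in> D" using u by simp
    then have "inv\<^bsub>free_group k\<^esub> u \<otimes>\<^bsub>free_group k\<^esub> u' = []"
      using u by (intro D(2)) auto
    also have "[] = \<one>\<^bsub>free_group k\<^esub>" by (simp add: free_group_def)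
    finally have "inv\<^bsub>free_group k\<^esub> u \<otimes>\<^bsub>free_group k\<^esub> u' = \<one>\<^bsub>free_group k\<^esub>" .
    then show ?thesis using u by (metis Fk.inv_closed Fk.inv_equality Fk.inv_inv)
  qed
  have \<theta>V: "\<theta> v \<in> carrier (free_group k)" if "v \<in> V" for v using V that by auto
  \<comment> \<open>Every prefix has to lead to a marker, otherwise the walk along
    \<open>\<theta> v\<close> would turn round before reaching its goal. The empty word places a
    marker at the identity even if \<open>V\<close> is empty.\<close>
  define P where "P = {[]} \<union> (\<Union>v\<in>V. (\<lambda>n. take n (\<theta> v)) ` {..length (\<theta> v)})"
  have nil: "[] \<in> carrier (free_group k)" by (simp add: free_group_def)
  have P: "finite P" "P \<subseteq> carrier (free_group k)"
    using V(1) \<theta>V take_free_group nil by (auto simp: P_def)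
  have take_P: "take n (\<theta> v) \<in> P" if "v \<in> V" for v n
  proof (cases "n \<le> length (\<theta> v)")
    case True
    then show ?thesis using that by (auto simp: P_def)
  next
    case False
    then have "take n (\<theta> v) = take (length (\<theta> v)) (\<theta> v)" by simp
    then show ?thesis using that unfolding P_def by blast
  qed
  have "\<exists>x\<in>X. \<phi> ` P \<subseteq> markers x"
  proof (rule exist)
    show "finite (\<phi> ` P)" "\<phi> ` P \<subseteq> carrier G" using P by auto
    show "w = w'" if "w \<in> \<phi> ` P" "w' \<in> \<phi> ` P" "inv w \<otimes> w' \<in> D" for w w'
      using that sep P(2) by (metis (no_types, lifting) imageE subsetD)
  qed
  then obtain x where x: "x \<in> X" "\<phi> ` P \<subseteq> markers x" by blast
  have \<phi>P: "\<phi> u \<in> markers x" if "u \<in> P" for u using x(2) that by blast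
  \<comment> \<open>The symbol is written on the whole coset of \<open>act_kernel\<close>, as
    consistency demands; \<open>uniq\<close> shows that no coset receives two symbols.\<close>
  define r where "r h = (if \<exists>v\<in>V. \<exists>n\<in>act_kernel. h = \<phi> (\<theta> v) \<otimes> n
    then let v = SOME v. v \<in> V \<and> (\<exists>n\<in>act_kernel. h = \<phi> (\<theta> v) \<otimes> n) in (y v, y v) else label x h)" for h
  have uniq: "v = v'" if v: "v \<in> V" "v' \<in> V" and n: "n \<in> act_kernel" "n' \<in> act_kernel"
    and eq: "\<phi> (\<theta> v) \<otimes> n = \<phi> (\<theta> v') \<otimes> n'" for v v' n n'
  proof -
    have G: "\<phi> (\<theta> v) \<in> carrier G" "\<phi> (\<theta> v') \<in> carrier G" using \<theta>V v by auto
    have "\<phi> (\<theta> v') = (\<phi> (\<theta> v) \<otimes> n) \<otimes> inv n'" using eq G n by (simp add: m_assoc)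
    then have "inv \<phi> (\<theta> v) \<otimes> \<phi> (\<theta> v') = n \<otimes> inv n'"
      using G n by (simp add: m_assoc) (simp add: m_assoc [symmetric])
    then have "inv \<phi> (\<theta> v) \<otimes> \<phi> (\<theta> v') \<in> D" using D(1) n act_kernel_mult act_kernel_inv by auto
    then have "\<theta> v = \<theta> v'" using sep \<theta>V v by blast
    then show ?thesis using inj v V(2) by (auto dest: inj_onD)
  qed
  have r_eq: "r (\<phi> (\<theta> v) \<otimes> n) = (y v, y v)" if v: "v \<in> V" "n \<in> act_kernel" for v n
  proof -
    let ?Q = "\<lambda>v'. v' \<in> V \<and> (\<exists>n'\<in>act_kernel. \<phi> (\<theta> v) \<otimes> n = \<phi> (\<theta> v') \<otimes> n')"
    have "?Q v" using v by blast
    then have "(SOME v'. ?Q v') = v"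
      by (rule some_equality) (use uniq [OF v(1) _ v(2)] in blast)
    moreover have "\<exists>v'\<in>V. \<exists>n'\<in>act_kernel. \<phi> (\<theta> v) \<otimes> n = \<phi> (\<theta> v') \<otimes> n'" using v by blast
    ultimately show ?thesis unfolding r_def by simp
  qed
  have yA: "y v \<in> A" if "v \<in> V" for v using y that V(2) by (auto simp: full_shift_def)
  have c: "consistent (markers x) r"
    unfolding consistent_def
  proof (intro ballI conjI impI)
    fix h assume h: "h \<in> markers x"
    then have hG: "h \<in> carrier G" by simp
    show "r h \<in> A \<times> A"
    proof (cases "\<exists>v\<in>V. \<exists>n\<in>act_kernel. h = \<phi> (\<theta> v) \<otimes> n")
      case True
      then obtain v n where "v \<in> V" "n \<in> act_kernel" "h = \<phi> (\<theta> v) \<otimes> n" by blast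
      then show ?thesis using r_eq yA by simp
    next
      case False
      then have "r h = label x h" unfolding r_def by simp
      then show ?thesis using label_in [OF h] by simp
    qed
    fix m assume m: "m \<in> act_kernel"
    show "r (h \<otimes> m) = r h"
    proof (cases "\<exists>v\<in>V. \<exists>n\<in>act_kernel. h = \<phi> (\<theta> v) \<otimes> n")
      case True
      then obtain v n where v: "v \<in> V" "n \<in> act_kernel" "h = \<phi> (\<theta> v) \<otimes> n" by blast
      then have "h \<otimes> m = \<phi> (\<theta> v) \<otimes> (n \<otimes> m)" using \<theta>V m by (simp add: m_assoc)
      then show ?thesis using r_eq v act_kernel_mult [OF v(2) m] by simp
    next
      case False
      have "\<not> (\<exists>v\<in>V. \<exists>n\<in>act_kernel. h \<otimes> m = \<phi> (\<theta> v) \<otimes> n)"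
      proof
        assume "\<exists>v\<in>V. \<exists>n\<in>act_kernel. h \<otimes> m = \<phi> (\<theta> v) \<otimes> n"
        then obtain v n where v: "v \<in> V" "n \<in> act_kernel" "h \<otimes> m = \<phi> (\<theta> v) \<otimes> n" by blast
        have "h = (h \<otimes> m) \<otimes> inv m" using hG m by (simp add: m_assoc)
        then have "h = \<phi> (\<theta> v) \<otimes> (n \<otimes> inv m)" using v \<theta>V m by (simp add: m_assoc)
        then show False using False v(1) act_kernel_mult [OF v(2) act_kernel_inv [OF m]] by blast
      qed
      then have "r (h \<otimes> m) = label x (h \<otimes> m)" unfolding r_def by simp
      moreover have "r h = label x h" using False unfolding r_def by simp
      ultimately show ?thesis using label_kernel [OF x(1) hG m] by simp
    qed
  qed
  define x' where "x' = rewrite r x"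
  have x': "x' \<in> X" "markers x' = markers x"
    using rewrite_in_X [OF x(1) c] markers_rewrite [OF x(1) c] by (simp_all add: x'_def)
  have one: "\<phi> [] = \<one>" using \<phi>.hom_one by (simp add: free_group_def)
  have "\<one> \<in> markers x'" using \<phi>P [of "[]"] one x' by (simp add: P_def)
  moreover have "reading x' (\<one>, True) v = y v" if v: "v \<in> V" for v
  proof -
    have "walk (markers x) (\<one>, True) (\<theta> v) = (\<one> \<otimes> \<phi> (\<theta> v), True)"
      using \<phi>P take_P [OF v] take_free_group [OF \<theta>V [OF v]] by (intro walk_True \<theta>V v) auto
    then have "walk (markers x') (\<one>, True) (\<theta> v) = (\<phi> (\<theta> v), True)" using x' \<theta>V v by simp
    moreover have "\<phi> (\<theta> v) \<in> markers x" using \<phi>P take_P [OF v, of "length (\<theta> v)"] by simp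
    then have "label x' (\<phi> (\<theta> v)) = r (\<phi> (\<theta> v))" unfolding x'_def by (rule label_rewrite [OF c])
    moreover have "r (\<phi> (\<theta> v)) = (y v, y v)"
      using r_eq [OF v act_kernel_one] \<theta>V [OF v] by simp
    ultimately show ?thesis using v V(2) by (auto simp: reading_def cell_def)
  qed
  ultimately show ?thesis using x'(1) by blast
qed

text \<open>By continuity the values of \<open>f y\<close> and \<open>g y\<close> at the identity
  depend on finitely many symbols of \<open>y\<close>. These can be stored in a point of
  \<open>X\<close>, where the new label at the identity reveals both values; equivariance yields the
  other coordinates.\<close>

lemma induced_inj:
  assumes D: "act_kernel \<subseteq> D" "\<And>w. w \<in> carrier (free_group k) \<Longrightarrow> \<phi> w \<in> D \<Longrightarrow> w = []"
    and exist: "\<And>W. \<lbrakk>finite W; W \<subseteq> carrier G; \<And>w w'. w \<in> W \<Longrightarrow> w' \<in> W \<Longrightarrow> inv w \<otimes> w' \<in> D \<Longrightarrow> w = w'\<rbrakk>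
      \<Longrightarrow> \<exists>x\<in>X. W \<subseteq> markers x"
    and inj: "inj_on \<theta> (carrier H)"
  shows "inj_on induced autos"
proof (rule inj_onI)
  fix f g assume f: "f \<in> autos" and g: "g \<in> autos" and eq: "induced f = induced g"
  have *: "f y \<one>\<^bsub>H\<^esub> = g y \<one>\<^bsub>H\<^esub>" if y: "y \<in> full" for y
  proof -
    obtain V where V: "finite V" "V \<subseteq> carrier H"
      "\<And>y'. y' \<in> full \<Longrightarrow> (\<And>v. v \<in> V \<Longrightarrow> y' v = y v) \<Longrightarrow> f y' \<one>\<^bsub>H\<^esub> = f y \<one>\<^bsub>H\<^esub>"
      by (fact auto_local [OF f y H.one_closed])
    obtain V' where V': "finite V'" "V' \<subseteq> carrier H"
      "\<And>y'. y' \<in> full \<Longrightarrow> (\<And>v. v \<in> V' \<Longrightarrow> y' v = y v) \<Longrightarrow> g y' \<one>\<^bsub>H\<^esub> = g y \<one>\<^bsub>H\<^esub>"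
      by (fact auto_local [OF g y H.one_closed])
    obtain x where x: "x \<in> X" "\<one> \<in> markers x" "\<forall>v\<in>V \<union> V'. reading x (\<one>, True) v = y v"
      using reading_exists [OF D exist inj _ _ y, of "V \<union> V'"] V(1,2) V'(1,2) by blast
    let ?y = "reading x (\<one>, True)"
    have y': "?y \<in> full" using x(2) by (intro reading_in) simp
    have "transport f x = transport g x" using fun_cong [OF eq, of x] x(1) by (simp add: induced_def)
    then have "new_label f x \<one> = new_label g x \<one>"
      using label_transport [OF x(1) f x(2)] label_transport [OF x(1) g x(2)] by simp
    then have "f ?y \<one>\<^bsub>H\<^esub> = g ?y \<one>\<^bsub>H\<^esub>" by (simp add: new_label_def)
    moreover have "f ?y \<one>\<^bsub>H\<^esub> = f y \<one>\<^bsub>H\<^esub>" using x(3) by (intro V(3) y') blast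
    moreover have "g ?y \<one>\<^bsub>H\<^esub> = g y \<one>\<^bsub>H\<^esub>" using x(3) by (intro V'(3) y') blast
    ultimately show ?thesis by simp
  qed
  have "f y = g y" if y: "y \<in> full" for y
  proof (rule full_eqI [OF auto_in [OF f y] auto_in [OF g y]])
    fix w assume w: "w \<in> carrier H"
    let ?y = "shift H (inv\<^bsub>H\<^esub> w) y"
    have "?y \<in> full" using shift_in_full_shift [OF group_H _ y] w by simp
    then have "f ?y \<one>\<^bsub>H\<^esub> = g ?y \<one>\<^bsub>H\<^esub>" by (rule *)
    then show "f y w = g y w"
      using auto_shift [OF f _ y, of "inv\<^bsub>H\<^esub> w"] auto_shift [OF g _ y, of "inv\<^bsub>H\<^esub> w"] w
      by (simp add: shift_def)
  qed
  then show "f = g"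
    using f g by (intro extensionalityI [of f full g]) (auto simp: shift_automorphisms_def)
qed

lemma embeds_of_separated:
  assumes A: "finite A" and D: "act_kernel \<subseteq> D" "\<And>w. w \<in> carrier (free_group k) \<Longrightarrow> \<phi> w \<in> D \<Longrightarrow> w = []"
    and exist: "\<And>W. \<lbrakk>finite W; W \<subseteq> carrier G; \<And>w w'. w \<in> W \<Longrightarrow> w' \<in> W \<Longrightarrow> inv w \<otimes> w' \<in> D \<Longrightarrow> w = w'\<rbrakk>
      \<Longrightarrow> \<exists>x\<in>X. W \<subseteq> markers x"
    and inj: "inj_on \<theta> (carrier H)"
  shows "embeds (Aut_shift H A full) (Aut_shift G B X)"
proof -
  have "inj_on induced autos" using D exist inj by (rule induced_inj)
  then have "induced \<in> mon (Aut_shift H A full) (Aut_shift G B X)"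
    using induced_hom [OF A] by (simp add: mon_def Aut_shift_def)
  then show ?thesis unfolding embeds_def by blast
qed

text \<open>Without symbols there are no labels and hence no markers, so
  \<open>markers_exist\<close> does not apply; but the full shift is then empty and has a single
  automorphism.\<close>

lemma embeds_of_empty:
  assumes "A = {}"
  shows "embeds (Aut_shift H A full) (Aut_shift G B X)"
proof -
  have "full = {}" using assms H.one_closed unfolding full_shift_def PiE_eq_empty_iff by blast
  then have "inj_on induced (carrier (Aut_shift H A full))"
    by (simp add: Aut_shift_def shift_automorphisms_def inj_on_def)
  then have "induced \<in> mon (Aut_shift H A full) (Aut_shift G B X)"
    using induced_hom assms by (simp add: mon_def)
  then show ?thesis unfolding embeds_def by blast
qed

end

section \<open>Homomorphisms of free groups avoiding finite sets\<close>

lemma foldr_push_replicate: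
  "u = [] \<or> hd u \<noteq> inv_letter x \<Longrightarrow> foldr push (replicate n x) u = replicate n x @ u"
proof (induction n)
  case (Suc n)
  then show ?case by (cases n; cases u) auto
qed simp

text \<open>When the inverses outnumber the copies of \<open>x\<close>, the excess meets
  \<open>r\<close>, and \<open>hd r \<noteq> x\<close> stops the cancellation there.\<close>

lemma foldr_push_replicate_inverse:
  assumes "r \<noteq> []" "hd r \<noteq> x"
  shows "foldr push (replicate m (inv_letter x)) (replicate n x @ r) =
    (if m \<le> n then replicate (n - m) x @ r else replicate (m - n) (inv_letter x) @ r)"
proof (induction m)
  case (Suc m)
  consider "m < n" | "m \<ge> n" by linarith
  then show ?case
  proof cases
    case 1
    then have "n - m = Suc (n - Suc m)" by simp
    then show ?thesis using Suc 1 by simp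
  next
    case 2
    obtain b r' where r: "r = b # r'" using assms(1) by (cases r) auto
    show ?thesis
    proof (cases "m = n")
      case True
      then show ?thesis using Suc r assms(2) by simp
    next
      case False
      then have "m - n = Suc (m - Suc n)" "Suc m - n = Suc (Suc (m - Suc n))" using 2 by simp_all
      then show ?thesis using Suc 2 False by simp
    qed
  qed
qed simp

text \<open>The \<open>i\<close>-th generator is sent to \<open>a^(i+1) b^N a^-(i+1)\<close>: cancellation in the image of a reduced
  word never reaches the first block \<open>b^N\<close>, so nontrivial images have length at least \<open>N\<close>.\<close>

lemma free_group_hom_avoiding:
  assumes "finite E"
  shows "\<exists>h\<in>hom (free_group k) (free_group 2). \<forall>w\<in>carrier (free_group k). h w \<in> E \<longrightarrow> w = []"
proof -
  interpret F2: group "free_group 2" by (rule group_free_group)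
  interpret Fk: group "free_group k" by (rule group_free_group)
  obtain N where N: "0 < N" "\<And>w. w \<in> E \<Longrightarrow> length w < N"
  proof
    show "0 < Suc (Max (insert 0 (length ` E)))" by simp
    fix w assume "w \<in> E"
    then have "length w \<le> Max (insert 0 (length ` E))" using assms by (intro Max_ge) auto
    then show "length w < Suc (Max (insert 0 (length ` E)))" by simp
  qed
  \<comment> \<open>This is already the reduced form of the image of the generator \<open>i\<close>,
    or of its inverse when \<open>c\<close> is false; the inverse changes only the sign of the
    middle block.\<close>
  define img where "img i c = replicate (Suc i) (0::nat, True) @ replicate N (1::nat, c) @ replicate (Suc i) (0, False)" for i c
  have foldr_img: "foldr push (img i c) r = foldr push (replicate (Suc i) (0, True))
      (foldr push (replicate N (1, c)) (foldr push (replicate (Suc i) (0, False)) r))" for i c r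
    by (simp add: img_def)
  have base: "foldr push (img i c) [] = img i c" for i c
  proof -
    have "foldr push (replicate (Suc i) (0, False)) [] = replicate (Suc i) (0::nat, False) @ []"
      by (rule foldr_push_replicate) simp
    moreover have "foldr push (replicate N (1, c)) (replicate (Suc i) (0, False)) = replicate N (1::nat, c) @ replicate (Suc i) (0, False)"
      by (rule foldr_push_replicate) (simp add: inv_letter_def)
    moreover have "foldr push (replicate (Suc i) (0, True)) (replicate N (1, c) @ replicate (Suc i) (0, False)) =
        replicate (Suc i) (0::nat, True) @ replicate N (1, c) @ replicate (Suc i) (0, False)"
      using N(1) by (intro foldr_push_replicate) (simp add: inv_letter_def hd_append)
    ultimately show ?thesis by (simp only: foldr_img append_Nil2) (simp only: img_def)
  qed
  have red: "reduced_word (img i c)" for i c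
    using reduced_foldr_push [of "[]" "img i c"] base by simp
  have set_img: "set (img i c) \<subseteq> {..<2} \<times> UNIV" for i c
    by (auto simp: img_def)
  have img_in: "img i c \<in> carrier (free_group 2)" for i c
    using red set_img by (simp add: free_group_def)
  obtain h where h: "h \<in> hom (free_group k) (free_group 2)" "\<And>i. i < k \<Longrightarrow> h [(i, True)] = img i True"
    using free_group_universal [OF group_free_group, of "\<lambda>i. img i True" k 2] img_in by blast
  interpret h: group_hom "free_group k" "free_group 2" h using h(1) by unfold_locales
  have letter: "[(i, c)] \<in> carrier (free_group k)" if "i < k" for i c
    using that by (simp add: free_group_def reduced_word_def)
  have h_letter: "h [(i, c)] = img i c" if i: "i < k" for i c
  proof (cases c)
    case False
    have "map inv_letter (rev (img i True)) = img i False"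
      by (simp add: img_def inv_letter_def replicate_append_same replicate_app_Cons_same)
    then have "img i False \<otimes>\<^bsub>free_group 2\<^esub> img i True = \<one>\<^bsub>free_group 2\<^esub>"
      using foldr_push_inverse [OF red [of i True]] by (simp add: free_group_def)
    then have 1: "inv\<^bsub>free_group 2\<^esub> (img i True) = img i False"
      by (rule F2.inv_equality [OF _ img_in img_in])
    have "[(i, False)] \<otimes>\<^bsub>free_group k\<^esub> [(i, True)] = \<one>\<^bsub>free_group k\<^esub>"
      by (simp add: free_group_def inv_letter_def)
    then have "inv\<^bsub>free_group k\<^esub> [(i, True)] = [(i, False)]"
      by (rule Fk.inv_equality [OF _ letter [OF i] letter [OF i]])
    then show ?thesis using h.hom_inv [OF letter [OF i, of True]] h(2) [OF i] 1 False by simp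
  qed (use h i in simp)
  have form: "\<exists>v. h ((i, c) # w) = replicate (Suc i) (0, True) @ replicate N (1, c) @ v"
    if "(i, c) # w \<in> carrier (free_group k)" for i c w
    using that
  proof (induction w arbitrary: i c)
    case Nil
    then have "i < k" by (simp add: free_group_def)
    then show ?case using h_letter [of i c] by (auto simp: img_def)
  next
    case (Cons a w)
    obtain j d where a: "a = (j, d)" by (cases a)
    have i: "i < k" and tl: "a # w \<in> carrier (free_group k)" and nc: "j = i \<Longrightarrow> d = c"
      using Cons.prems by (auto simp: free_group_def a reduced_word_def inv_letter_def)
    obtain v where v: "h (a # w) = replicate (Suc j) (0, True) @ replicate N (1, d) @ v"
      using Cons.IH [of j d] tl a by auto
    have "(i, c) # a # w = [(i, c)] \<otimes>\<^bsub>free_group k\<^esub> (a # w)"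
      using Cons.prems by (simp add: free_group_def reduced_word_def)
    then have "h ((i, c) # a # w) = foldr push (img i c) (h (a # w))"
      using h.hom_mult [OF letter [OF i, of c] tl] h_letter [OF i, of c] by (simp add: free_group_def)
    also have "\<dots> = foldr push (replicate (Suc i) (0, True)) (foldr push (replicate N (1, c))
        (foldr push (replicate (Suc i) (0, False)) (replicate (Suc j) (0, True) @ replicate N (1, d) @ v)))"
      unfolding foldr_img v ..
    also have "foldr push (replicate (Suc i) (0, False)) (replicate (Suc j) (0, True) @ replicate N (1, d) @ v) =
        (if Suc i \<le> Suc j then replicate (Suc j - Suc i) (0, True) @ replicate N (1, d) @ v
          else replicate (Suc i - Suc j) (0, False) @ replicate N (1, d) @ v)" (is "_ = ?u")
      using foldr_push_replicate_inverse [of "replicate N (1, d) @ v" "(0, True)" "Suc i" "Suc j"] N(1)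
      by (simp add: hd_append inv_letter_def del: replicate_Suc)
    also have "foldr push (replicate N (1, c)) ?u = replicate N (1, c) @ ?u"
    proof (rule foldr_push_replicate, rule disjI2)
      \<comment> \<open>For \<open>i = j\<close> the powers of the generator 0 cancel completely and
        two powers of the generator 1 meet; they have equal sign because the word is reduced.
        Otherwise a nontrivial power of the generator 0 remains between them.\<close>
      consider "i = j" | "i < j" | "j < i" by linarith
      then show "hd ?u \<noteq> inv_letter (1, c)"
        using nc N(1) by cases (auto simp: hd_append inv_letter_def)
    qed
    also have "foldr push (replicate (Suc i) (0, True)) (replicate N (1, c) @ ?u) =
        replicate (Suc i) (0, True) @ replicate N (1, c) @ ?u"
      using N(1) by (intro foldr_push_replicate) (simp add: hd_append inv_letter_def)
    finally show ?case by blast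
  qed
  have "w = []" if w: "w \<in> carrier (free_group k)" "h w \<in> E" for w
  proof (cases w)
    case (Cons a w')
    obtain i c where "a = (i, c)" by (cases a)
    then obtain v where "h w = replicate (Suc i) (0, True) @ replicate N (1, c) @ v"
      using form [of i c w'] w Cons by auto
    then have "N \<le> length (h w)" by simp
    then show ?thesis using N(2) [OF w(2)] by simp
  qed simp
  then show ?thesis using h(1) by blast
qed

section \<open>Rank one and elements of infinite order\<close>

lemma free_group_1_replicate:
  assumes "w \<in> carrier (free_group 1)"
  shows "\<exists>n c. w = replicate n (0, c)"
  using assms
proof (induction w)
  case (Cons a w)
  obtain c where a: "a = (0, c)" using Cons.prems by (cases a) (auto simp: free_group_def)
  have "w \<in> carrier (free_group 1)" using Cons.prems by (auto simp: free_group_def dest: reduced_ConsD)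
  then obtain n d where w: "w = replicate n (0, d)" using Cons.IH by blast
  show ?case
  proof (cases n)
    case 0
    then show ?thesis using a w by (intro exI [of _ 1] exI [of _ c]) simp
  next
    case (Suc m)
    then have "d = c" using Cons.prems a w by (auto simp: free_group_def reduced_word_def inv_letter_def)
    then show ?thesis using a w by (intro exI [of _ "Suc n"] exI [of _ c]) simp
  qed
qed simp

lemma free_group_pow:
  assumes "i < k"
  shows "[(i, c)] [^]\<^bsub>free_group k\<^esub> (n::nat) = replicate n (i, c)"
proof -
  interpret group "free_group k" by (rule group_free_group)
  have "[(i, c)] \<in> carrier (free_group k)" using assms by (simp add: free_group_def reduced_word_def)
  then show ?thesis
  proof (induction n)
    case (Suc n)
    have "[(i, c)] [^]\<^bsub>free_group k\<^esub> Suc n = [(i, c)] \<otimes>\<^bsub>free_group k\<^esub> ([(i, c)] [^]\<^bsub>free_group k\<^esub> n)"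
      by (rule nat_pow_Suc2 [OF Suc.prems])
    then show ?case using Suc by (cases n) (simp_all add: free_group_def inv_letter_def)
  qed (simp add: free_group_def)
qed

context group
begin

lemma infinite_order_inj:
  assumes g: "g \<in> carrier G" and inf: "\<And>n::nat. n > 0 \<Longrightarrow> g [^] n \<noteq> \<one>"
  shows "inj (\<lambda>n::nat. g [^] n)"
proof (rule linorder_injI)
  fix i j :: nat assume ij: "i < j"
  then have "g [^] j = g [^] i \<otimes> g [^] (j - i)" using g by (simp add: nat_pow_mult)
  moreover have "g [^] (j - i) \<noteq> \<one>" using ij by (intro inf) simp
  ultimately show "g [^] i \<noteq> g [^] j" using g by simp
qed

text \<open>The powers of \<open>g\<close> are distinct, so those lying in \<open>D\<close> or in
  its set of inverses have exponents below some \<open>N\<close>. Sending the generator to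
  \<open>g [^] Suc N\<close> makes all exponents multiples of \<open>Suc N\<close>, and the only
  such multiple below \<open>N\<close> is zero.\<close>

lemma free_group_1_hom_avoiding:
  assumes g: "g \<in> carrier G" and inf: "\<And>n::nat. n > 0 \<Longrightarrow> g [^] n \<noteq> \<one>" and D: "finite D"
  shows "\<exists>\<phi>\<in>hom (free_group 1) G. \<forall>w\<in>carrier (free_group 1). \<phi> w \<in> D \<longrightarrow> w = []"
proof -
  have "finite {n::nat. g [^] n \<in> D \<union> m_inv G ` D}"
    using finite_vimageI [OF _ infinite_order_inj [OF g inf], of "D \<union> m_inv G ` D"] D
    by (simp add: vimage_def)
  then obtain N where N: "\<And>n::nat. g [^] n \<in> D \<union> m_inv G ` D \<Longrightarrow> n < N"
    using finite_nat_set_iff_bounded by (metis (mono_tags, lifting) mem_Collect_eq)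
  let ?g = "g [^] Suc N"
  obtain \<phi> where \<phi>: "\<phi> \<in> hom (free_group 1) G" "\<phi> [(0, True)] = ?g"
    using free_group_universal [OF is_group, of "\<lambda>_. ?g" 1] g by auto
  interpret F: group "free_group 1" by (rule group_free_group)
  interpret \<phi>: group_hom "free_group 1" G \<phi> using \<phi>(1) by unfold_locales
  have letter: "[(0, c)] \<in> carrier (free_group 1)" for c by (simp add: free_group_def reduced_word_def)
  have "[(0, False)] \<otimes>\<^bsub>free_group 1\<^esub> [(0, True)] = \<one>\<^bsub>free_group 1\<^esub>"
    by (simp add: free_group_def inv_letter_def)
  then have inv: "inv\<^bsub>free_group 1\<^esub> [(0, True)] = [(0, False)]"
    by (rule F.inv_equality [OF _ letter letter])
  have "w = []" if w: "w \<in> carrier (free_group 1)" "\<phi> w \<in> D" for w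
  proof -
    obtain n c where nc: "w = replicate n (0, c)" using free_group_1_replicate [OF w(1)] by blast
    then have "w = [(0, c)] [^]\<^bsub>free_group 1\<^esub> n" by (simp add: free_group_pow)
    then have "\<phi> w = \<phi> [(0, c)] [^] n" using \<phi>.hom_nat_pow [OF letter] by simp
    moreover have "\<phi> [(0, c)] = (if c then ?g else inv ?g)"
      using \<phi>(2) \<phi>.hom_inv [OF letter [of True]] inv by simp
    moreover have "?g [^] n = g [^] (Suc N * n)" using g by (rule nat_pow_pow)
    ultimately have \<phi>w: "\<phi> w = (if c then g [^] (Suc N * n) else inv (g [^] (Suc N * n)))"
      using g by (simp add: nat_pow_inv del: nat_pow_Suc)
    have "g [^] (Suc N * n) \<in> D \<union> m_inv G ` D"
    proof (cases c)
      case False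
      then have "g [^] (Suc N * n) = inv (\<phi> w)" using \<phi>w g by simp
      then show ?thesis using w(2) by blast
    qed (use \<phi>w w in simp)
    then have "Suc N * n < N" by (rule N)
    then have "n = 0" by (cases n) auto
    then show ?thesis using nc by simp
  qed
  then show ?thesis using \<phi>(1) by blast
qed

end

lemma integer_group_mon_free_group: "\<exists>\<theta>. \<theta> \<in> mon integer_group (free_group 1)"
proof -
  interpret F: group "free_group 1" by (rule group_free_group)
  let ?a = "[(0::nat, True)]"
  have a: "?a \<in> carrier (free_group 1)" by (simp add: free_group_def reduced_word_def)
  have hom: "(\<lambda>n. ?a [^]\<^bsub>free_group 1\<^esub> n) \<in> hom integer_group (free_group 1)"
    by (rule homI) (simp_all add: integer_group_def F.int_pow_closed [OF a] F.int_pow_mult [OF a] del: One_nat_def)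
  have "inj (\<lambda>n::int. ?a [^]\<^bsub>free_group 1\<^esub> n)"
  proof (rule linorder_injI)
    fix i j :: int assume ij: "i < j"
    show "?a [^]\<^bsub>free_group 1\<^esub> i \<noteq> ?a [^]\<^bsub>free_group 1\<^esub> j"
    proof
      assume eq: "?a [^]\<^bsub>free_group 1\<^esub> i = ?a [^]\<^bsub>free_group 1\<^esub> j"
      have "?a [^]\<^bsub>free_group 1\<^esub> (j - i) = \<one>\<^bsub>free_group 1\<^esub>"
        by (simp add: F.int_pow_diff [OF a] eq F.int_pow_closed [OF a] F.r_inv del: One_nat_def)
      moreover obtain n where n: "j - i = int n" "n > 0"
      proof
        show "j - i = int (nat (j - i))" "nat (j - i) > 0" using ij by simp_all
      qed
      ultimately have "?a [^]\<^bsub>free_group 1\<^esub> n = \<one>\<^bsub>free_group 1\<^esub>" by (simp only: int_pow_int)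
      then have "replicate n (0::nat, True) = []"
        using free_group_pow [of 0 1 True n] by (simp add: free_group_def)
      then show False using n by simp
    qed
  qed
  then have "inj_on (\<lambda>n::int. ?a [^]\<^bsub>free_group 1\<^esub> n) (carrier integer_group)"
    by (rule inj_on_subset) simp
  then show ?thesis using hom by (auto simp: mon_def)
qed

section \<open>The embedding\<close>

lemma subshift_limit:
  assumes "subshift G B X" "x \<in> extensional (carrier G)"
    and approx: "\<And>W. finite W \<Longrightarrow> W \<subseteq> carrier G \<Longrightarrow> \<exists>y\<in>X. \<forall>w\<in>W. y w = x w"
  shows "x \<in> X"
proof (rule ccontr)
  assume "x \<notin> X"
  have X: "X \<subseteq> full_shift G B" using assms(1) by (rule subshift_subset)
  have "x w \<in> B" if "w \<in> carrier G" for w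
  proof -
    obtain y where "y \<in> X" "y w = x w" using approx [of "{w}"] \<open>w \<in> carrier G\<close> by auto
    moreover have "y w \<in> B" using \<open>y \<in> X\<close> X that by (auto simp: full_shift_def)
    ultimately show ?thesis by simp
  qed
  then have x: "x \<in> full_shift G B - X"
    using assms(2) \<open>x \<notin> X\<close> by (auto simp: full_shift_def PiE_def)
  have "openin (prodiscrete G B) (full_shift G B - X)"
    using assms(1) by (simp add: subshift_def closedin_def)
  then have "\<exists>U. finite {i \<in> carrier G. U i \<noteq> B} \<and> x \<in> Pi\<^sub>E (carrier G) U \<and>
      Pi\<^sub>E (carrier G) U \<subseteq> full_shift G B - X"
    using x unfolding prodiscrete_def openin_product_topology_alt topspace_discrete_topology by blast
  then obtain U where U: "finite {i \<in> carrier G. U i \<noteq> B}" "x \<in> Pi\<^sub>E (carrier G) U"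
      "Pi\<^sub>E (carrier G) U \<subseteq> full_shift G B - X" by blast
  obtain y where y: "y \<in> X" "\<forall>w\<in>{i \<in> carrier G. U i \<noteq> B}. y w = x w"
    using approx [OF U(1)] by auto
  have "y i \<in> U i" if i: "i \<in> carrier G" for i
  proof (cases "U i = B")
    case True
    then show ?thesis using y X i by (auto simp: full_shift_def)
  next
    case False
    then show ?thesis using y(2) U(2) i by auto
  qed
  then have "y \<in> Pi\<^sub>E (carrier G) U" using y X by (auto simp: full_shift_def PiE_iff)
  then show False using U(3) y by blast
qed

lemma si_subshift_exists:
  assumes "group G" "subshift G B X" "nontrivial X" "strongly_irreducible G X" "infinite (carrier G)"
  shows "\<exists>K \<alpha> \<beta>. si_subshift G B X K \<alpha> \<beta>"
proof -
  interpret group G by fact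
  obtain K where K: "finite K" "K \<subseteq> carrier G"
    and si: "\<forall>S T. finite S \<and> S \<subseteq> carrier G \<and> finite T \<and> T \<subseteq> carrier G \<and> (S <#>\<^bsub>G\<^esub> K) \<inter> T = {} \<longrightarrow>
      (\<forall>p \<in> patterns S X. \<forall>q \<in> patterns T X. \<exists>x \<in> X. restrict x S = p \<and> restrict x T = q)"
    using assms(4) unfolding strongly_irreducible_def by (elim exE conjE)
  have X: "X \<subseteq> full_shift G B" using assms(2) by (rule subshift_subset)
  have tr: "translate G h x \<in> X" if "h \<in> carrier G" "x \<in> X" for h x
  proof -
    have "translate G h x = shift G (inv\<^bsub>G\<^esub> h) x" using that by (simp add: translate_def shift_def)
    then show ?thesis using assms(2) that by (simp add: subshift_def)
  qed
  obtain x y where xy: "x \<in> X" "y \<in> X" "x \<noteq> y"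
    using assms(3) unfolding nontrivial_def by blast
  obtain g where g: "g \<in> carrier G" "x g \<noteq> y g"
  proof (rule ccontr)
    assume "\<not> thesis"
    then have "x g = y g" if "g \<in> carrier G" for g using that \<open>\<And>g. g \<in> carrier G \<Longrightarrow> x g \<noteq> y g \<Longrightarrow> thesis\<close> by blast
    then have "x = y" using xy X unfolding full_shift_def by (intro PiE_ext [of x "carrier G" "\<lambda>_. B" y]) auto
    then show False using xy by simp
  qed
  define K' where "K' = insert \<one>\<^bsub>G\<^esub> (K \<union> m_inv G ` K)"
  have "si_subshift G B X K' (x g) (y g)"
  proof (unfold_locales)
    show "infinite (carrier G)" "finite B" "X \<subseteq> carrier G \<rightarrow>\<^sub>E B"
      using assms X by (simp_all add: subshift_def full_shift_def)
    show "x \<in> X" if "x \<in> extensional (carrier G)"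
      "\<And>W. finite W \<Longrightarrow> W \<subseteq> carrier G \<Longrightarrow> \<exists>y\<in>X. \<forall>w\<in>W. y w = x w" for x
      using assms(2) that by (rule subshift_limit)
    show "translate G h x \<in> X" if "h \<in> carrier G" "x \<in> X" for h x using that by (rule tr)
    show "finite K'" "K' \<subseteq> carrier G" "\<one>\<^bsub>G\<^esub> \<in> K'" using K by (auto simp: K'_def)
    show "inv\<^bsub>G\<^esub> k \<in> K'" if "k \<in> K'" for k
      using that K(2) by (auto simp: K'_def subset_iff)
    show "\<exists>z\<in>X. (\<forall>s\<in>S. z s = a s) \<and> (\<forall>t\<in>T. z t = b t)"
      if st: "finite S" "S \<subseteq> carrier G" "finite T" "T \<subseteq> carrier G" "(S <#>\<^bsub>G\<^esub> K') \<inter> T = {}" "a \<in> X" "b \<in> X" for S T a b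
    proof -
      have "(S <#>\<^bsub>G\<^esub> K) \<inter> T = {}" using st(5) by (auto simp: K'_def set_mult_def)
      moreover have "restrict a S \<in> patterns S X" "restrict b T \<in> patterns T X"
        using st(6,7) by (simp_all add: patterns_def)
      ultimately obtain z where z: "z \<in> X" "restrict z S = restrict a S" "restrict z T = restrict b T"
        using si st(1-4) by meson
      have "z s = a s" if s: "s \<in> S" for s using fun_cong [OF z(2), of s] s by simp
      moreover have "z t = b t" if t: "t \<in> T" for t using fun_cong [OF z(3), of t] t by simp
      ultimately show ?thesis using z(1) by blast
    qed
    show "x g \<noteq> y g" by (rule g)
    show "\<exists>z\<in>X. z \<one>\<^bsub>G\<^esub> = x g" using tr [OF g(1) xy(1)] g(1) by (intro bexI [of _ "translate G g x"]) (simp_all add: translate_def)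
    show "\<exists>z\<in>X. z \<one>\<^bsub>G\<^esub> = y g" using tr [OF g(1) xy(2)] g(1) by (intro bexI [of _ "translate G g y"]) (simp_all add: translate_def)
  qed
  then show ?thesis by blast
qed

lemma marker_exists:
  assumes "si_subshift G B X K \<alpha> \<beta>" "finite L"
  shows "\<exists>S F p enc. marker G B X K \<alpha> \<beta> S F p L enc"
proof -
  interpret si_subshift G B X K \<alpha> \<beta> by fact
  obtain S F p where S: "finite S" "S \<subseteq> carrier G" "finite F" "F \<subseteq> carrier G" "S \<inter> F = {}" "p \<in> X"
    and ker: "\<And>n f. n \<in> act_kernel \<Longrightarrow> f \<in> F \<Longrightarrow> n \<otimes>\<^bsub>G\<^esub> f \<in> F"
    and c: "card L \<le> card ((\<lambda>z. restrict z F) ` {z \<in> X. \<forall>s\<in>S. z s = p s})"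
    and sw: "\<And>y z. y \<in> X \<Longrightarrow> z \<in> X \<Longrightarrow> \<forall>s\<in>S. y s = p s \<Longrightarrow> \<forall>s\<in>S. z s = p s \<Longrightarrow> override_on y z F \<in> X"
    and iso: "\<And>e z. e \<in> quotients (S \<union> F) <#>\<^bsub>G\<^esub> quotients (S \<union> F) \<Longrightarrow> e \<notin> act_kernel \<Longrightarrow>
      \<exists>s\<in>S. override_on p z F (e \<otimes>\<^bsub>G\<^esub> s) \<noteq> p s"
    by (fact isolated_marker)
  have "finite ((\<lambda>z. restrict z F) ` {z \<in> X. \<forall>s\<in>S. z s = p s})"
    by (rule finite_subset [OF _ finite_patterns [OF S(3,4)]]) auto
  from card_le_inj [OF assms(2) this c]
  obtain enc where enc: "enc ` L \<subseteq> (\<lambda>z. restrict z F) ` {z \<in> X. \<forall>s\<in>S. z s = p s}" "inj_on enc L"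
    by blast
  have "marker G B X K \<alpha> \<beta> S F p L enc"
  proof (unfold_locales)
    show "finite S" "S \<subseteq> carrier G" "finite F" "F \<subseteq> carrier G" "S \<inter> F = {}" "p \<in> X" "inj_on enc L"
      by fact+
    show "n \<otimes>\<^bsub>G\<^esub> f \<in> F" if "n \<in> act_kernel" "f \<in> F" for n f using that by (rule ker)
    show "\<exists>z\<in>X. (\<forall>s\<in>S. z s = p s) \<and> enc l = restrict z F" if "l \<in> L" for l
      using enc(1) that by blast
    show "override_on y z F \<in> X"
      if "y \<in> X" "z \<in> X" "\<forall>s\<in>S. y s = p s" "\<forall>s\<in>S. z s = p s" for y z using that by (rule sw)
    show "\<exists>s\<in>S. override_on p z F (e \<otimes>\<^bsub>G\<^esub> s) \<noteq> p s"
      if "z \<in> X" "e \<in> quotients (S \<union> F) <#>\<^bsub>G\<^esub> quotients (S \<union> F)" "e \<notin> act_kernel" for z e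
      using that(2,3) by (rule iso)
  qed
  then show ?thesis by blast
qed

text \<open>The set to be avoided depends on the marker, and the marker depends on \<open>A\<close>;
  so \<open>\<phi>\<close> is chosen last, and \<open>avoid\<close> has to cover all finite
  sets.\<close>

lemma embeds_Aut_shift:
  fixes G :: "('g, 'm) monoid_scheme" and H :: "('h, 'n) monoid_scheme" and A :: "'a set"
  assumes G: "group G" "subshift G B X" "nontrivial X" "strongly_irreducible G X" "infinite (carrier G)"
    and A: "finite A" and H: "group H" "\<theta> \<in> mon H (free_group k)"
    and avoid: "\<And>D. finite D \<Longrightarrow> \<exists>\<phi>\<in>hom (free_group k) G. \<forall>w\<in>carrier (free_group k). \<phi> w \<in> D \<longrightarrow> w = []"
  shows "embeds (Aut_shift H A (full_shift H A)) (Aut_shift G B X)"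
proof -
  obtain K \<alpha> \<beta> where si: "si_subshift G B X K \<alpha> \<beta>" using si_subshift_exists [OF G] by blast
  obtain S F p enc where marker: "marker G B X K \<alpha> \<beta> S F p (A \<times> A) enc"
    using marker_exists [OF si, of "A \<times> A"] A by blast
  have \<theta>: "\<theta> \<in> hom H (free_group k)" "inj_on \<theta> (carrier H)" using H(2) by (simp_all add: mon_def)
  have conveyor: "conveyor G B X K \<alpha> \<beta> S F p A enc H k \<theta> \<phi>" if "\<phi> \<in> hom (free_group k) G" for \<phi>
    by (rule conveyor.intro [OF marker conveyor_axioms.intro [OF H(1) \<theta>(1) that]])
  show ?thesis
  proof (cases "A = {}")
    case True
    obtain \<phi> where "\<phi> \<in> hom (free_group k) G" using avoid [of "{}"] by blast
    from conveyor.embeds_of_empty [OF conveyor [OF this] True] show ?thesis .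
  next
    case False
    then have L: "A \<times> A \<noteq> {}" by simp
    show ?thesis
    proof (rule marker.markers_exist [OF marker L])
      fix D
      assume D: "finite D" "si_subshift.act_kernel G X \<subseteq> D"
        and exist: "\<And>W. \<lbrakk>finite W; W \<subseteq> carrier G;
            \<And>w w'. w \<in> W \<Longrightarrow> w' \<in> W \<Longrightarrow> inv\<^bsub>G\<^esub> w \<otimes>\<^bsub>G\<^esub> w' \<in> D \<Longrightarrow> w = w'\<rbrakk>
          \<Longrightarrow> \<exists>x\<in>X. W \<subseteq> marker.markers G X S F p (A \<times> A) enc x"
      obtain \<phi> where \<phi>: "\<phi> \<in> hom (free_group k) G"
          "\<forall>w\<in>carrier (free_group k). \<phi> w \<in> D \<longrightarrow> w = []"
        using avoid [OF D(1)] by (rule bexE)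
      have "w = []" if "w \<in> carrier (free_group k)" "\<phi> w \<in> D" for w using \<phi>(2) that by blast
      with A D(2) show ?thesis
        using exist \<theta>(2) by (rule conveyor.embeds_of_separated [OF conveyor [OF \<phi>(1)]])
    qed
  qed
qed

theorem theorem3:
  fixes G :: "('g, 'm) monoid_scheme"
    and B :: "'b set" and X :: "('g \<Rightarrow> 'b) set" and A :: "'a set"
  assumes "group G"
    and "subshift G B X"
    and "nontrivial X"
    and "strongly_irreducible G X"
    and "finite A"
  shows "((\<exists>g \<in> carrier G. \<forall>n::nat. n > 0 \<longrightarrow> g [^]\<^bsub>G\<^esub> n \<noteq> \<one>\<^bsub>G\<^esub>) \<longrightarrow>
            embeds (Aut_shift integer_group A (full_shift integer_group A)) (Aut_shift G B X))
       \<and> (embeds (free_group 2) G \<longrightarrow>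
            (\<forall>k\<ge>1. embeds (Aut_shift (free_group k) A (full_shift (free_group k) A))
                         (Aut_shift G B X)))"
proof (intro conjI impI allI)
  interpret G: group G by fact
  \<comment> \<open>Both hypotheses provide an element of infinite order, and the marker
    construction needs infinitely many positions.\<close>
  have infinite: "infinite (carrier G)"
    if g: "g \<in> carrier G" "\<And>n::nat. n > 0 \<Longrightarrow> g [^]\<^bsub>G\<^esub> n \<noteq> \<one>\<^bsub>G\<^esub>" for g
  proof -
    have "range (\<lambda>n::nat. g [^]\<^bsub>G\<^esub> n) \<subseteq> carrier G" using g(1) by auto
    then show ?thesis
      using range_inj_infinite [OF G.infinite_order_inj [OF g]] finite_subset by blast
  qed
  {
    assume "\<exists>g \<in> carrier G. \<forall>n::nat. n > 0 \<longrightarrow> g [^]\<^bsub>G\<^esub> n \<noteq> \<one>\<^bsub>G\<^esub>"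
    then obtain g where g: "g \<in> carrier G" "\<And>n::nat. n > 0 \<Longrightarrow> g [^]\<^bsub>G\<^esub> n \<noteq> \<one>\<^bsub>G\<^esub>" by blast
    obtain \<theta> where \<theta>: "\<theta> \<in> mon integer_group (free_group 1)" using integer_group_mon_free_group by blast
    show "embeds (Aut_shift integer_group A (full_shift integer_group A)) (Aut_shift G B X)"
      using assms(1-4) infinite [OF g] assms(5) group_integer_group \<theta> G.free_group_1_hom_avoiding [OF g]
      by (rule embeds_Aut_shift)
  }
  fix k :: nat
  assume "embeds (free_group 2) G"
  then obtain \<psi> where \<psi>: "\<psi> \<in> hom (free_group 2) G" "inj_on \<psi> (carrier (free_group 2))"
    by (auto simp: embeds_def mon_def)
  interpret F2: group "free_group 2" by (rule group_free_group)
  interpret \<psi>: group_hom "free_group 2" G \<psi> using \<psi>(1) by unfold_locales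
  have a: "[(0, True)] \<in> carrier (free_group 2)" by (simp add: free_group_def reduced_word_def)
  have "\<psi> [(0, True)] [^]\<^bsub>G\<^esub> n \<noteq> \<one>\<^bsub>G\<^esub>" if "n > 0" for n :: nat
  proof
    assume "\<psi> [(0, True)] [^]\<^bsub>G\<^esub> n = \<one>\<^bsub>G\<^esub>"
    then have eq: "\<psi> ([(0, True)] [^]\<^bsub>free_group 2\<^esub> n) = \<psi> \<one>\<^bsub>free_group 2\<^esub>"
      using \<psi>.hom_nat_pow [OF a, of n] by simp
    have "[(0, True)] [^]\<^bsub>free_group 2\<^esub> n = \<one>\<^bsub>free_group 2\<^esub>"
      by (rule inj_onD [OF \<psi>(2) eq]) (simp_all add: a)
    then show False using that by (simp add: free_group_pow) (simp add: free_group_def)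
  qed
  then have inf: "infinite (carrier G)" using infinite [of "\<psi> [(0, True)]"] a by simp
  have id: "(\<lambda>w. w) \<in> mon (free_group k) (free_group k)" by (auto simp: mon_def hom_def)
  \<comment> \<open>Injectivity of \<open>\<psi>\<close> turns the finite set \<open>D\<close> into
    a finite set of words in rank 2; \<open>h\<close> avoids these words while passing from rank
    \<open>k\<close> to rank 2.\<close>
  have avoid: "\<exists>\<phi>\<in>hom (free_group k) G. \<forall>w\<in>carrier (free_group k). \<phi> w \<in> D \<longrightarrow> w = []"
    if D: "finite D" for D
  proof -
    have "finite (\<psi> -` D \<inter> carrier (free_group 2))" using D \<psi>(2) by (rule finite_vimage_IntI)
    from free_group_hom_avoiding [OF this, of k] obtain h where h: "h \<in> hom (free_group k) (free_group 2)"
      "\<forall>w\<in>carrier (free_group k). h w \<in> \<psi> -` D \<inter> carrier (free_group 2) \<longrightarrow> w = []" by blast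
    have "\<psi> \<circ> h \<in> hom (free_group k) G" using h(1) \<psi>(1) by (rule hom_compose)
    moreover have "w = []" if "w \<in> carrier (free_group k)" "(\<psi> \<circ> h) w \<in> D" for w
      using h that hom_in_carrier [OF h(1) that(1)] by auto
    ultimately show ?thesis by blast
  qed
  show "embeds (Aut_shift (free_group k) A (full_shift (free_group k) A)) (Aut_shift G B X)"
    using assms(1-4) inf assms(5) group_free_group id avoid by (rule embeds_Aut_shift)
qed

end
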